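(* Let $H$ be a finite-dimensional Hopf algebra over $\mathbb{C}$, and let $V$ be an inner faithful $H$-module vertex superalgebra such that the linear map $Y(z)\colon V\otimes V\to V((z))$, $u\otimes v\mapsto Y(u,z)v$, is injective. Then $H\cong\mathbb{C}[G]$ as Hopf algebras for some finite group $G$ of automorphisms of $V$ (i.e. a finite subgroup $G$ of $\mathrm{Aut}(V)$). In particular, $H$ is a group algebra.
   Context: All vector spaces and tensor products are over $\mathbb{C}$. A vector superspace is a $\mathbb{Z}_2$-graded vector space $V=V_{\bar 0}\oplus V_{\bar 1}$; homogeneous $u\in V_{\bar i}$ has $|u|=i$. A vertex superalgebra is a triple $(V,Y(\ ,z),\mathbf 1)$ with $V$ a vector superspace, $\mathbf 1\in V_{\bar 0}$, and a linear map $V\to \mathrm{End}_{\mathbb{C}}(V)[[z,z^{-1}]]$, $v\mapsto Y(v,z)=\sum_{n\in\mathbb{Z}}v_nz^{-n-1}$, such that: (1) for $u,v\in V$, $u_nv=0$ for $n\gg0$; (2) $Y(\mathbf 1,z)=\mathrm{id}_V$ and $Y(v,z)\mathbf 1=v+(v_{-2}\mathbf 1)z+\cdots\in V[[z]]$; (3) $u_nv\in V_{\alpha+\beta}$ for $u\in V_\alpha$, $v\in V_\beta$, $n\in\mathbb{Z}$; (4) for homogeneous $u,v,w$, $$z_0^{-1}\delta\left(\tfrac{z_1-z_2}{z_0}\right)Y(u,z_1)Y(v,z_2)w-(-1)^{|u||v|}z_0^{-1}\delta\left(\tfrac{z_2-z_1}{-z_0}\right)Y(v,z_2)Y(u,z_1)w=z_2^{-1}\delta\left(\tfrac{z_1-z_0}{z_2}\right)Y(Y(u,z_0)v,z_2)w,$$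 where $\delta(z)=\sum_{n\in\mathbb{Z}}z^n$ and binomial powers are expanded in nonnegative powers of the second variable. An automorphism of $V$ is an even (parity-preserving) invertible linear map $g\colon V\to V$ with $g(\mathbf 1)=\mathbf 1$ and $gY(u,z)g^{-1}=Y(gu,z)$ for all $u\in V$; $\mathrm{Aut}(V)$ is the group of automorphisms. Let $H$ be a Hopf algebra with comultiplication $\Delta(h)=\sum h_1\otimes h_2$, counit $\epsilon$, antipode $S$. $V$ is an $H$-module vertex superalgebra ($H$ acts on $V$) if: (1) $V$ is an $H$-module with $HV_\alpha\subseteq V_\alpha$ for $\alpha\in\mathbb{Z}_2$; (2) $h\mathbf 1=\epsilon(h)\mathbf 1$ for $h\in H$; (3) $h(Y(u,z)v)=\sum Y(h_1u,z)h_2v$ for $h\in H$, $u,v\in V$. A Hopf ideal of $H$ is a subspace $I$ with $IH\subseteq I$, $HI\subseteq I$, $\Delta(I)\subseteq H\otimes I+I\otimes H$, $\epsilon(I)=0$ and $S(I)\subseteq I$. The action of $H$ on $V$ is inner faithful if $IV\ne0$ for every nonzero Hopf ideal $I$ of $H$. The group algebra $\mathbb{C}[G]$ has its usual Hopf structure $\Delta(g)=g\otimes g$, $\epsilon(g)=1$, $S(g)=g^{-1}$ for $g\in G$. *)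

theory Defs
  imports
    Complex_Main
    "HOL-Algebra.Group"
    "HOL-Library.Z2"
    "HOL-Library.Poly_Mapping"
    "HOL-Library.Groups_Big_Fun"
    "HOL-Computational_Algebra.Formal_Laurent_Series"
begin

section \<open>Complex vector spaces\<close>

class complex_vector = ab_group_add +
  fixes scaleC :: "complex \<Rightarrow> 'a \<Rightarrow> 'a"  (infixr \<open>*\<^sub>C\<close> 75)
  assumes scaleC_add_right: "a *\<^sub>C (x + y) = a *\<^sub>C x + a *\<^sub>C y"
    and scaleC_add_left: "(a + b) *\<^sub>C x = a *\<^sub>C x + b *\<^sub>C x"
    and scaleC_scaleC: "a *\<^sub>C (b *\<^sub>C x) = (a * b) *\<^sub>C x"
    and scaleC_one: "1 *\<^sub>C x = x"

global_interpretation cvs: vector_space "scaleC :: complex \<Rightarrow> 'a \<Rightarrow> 'a :: complex_vector"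
  by unfold_locales
    (rule scaleC_add_right scaleC_add_left scaleC_scaleC scaleC_one)+

instantiation complex :: complex_vector
begin
definition scaleC_complex :: "complex \<Rightarrow> complex \<Rightarrow> complex"
  where "scaleC_complex a x = a * x"
instance
  by standard (simp_all add: scaleC_complex_def algebra_simps)
end

instantiation poly_mapping :: (type, complex_vector) complex_vector
begin
lift_definition scaleC_poly_mapping ::
  "complex \<Rightarrow> ('a \<Rightarrow>\<^sub>0 'b) \<Rightarrow> ('a \<Rightarrow>\<^sub>0 'b)" is "\<lambda>c f x. c *\<^sub>C f x"
  by (erule rev_finite_subset) auto
instance
  by standard
    (transfer, simp add: cvs.scale_right_distrib cvs.scale_left_distrib)+
end

instantiation fls :: (complex_vector) complex_vector
begin
lift_definition scaleC_fls :: "complex \<Rightarrow> 'a fls \<Rightarrow> 'a fls" is "\<lambda>c f n. c *\<^sub>C f n"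
  by (erule MOST_rev_mp) (auto intro!: always_eventually)
instance
  by standard
    (transfer, simp add: cvs.scale_right_distrib cvs.scale_left_distrib)+
end

definition clinear_on :: "'a::complex_vector set \<Rightarrow> ('a \<Rightarrow> 'b::complex_vector) \<Rightarrow> bool" where
  "clinear_on A f \<longleftrightarrow>
     (\<forall>x\<in>A. \<forall>y\<in>A. f (x + y) = f x + f y) \<and> (\<forall>c. \<forall>x\<in>A. f (c *\<^sub>C x) = c *\<^sub>C f x)"

definition bilinear_on ::
  "'a::complex_vector set \<Rightarrow> 'b::complex_vector set \<Rightarrow> ('a \<Rightarrow> 'b \<Rightarrow> 'c::complex_vector) \<Rightarrow> bool"
where
  "bilinear_on A B b \<longleftrightarrow>
     (\<forall>v\<in>B. clinear_on A (\<lambda>u. b u v)) \<and> (\<forall>u\<in>A. clinear_on B (b u))"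


section \<open>Tensor products\<close>

text \<open>The tensor product of two types is the free complex vector space on pairs modulo the
  bilinearity relations.\<close>

abbreviation pair_basis :: "'a \<Rightarrow> 'b \<Rightarrow> ('a \<times> 'b) \<Rightarrow>\<^sub>0 complex"
  where "pair_basis u v \<equiv> Poly_Mapping.single (u, v) 1"

definition tensor_relators ::
  "(('a::complex_vector \<times> 'b::complex_vector) \<Rightarrow>\<^sub>0 complex) set" where
  "tensor_relators =
     {pair_basis (u + u') v - pair_basis u v - pair_basis u' v | u u' v. True} \<union>
     {pair_basis u (v + v') - pair_basis u v - pair_basis u v' | u v v'. True} \<union>
     {pair_basis (c *\<^sub>C u) v - c *\<^sub>C pair_basis u v | c u v. True} \<union>
     {pair_basis u (c *\<^sub>C v) - c *\<^sub>C pair_basis u v | c u v. True}"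

definition tensor_rel ::
  "(('a::complex_vector \<times> 'b::complex_vector) \<Rightarrow>\<^sub>0 complex) \<Rightarrow>
   (('a \<times> 'b) \<Rightarrow>\<^sub>0 complex) \<Rightarrow> bool" where
  "tensor_rel x y \<longleftrightarrow> x - y \<in> cvs.span tensor_relators"

quotient_type (overloaded) ('a, 'b) tensor =
  "('a::complex_vector \<times> 'b::complex_vector) \<Rightarrow>\<^sub>0 complex" / tensor_rel
proof (rule equivpI)
  show "reflp (tensor_rel :: (('a \<times> 'b) \<Rightarrow>\<^sub>0 complex) \<Rightarrow> _)"
    by (rule reflpI) (simp add: tensor_rel_def cvs.span_zero)
  show "symp (tensor_rel :: (('a \<times> 'b) \<Rightarrow>\<^sub>0 complex) \<Rightarrow> _)"
    by (rule sympI) (unfold tensor_rel_def, drule cvs.span_neg, simp)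
  show "transp (tensor_rel :: (('a \<times> 'b) \<Rightarrow>\<^sub>0 complex) \<Rightarrow> _)"
    by (rule transpI) (unfold tensor_rel_def, drule (1) cvs.span_add, simp)
qed

instantiation tensor :: (complex_vector, complex_vector) complex_vector
begin
lift_definition zero_tensor :: "('a, 'b) tensor" is 0 .
lift_definition plus_tensor :: "('a, 'b) tensor \<Rightarrow> ('a, 'b) tensor \<Rightarrow> ('a, 'b) tensor" is "(+)"
  unfolding tensor_rel_def by (simp add: add_diff_add cvs.span_add)
lift_definition uminus_tensor :: "('a, 'b) tensor \<Rightarrow> ('a, 'b) tensor" is "uminus"
  unfolding tensor_rel_def by (drule cvs.span_neg) (simp add: algebra_simps)
lift_definition minus_tensor :: "('a, 'b) tensor \<Rightarrow> ('a, 'b) tensor \<Rightarrow> ('a, 'b) tensor" is "(-)"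
  unfolding tensor_rel_def
  by (drule (1) cvs.span_diff) (simp add: algebra_simps)
lift_definition scaleC_tensor :: "complex \<Rightarrow> ('a, 'b) tensor \<Rightarrow> ('a, 'b) tensor" is "scaleC"
  unfolding tensor_rel_def by (drule cvs.span_scale) (simp add: cvs.scale_right_diff_distrib)
instance
  by standard
    (transfer, simp add: tensor_rel_def cvs.span_zero
        cvs.scale_right_distrib cvs.scale_left_distrib)+
end

lift_definition tens :: "'a::complex_vector \<Rightarrow> 'b::complex_vector \<Rightarrow> ('a, 'b) tensor"
  (infixl \<open>\<otimes>\<^sub>C\<close> 72) is pair_basis .

text \<open>For subspaces \<open>A\<close> and \<open>B\<close> of the ambient types, \<open>A \<otimes> B\<close> is identified with its image in the
  tensor product of the types (the canonical map is injective over a field).\<close>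

definition tensor_space ::
  "'a::complex_vector set \<Rightarrow> 'b::complex_vector set \<Rightarrow> ('a, 'b) tensor set" where
  "tensor_space A B = cvs.span {u \<otimes>\<^sub>C v | u v. u \<in> A \<and> v \<in> B}"

text \<open>\<open>tensor_lift A B b\<close> is the linear map on \<open>A \<otimes> B\<close> that sends \<open>u \<otimes> v\<close> to \<open>b u v\<close>, for \<open>b\<close>
  bilinear on \<open>A \<times> B\<close>: rewrite the argument as a formal sum of pairs from \<open>A \<times> B\<close> and apply \<open>b\<close> to each
  pair. The theorems \<open>tensor_lift_tens\<close> and \<open>clinear_on_tensor_lift\<close> below show that
  the value does not depend on the choice. In Sweedler notation,
  \<open>tensor_lift A A b (\<Delta> h) = \<Sum> b h\<^sub>1 h\<^sub>2\<close>.\<close>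

definition formal_eval ::
  "('a \<Rightarrow> 'b \<Rightarrow> 'c::complex_vector) \<Rightarrow> (('a \<times> 'b) \<Rightarrow>\<^sub>0 complex) \<Rightarrow> 'c" where
  "formal_eval b x =
     (\<Sum>p\<in>Poly_Mapping.keys x. Poly_Mapping.lookup x p *\<^sub>C b (fst p) (snd p))"

definition tensor_lift ::
  "'a::complex_vector set \<Rightarrow> 'b::complex_vector set \<Rightarrow>
   ('a \<Rightarrow> 'b \<Rightarrow> 'c::complex_vector) \<Rightarrow> ('a, 'b) tensor \<Rightarrow> 'c" where
  "tensor_lift A B b t =
     formal_eval b (SOME x. Poly_Mapping.keys x \<subseteq> A \<times> B \<and> abs_tensor x = t)"


lemma clinear_on_UNIV_iff: "clinear_on UNIV f \<longleftrightarrow> Vector_Spaces.linear scaleC scaleC f"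
  by (auto simp: clinear_on_def Vector_Spaces.linear_def module_hom_def module_hom_axioms_def
      cvs.module_axioms cvs.vector_space_axioms)

lemma formal_eval_superset:
  assumes "finite S" "Poly_Mapping.keys x \<subseteq> S"
  shows "formal_eval b x = (\<Sum>p\<in>S. Poly_Mapping.lookup x p *\<^sub>C b (fst p) (snd p))"
  unfolding formal_eval_def
  by (rule sum.mono_neutral_left) (use assms in \<open>auto simp: in_keys_iff\<close>)

lemma lookup_scaleC [simp]: "Poly_Mapping.lookup (c *\<^sub>C x) k = c *\<^sub>C Poly_Mapping.lookup x k"
  by transfer simp

lemma keys_scaleC_subset: "Poly_Mapping.keys (c *\<^sub>C x) \<subseteq> Poly_Mapping.keys x"
  by (auto simp: in_keys_iff)

lemma formal_eval_add: "formal_eval b (x + y) = formal_eval b x + formal_eval b y"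
proof -
  let ?S = "Poly_Mapping.keys x \<union> Poly_Mapping.keys y"
  have "formal_eval b (x + y) =
      (\<Sum>p\<in>?S. Poly_Mapping.lookup (x + y) p *\<^sub>C b (fst p) (snd p))"
    by (rule formal_eval_superset) (use Poly_Mapping.keys_add[of x y] in auto)
  also have "\<dots> = formal_eval b x + formal_eval b y"
    by (simp add: formal_eval_superset[of ?S] lookup_add cvs.scale_left_distrib sum.distrib)
  finally show ?thesis .
qed

lemma formal_eval_scaleC: "formal_eval b (c *\<^sub>C x) = c *\<^sub>C formal_eval b x"
  using formal_eval_superset[OF finite_keys keys_scaleC_subset, of b c x]
  by (simp add: formal_eval_def cvs.scale_sum_right scaleC_complex_def)

lemma formal_eval_linear: "Vector_Spaces.linear scaleC scaleC (formal_eval b)"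
  by (simp add: clinear_on_UNIV_iff[symmetric] clinear_on_def formal_eval_add formal_eval_scaleC)

lemma formal_eval_diff: "formal_eval b (x - y) = formal_eval b x - formal_eval b y"
  using formal_eval_add[of b "x - y" y] by simp

lemma formal_eval_pair_basis: "formal_eval b (pair_basis u v) = b u v"
  by (simp add: formal_eval_def)

lemma formal_eval_relators:
  assumes "bilinear_on UNIV UNIV b" "x \<in> cvs.span tensor_relators"
  shows "formal_eval b x = 0"
  using assms(2)
proof (induction rule: cvs.span_induct_alt)
  case base
  show ?case by (simp add: formal_eval_def)
next
  case (step c x y)
  have "formal_eval b x = 0"
    using step(1) assms(1)
    by (auto simp: tensor_relators_def formal_eval_diff formal_eval_pair_basis formal_eval_scaleC
        bilinear_on_def clinear_on_def)
  then show ?case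
    using step by (simp add: formal_eval_add formal_eval_scaleC)
qed

lemma subspace_projection:
  assumes "cvs.subspace (A :: 'a::complex_vector set)"
  obtains p where "clinear_on UNIV p" "range p \<subseteq> A" "\<And>x. x \<in> A \<Longrightarrow> p x = x"
proof -
  interpret vector_space_pair "scaleC :: complex \<Rightarrow> 'a \<Rightarrow> 'a" "scaleC :: complex \<Rightarrow> 'a \<Rightarrow> 'a" ..
  have "\<exists>g. range g \<subseteq> A \<and> Vector_Spaces.linear scaleC scaleC g \<and> (\<forall>v\<in>A. g (id v) = v)"
    using linear_exists_left_inverse_on[OF cvs.linear_id assms] by simp
  then show thesis
    using that by (auto simp: clinear_on_UNIV_iff)
qed

lemma bilinear_on_extension:
  assumes "cvs.subspace A" "cvs.subspace B" "bilinear_on A B b"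
  obtains b' where "bilinear_on UNIV UNIV b'" "\<And>u v. u \<in> A \<Longrightarrow> v \<in> B \<Longrightarrow> b' u v = b u v"
proof -
  obtain p where p: "clinear_on UNIV p" "range p \<subseteq> A" "\<And>x. x \<in> A \<Longrightarrow> p x = x"
    using subspace_projection[OF assms(1)] by metis
  obtain q where q: "clinear_on UNIV q" "range q \<subseteq> B" "\<And>x. x \<in> B \<Longrightarrow> q x = x"
    using subspace_projection[OF assms(2)] by metis
  have "p u \<in> A" "q v \<in> B" for u v
    using p(2) q(2) by auto
  then have "bilinear_on UNIV UNIV (\<lambda>u v. b (p u) (q v))"
    using p(1) q(1) assms(3) by (simp add: bilinear_on_def clinear_on_def)
  then show thesis
    using that p(3) q(3) by metis
qed

lemma abs_tensor_pair_basis: "abs_tensor (pair_basis u v) = u \<otimes>\<^sub>C v"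
  by (simp add: tens.abs_eq)

lemma tensor_space_rep:
  assumes "t \<in> tensor_space A B" "cvs.subspace A"
  shows "\<exists>x. Poly_Mapping.keys x \<subseteq> A \<times> B \<and> abs_tensor x = t"
  using assms(1) unfolding tensor_space_def
proof (induction rule: cvs.span_induct_alt)
  case base
  show ?case by (rule exI[of _ 0]) (simp add: zero_tensor.abs_eq)
next
  case (step c s t)
  then obtain u v x where s: "s = u \<otimes>\<^sub>C v" "u \<in> A" "v \<in> B"
    and x: "Poly_Mapping.keys x \<subseteq> A \<times> B" "abs_tensor x = t"
    by auto
  have "Poly_Mapping.keys (c *\<^sub>C pair_basis u v + x) \<subseteq> A \<times> B"
    using s x keys_scaleC_subset[of c "pair_basis u v"]
      Poly_Mapping.keys_add[of "c *\<^sub>C pair_basis u v" x] by auto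
  moreover have "abs_tensor (c *\<^sub>C pair_basis u v + x) = c *\<^sub>C s + t"
    by (simp add: s x(2)[symmetric] abs_tensor_pair_basis[symmetric] plus_tensor.abs_eq
        scaleC_tensor.abs_eq)
  ultimately show ?case by blast
qed

lemma tensor_lift_eq_formal_eval:
  assumes "cvs.subspace A" "cvs.subspace B" "bilinear_on A B b"
    and x: "Poly_Mapping.keys x \<subseteq> A \<times> B"
  shows "tensor_lift A B b (abs_tensor x) = formal_eval b x"
proof -
  obtain b' where b': "bilinear_on UNIV UNIV b'" "\<And>u v. u \<in> A \<Longrightarrow> v \<in> B \<Longrightarrow> b' u v = b u v"
    using bilinear_on_extension[OF assms(1-3)] by metis
  define y where "y = (SOME y. Poly_Mapping.keys y \<subseteq> A \<times> B \<and> abs_tensor y = abs_tensor x)"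
  have y: "Poly_Mapping.keys y \<subseteq> A \<times> B \<and> abs_tensor y = abs_tensor x"
    unfolding y_def by (rule someI[of _ x]) (use x in simp)
  have eq: "formal_eval b z = formal_eval b' z" if "Poly_Mapping.keys z \<subseteq> A \<times> B" for z
    unfolding formal_eval_def by (rule sum.cong) (use that b'(2) in \<open>auto simp: subset_iff\<close>)
  have "y - x \<in> cvs.span tensor_relators"
    using y by (simp add: tensor.abs_eq_iff tensor_rel_def)
  then have "formal_eval b' y = formal_eval b' x"
    using formal_eval_relators[OF b'(1), of "y - x"] by (simp add: formal_eval_diff)
  then show ?thesis
    using eq x y by (simp add: tensor_lift_def y_def)
qed

theorem tensor_lift_tens:
  assumes "cvs.subspace A" "cvs.subspace B" "bilinear_on A B b" "u \<in> A" "v \<in> B"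
  shows "tensor_lift A B b (u \<otimes>\<^sub>C v) = b u v"
  using tensor_lift_eq_formal_eval[OF assms(1-3), of "pair_basis u v"] assms(4,5)
  by (simp add: abs_tensor_pair_basis formal_eval_pair_basis)

theorem clinear_on_tensor_lift:
  assumes "cvs.subspace A" "cvs.subspace B" "bilinear_on A B b"
  shows "clinear_on (tensor_space A B) (tensor_lift A B b)"
  unfolding clinear_on_def
proof (intro conjI ballI allI)
  note lift = tensor_lift_eq_formal_eval[OF assms]
  fix s assume "s \<in> tensor_space A B"
  then obtain x where x: "Poly_Mapping.keys x \<subseteq> A \<times> B" "abs_tensor x = s"
    using tensor_space_rep assms(1) by blast
  {
    fix t assume "t \<in> tensor_space A B"
    then obtain y where y: "Poly_Mapping.keys y \<subseteq> A \<times> B" "abs_tensor y = t"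
      using tensor_space_rep assms(1) by blast
    have "Poly_Mapping.keys (x + y) \<subseteq> A \<times> B"
      using Poly_Mapping.keys_add[of x y] x y by blast
    from lift[OF this] show "tensor_lift A B b (s + t) = tensor_lift A B b s + tensor_lift A B b t"
      using x y lift[OF x(1)] lift[OF y(1)]
      by (simp add: formal_eval_add plus_tensor.abs_eq[symmetric])
  }
  fix c
  have "Poly_Mapping.keys (c *\<^sub>C x) \<subseteq> A \<times> B"
    using keys_scaleC_subset[of c x] x by blast
  from lift[OF this] show "tensor_lift A B b (c *\<^sub>C s) = c *\<^sub>C tensor_lift A B b s"
    using x lift[OF x(1)] by (simp add: formal_eval_scaleC scaleC_tensor.abs_eq[symmetric])
qed


section \<open>Hopf algebras\<close>

text \<open>A Hopf algebra lives on a subspace of its ambient type, so that group algebras of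
  subgroups are covered. Only the values of the operations on the carrier matter.\<close>

record (overloaded) ('a::complex_vector) hopf = "'a monoid" +
  comult :: "'a \<Rightarrow> ('a, 'a) tensor"
  counit :: "'a \<Rightarrow> complex"
  antipode :: "'a \<Rightarrow> 'a"

definition tensor_mult :: "('a::complex_vector, 'm) hopf_scheme \<Rightarrow>
    ('a, 'a) tensor \<Rightarrow> ('a, 'a) tensor \<Rightarrow> ('a, 'a) tensor" where
  "tensor_mult H s t =
     tensor_lift (carrier H) (carrier H) (\<lambda>a b.
       tensor_lift (carrier H) (carrier H) (\<lambda>c d. (a \<otimes>\<^bsub>H\<^esub> c) \<otimes>\<^sub>C (b \<otimes>\<^bsub>H\<^esub> d)) t) s"

definition tensor_assoc :: "'a::complex_vector set \<Rightarrow>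
    (('a, 'a) tensor, 'a) tensor \<Rightarrow> ('a, ('a, 'a) tensor) tensor" where
  "tensor_assoc A =
     tensor_lift (tensor_space A A) A (\<lambda>t c. tensor_lift A A (\<lambda>a b. a \<otimes>\<^sub>C (b \<otimes>\<^sub>C c)) t)"

locale hopf_algebra = monoid H for H :: "('a::complex_vector, 'm) hopf_scheme" (structure) +
  assumes subspace_carrier: "cvs.subspace (carrier H)"
    and mult_bilinear: "bilinear_on (carrier H) (carrier H) (\<lambda>x y. x \<otimes> y)"
    and comult_closed: "comult H \<in> carrier H \<rightarrow> tensor_space (carrier H) (carrier H)"
    and comult_linear: "clinear_on (carrier H) (comult H)"
    and counit_linear: "clinear_on (carrier H) (counit H)"
    and coassoc: "h \<in> carrier H \<Longrightarrow>
      tensor_assoc (carrier H)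
        (tensor_lift (carrier H) (carrier H) (\<lambda>a b. comult H a \<otimes>\<^sub>C b) (comult H h)) =
      tensor_lift (carrier H) (carrier H) (\<lambda>a b. a \<otimes>\<^sub>C comult H b) (comult H h)"
    and counit_left: "h \<in> carrier H \<Longrightarrow>
      tensor_lift (carrier H) (carrier H) (\<lambda>a b. counit H a *\<^sub>C b) (comult H h) = h"
    and counit_right: "h \<in> carrier H \<Longrightarrow>
      tensor_lift (carrier H) (carrier H) (\<lambda>a b. counit H b *\<^sub>C a) (comult H h) = h"
    and comult_mult: "\<lbrakk>h \<in> carrier H; k \<in> carrier H\<rbrakk> \<Longrightarrow>
      comult H (h \<otimes> k) = tensor_mult H (comult H h) (comult H k)"
    and comult_one: "comult H \<one> = \<one> \<otimes>\<^sub>C \<one>"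
    and counit_mult: "\<lbrakk>h \<in> carrier H; k \<in> carrier H\<rbrakk> \<Longrightarrow>
      counit H (h \<otimes> k) = counit H h * counit H k"
    and counit_one: "counit H \<one> = 1"
    and antipode_closed: "antipode H \<in> carrier H \<rightarrow> carrier H"
    and antipode_linear: "clinear_on (carrier H) (antipode H)"
    and antipode_left: "h \<in> carrier H \<Longrightarrow>
      tensor_lift (carrier H) (carrier H) (\<lambda>a b. antipode H a \<otimes> b) (comult H h) =
      counit H h *\<^sub>C \<one>"
    and antipode_right: "h \<in> carrier H \<Longrightarrow>
      tensor_lift (carrier H) (carrier H) (\<lambda>a b. a \<otimes> antipode H b) (comult H h) =
      counit H h *\<^sub>C \<one>"

definition finite_dim :: "'a::complex_vector set \<Rightarrow> bool" where
  "finite_dim A \<longleftrightarrow> (\<exists>B. finite B \<and> cvs.span B = A)"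

definition hopf_ideal :: "('a::complex_vector, 'm) hopf_scheme \<Rightarrow> 'a set \<Rightarrow> bool" where
  "hopf_ideal H I \<longleftrightarrow>
     I \<subseteq> carrier H \<and> cvs.subspace I \<and>
     (\<forall>x\<in>I. \<forall>h\<in>carrier H. x \<otimes>\<^bsub>H\<^esub> h \<in> I \<and> h \<otimes>\<^bsub>H\<^esub> x \<in> I) \<and>
     (\<forall>x\<in>I. \<exists>s\<in>tensor_space (carrier H) I. \<exists>t\<in>tensor_space I (carrier H). comult H x = s + t) \<and>
     (\<forall>x\<in>I. counit H x = 0) \<and>
     (\<forall>x\<in>I. antipode H x \<in> I)"

definition hopf_iso ::
  "('a::complex_vector, 'm) hopf_scheme \<Rightarrow> ('b::complex_vector, 'n) hopf_scheme \<Rightarrow>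
   ('a \<Rightarrow> 'b) set" where
  "hopf_iso H K = {\<phi> \<in> iso H K.
     clinear_on (carrier H) \<phi> \<and> \<phi> \<one>\<^bsub>H\<^esub> = \<one>\<^bsub>K\<^esub> \<and>
     (\<forall>h\<in>carrier H.
        comult K (\<phi> h) = tensor_lift (carrier H) (carrier H) (\<lambda>a b. \<phi> a \<otimes>\<^sub>C \<phi> b) (comult H h) \<and>
        counit K (\<phi> h) = counit H h \<and>
        antipode K (\<phi> h) = \<phi> (antipode H h))}"

definition hopf_isomorphic ::
  "('a::complex_vector, 'm) hopf_scheme \<Rightarrow> ('b::complex_vector, 'n) hopf_scheme \<Rightarrow> bool" where
  "hopf_isomorphic H K \<longleftrightarrow> hopf_iso H K \<noteq> {}"

text \<open>The group algebra: an element \<open>f\<close> stands for the formal sum of the \<open>lookup f g\<close> multiples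
  of the group elements \<open>g\<close>, and all operations are the linear extensions of those on the group.\<close>

definition group_algebra :: "('g, 'm) monoid_scheme \<Rightarrow> ('g \<Rightarrow>\<^sub>0 complex) hopf" where
  "group_algebra G = \<lparr>
     carrier = {f. Poly_Mapping.keys f \<subseteq> carrier G},
     monoid.mult = (\<lambda>f f'. \<Sum>a\<in>Poly_Mapping.keys f. \<Sum>b\<in>Poly_Mapping.keys f'.
       Poly_Mapping.single (a \<otimes>\<^bsub>G\<^esub> b) (Poly_Mapping.lookup f a * Poly_Mapping.lookup f' b)),
     monoid.one = Poly_Mapping.single \<one>\<^bsub>G\<^esub> 1,
     comult = (\<lambda>f. \<Sum>a\<in>Poly_Mapping.keys f.
       Poly_Mapping.lookup f a *\<^sub>C (Poly_Mapping.single a 1 \<otimes>\<^sub>C Poly_Mapping.single a 1)),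
     counit = (\<lambda>f. \<Sum>a\<in>Poly_Mapping.keys f. Poly_Mapping.lookup f a),
     antipode = (\<lambda>f. \<Sum>a\<in>Poly_Mapping.keys f.
       Poly_Mapping.single (inv\<^bsub>G\<^esub> a) (Poly_Mapping.lookup f a))\<rparr>"


section \<open>Vertex superalgebras\<close>

locale vector_superspace =
  fixes par :: "bit \<Rightarrow> 'v::complex_vector set"
  assumes subspace_par: "cvs.subspace (par \<alpha>)"
    and par_disjoint: "par 0 \<inter> par 1 = {0}"
    and par_sum: "\<exists>a\<in>par 0. \<exists>b\<in>par 1. v = a + b"

definition koszul_sign :: "bit \<Rightarrow> bit \<Rightarrow> complex" where
  "koszul_sign \<alpha> \<beta> = (if \<alpha> = 1 \<and> \<beta> = 1 then -1 else 1)"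

text \<open>A formal distribution in three variables \<open>z\<^sub>0, z\<^sub>1, z\<^sub>2\<close> is given by its coefficients:
  \<open>F a b c\<close> is the coefficient of \<open>z\<^sub>0\<^sup>a z\<^sub>1\<^sup>b z\<^sub>2\<^sup>c\<close>. The sum in the product below has only finitely
  many nonzero terms in each of the three cases where it is used, by the truncation condition of a
  vertex superalgebra.\<close>

definition dist_mult ::
  "(int \<Rightarrow> int \<Rightarrow> int \<Rightarrow> complex) \<Rightarrow> (int \<Rightarrow> int \<Rightarrow> int \<Rightarrow> 'v::complex_vector) \<Rightarrow>
   int \<Rightarrow> int \<Rightarrow> int \<Rightarrow> 'v" where
  "dist_mult D F a b c = Sum_any (\<lambda>(i, j, k). D i j k *\<^sub>C F (a - i) (b - j) (c - k))"

text \<open>The coefficient of \<open>y\<^sup>j z\<^sup>k\<close> in \<open>(y - z)\<^sup>n\<close>, expanded in nonnegative powers of \<open>z\<close>.\<close>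

definition binomial_coeff :: "int \<Rightarrow> int \<Rightarrow> int \<Rightarrow> complex" where
  "binomial_coeff n j k =
     (if 0 \<le> k \<and> j + k = n then (-1) ^ nat k * (of_int n gchoose nat k) else 0)"

text \<open>The coefficient of \<open>x\<^sup>i y\<^sup>j z\<^sup>k\<close> in
  \<open>x\<^sup>-\<^sup>1 \<delta>((y - z) / (e x)) = (\<Sum>n. e\<^sup>-\<^sup>n x\<^sup>-\<^sup>n\<^sup>-\<^sup>1 (y - z)\<^sup>n)\<close>, where \<open>e\<close> is \<open>1\<close> or \<open>-1\<close>;
  the term that contributes is \<open>n = - i - 1\<close>.\<close>

definition delta_coeff :: "complex \<Rightarrow> int \<Rightarrow> int \<Rightarrow> int \<Rightarrow> complex" where
  "delta_coeff e i j k = e powi (i + 1) * binomial_coeff (- i - 1) j k"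

text \<open>\<open>Y u n v\<close> is the \<open>n\<close>-th product \<open>u\<^sub>n v\<close>, the coefficient of \<open>z\<^sup>-\<^sup>n\<^sup>-\<^sup>1\<close> in \<open>Y(u,z)v\<close>.\<close>

locale vertex_superalgebra = vector_superspace par
  for par :: "bit \<Rightarrow> 'v::complex_vector set" +
  fixes Y :: "'v \<Rightarrow> int \<Rightarrow> 'v \<Rightarrow> 'v" and vac :: 'v
  assumes vac_even: "vac \<in> par 0"
    and Y_bilinear: "bilinear_on UNIV UNIV (\<lambda>u. Y u n)"
    and truncation: "\<exists>N. \<forall>n\<ge>N. Y u n v = 0"
    and vacuum: "Y vac n v = (if n = -1 then v else 0)"
    and creation: "Y v (-1) vac = v" "0 \<le> n \<Longrightarrow> Y v n vac = 0"
    and Y_parity: "\<lbrakk>u \<in> par \<alpha>; v \<in> par \<beta>\<rbrakk> \<Longrightarrow> Y u n v \<in> par (\<alpha> + \<beta>)"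
    and jacobi: "\<lbrakk>u \<in> par \<alpha>; v \<in> par \<beta>; w \<in> par \<gamma>\<rbrakk> \<Longrightarrow>
      dist_mult (\<lambda>i j k. delta_coeff 1 i j k)
        (\<lambda>a b c. if a = 0 then Y u (- b - 1) (Y v (- c - 1) w) else 0) a b c
      - koszul_sign \<alpha> \<beta> *\<^sub>C dist_mult (\<lambda>i j k. delta_coeff (-1) i k j)
        (\<lambda>a b c. if a = 0 then Y v (- c - 1) (Y u (- b - 1) w) else 0) a b c
      = dist_mult (\<lambda>i j k. delta_coeff 1 k j i)
        (\<lambda>a b c. if b = 0 then Y (Y u (- a - 1) v) (- c - 1) w else 0) a b c"

definition vertex_aut ::
  "(bit \<Rightarrow> 'v::complex_vector set) \<Rightarrow> ('v \<Rightarrow> int \<Rightarrow> 'v \<Rightarrow> 'v) \<Rightarrow> 'v \<Rightarrow> ('v \<Rightarrow> 'v) monoid" where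
  "vertex_aut par Y vac = \<lparr>
     carrier = {g. clinear_on UNIV g \<and> bij g \<and> (\<forall>\<alpha>. g ` par \<alpha> \<subseteq> par \<alpha>) \<and> g vac = vac \<and>
       (\<forall>u n. g \<circ> Y u n \<circ> inv_into UNIV g = Y (g u) n)},
     monoid.mult = (\<circ>),
     monoid.one = id\<rparr>"

definition vertex_series :: "('v \<Rightarrow> int \<Rightarrow> 'v \<Rightarrow> 'v) \<Rightarrow> 'v \<Rightarrow> 'v \<Rightarrow> 'v::complex_vector fls" where
  "vertex_series Y u v = Abs_fls (\<lambda>n. Y u (- n - 1) v)"

text \<open>The linear map \<open>Y(z)\<close> from \<open>V \<otimes> V\<close> to \<open>V((z))\<close>.\<close>

definition vertex_map ::
  "('v \<Rightarrow> int \<Rightarrow> 'v \<Rightarrow> 'v) \<Rightarrow> ('v::complex_vector, 'v) tensor \<Rightarrow> 'v fls" where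
  "vertex_map Y = tensor_lift UNIV UNIV (vertex_series Y)"


section \<open>Hopf actions on vertex superalgebras\<close>

locale hopf_module_vertex_superalgebra =
  hopf_algebra H + vertex_superalgebra par Y vac
  for H :: "('h::complex_vector, 'm) hopf_scheme" (structure)
    and par :: "bit \<Rightarrow> 'v::complex_vector set"
    and Y :: "'v \<Rightarrow> int \<Rightarrow> 'v \<Rightarrow> 'v" and vac :: 'v +
  fixes act :: "'h \<Rightarrow> 'v \<Rightarrow> 'v"
  assumes act_bilinear: "bilinear_on (carrier H) UNIV act"
    and act_one: "act \<one> v = v"
    and act_mult: "\<lbrakk>h \<in> carrier H; k \<in> carrier H\<rbrakk> \<Longrightarrow> act (h \<otimes> k) v = act h (act k v)"
    and act_parity: "\<lbrakk>h \<in> carrier H; v \<in> par \<alpha>\<rbrakk> \<Longrightarrow> act h v \<in> par \<alpha>"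
    and act_vac: "h \<in> carrier H \<Longrightarrow> act h vac = counit H h *\<^sub>C vac"
    and act_Y: "h \<in> carrier H \<Longrightarrow>
      act h (Y u n v) =
      tensor_lift (carrier H) (carrier H) (\<lambda>a b. Y (act a u) n (act b v)) (comult H h)"

definition inner_faithful ::
  "('h::complex_vector, 'm) hopf_scheme \<Rightarrow> ('h \<Rightarrow> 'v::zero \<Rightarrow> 'v) \<Rightarrow> bool" where
  "inner_faithful H act \<longleftrightarrow>
     (\<forall>I. hopf_ideal H I \<and> I \<noteq> {0} \<longrightarrow> (\<exists>h\<in>I. \<exists>v. act h v \<noteq> 0))"

end

theory Submission
  imports Defs "HOL-Computational_Algebra.Fundamental_Theorem_Algebra"
begin

text \<open>Skew symmetry \<open>Y(u,z)v = \<plusminus>e\<^bsup>zD\<^esup>Y(v,-z)u\<close> and injectivity of \<open>Y(z)\<close> show that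
  \<open>\<Sum> h\<^sub>1u \<otimes> h\<^sub>2v = \<Sum> h\<^sub>2u \<otimes> h\<^sub>1v\<close> for all \<open>h\<close>, \<open>u\<close>, \<open>v\<close>, because the action commutes with
  \<open>x \<mapsto> x\<^sub>n\<one>\<close>. Injectivity also embeds \<open>V \<otimes> V\<close> into \<open>V((z))\<close>, so an element of \<open>H\<close> that annihilates \<open>V\<close>
  annihilates \<open>V \<otimes> V\<close>: the annihilator of \<open>V\<close> is a bi-ideal, hence a Hopf ideal in finite dimension,
  hence zero. So \<open>H\<close> acts faithfully on \<open>V \<otimes> V\<close> via \<open>H \<otimes> H\<close> and is cocommutative. A finite-dimensional
  cocommutative Hopf algebra over the complex numbers is spanned by its group-like elements,
  and these act on \<open>V\<close> as automorphisms.

  If \<open>V = 0\<close>, the annihilator of \<open>V\<close> is all of \<open>H\<close>, which is not a Hopf ideal; there the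
  augmentation ideal takes its place.\<close>

section \<open>Linear algebra on subspaces\<close>

text \<open>In skew symmetry the sign and the power of -1 depend only on the mode and on the
  parities of \<open>u\<close> and \<open>v\<close>, and the action preserves parities. So one
  scalar serves the pair (u, v) and all pairs (h1 u, h2 v), and it comes out of the Sweedler sum.
  The passage from cocommutativity to group-likes uses the dual algebra, which acts on H by h -> h1
  f(h2). Cocommutativity makes these operators commute. If the span W of the group-likes were
  proper, the operators would have a simultaneous eigenvector x modulo W, because the field is
  algebraically closed. Such an x has \<Delta>(x) = x \<otimes> c + \<Sum> g \<otimes> y(g), summed
  over the group-likes g; coassociativity makes c group-like and every y(g) skew primitive. Skew
  primitive elements lie in W, since there are no nonzero primitive ones: their powers would be
  independent in characteristic 0. The counit then puts x itself into W.\<close>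

lemma clinear_on_zero: "clinear_on A f \<Longrightarrow> 0 \<in> A \<Longrightarrow> f 0 = 0"
  unfolding clinear_on_def by (metis cvs.scale_zero_left)

lemma clinear_on_add: "clinear_on A f \<Longrightarrow> x \<in> A \<Longrightarrow> y \<in> A \<Longrightarrow> f (x + y) = f x + f y"
  by (simp add: clinear_on_def)

lemma clinear_on_scale: "clinear_on A f \<Longrightarrow> x \<in> A \<Longrightarrow> f (c *\<^sub>C x) = c *\<^sub>C f x"
  by (simp add: clinear_on_def)

lemma clinear_on_diff:
  assumes "clinear_on A f" "cvs.subspace A" "x \<in> A" "y \<in> A"
  shows "f (x - y) = f x - f y"
  using clinear_on_add[OF assms(1) cvs.subspace_diff[OF assms(2-4)] assms(4)] by simp

lemma clinear_on_sum:
  assumes "clinear_on A f" "cvs.subspace A" "\<And>i. i \<in> I \<Longrightarrow> g i \<in> A"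
  shows "f (\<Sum>i\<in>I. g i) = (\<Sum>i\<in>I. f (g i))"
  using assms(3)
proof (induction I rule: infinite_finite_induct)
  case (insert x F)
  then show ?case
    using assms by (simp add: clinear_on_add cvs.subspace_sum)
qed (use clinear_on_zero[OF assms(1) cvs.subspace_0[OF assms(2)]] in auto)

lemma clinear_on_subset: "clinear_on B f \<Longrightarrow> A \<subseteq> B \<Longrightarrow> clinear_on A f"
  unfolding clinear_on_def by blast

lemma clinear_on_compose:
  "clinear_on A f \<Longrightarrow> clinear_on B g \<Longrightarrow> f ` A \<subseteq> B \<Longrightarrow> clinear_on A (\<lambda>x. g (f x))"
  unfolding clinear_on_def by (simp add: image_subset_iff)

lemma clinear_on_ident: "clinear_on A (\<lambda>x. x)"
  by (simp add: clinear_on_def)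

lemma clinear_on_span_eq:
  assumes "clinear_on A f" "clinear_on A g" "cvs.subspace A" "S \<subseteq> A" "x \<in> cvs.span S"
    and "\<And>s. s \<in> S \<Longrightarrow> f s = g s"
  shows "f x = g x"
proof -
  \<comment> \<open>Membership in \<open>A\<close> is carried through the induction because
    \<open>f\<close> and \<open>g\<close> are linear only there.\<close>
  have "x \<in> A \<and> f x = g x"
    using assms(5)
  proof (induction rule: cvs.span_induct_alt)
    case base
    then show ?case
      using assms by (simp add: clinear_on_zero cvs.subspace_0)
  next
    case (step c x y)
    then show ?case
      using assms
      by (auto simp: clinear_on_add clinear_on_scale cvs.subspace_add cvs.subspace_scale subset_iff)
  qed
  then show ?thesis ..
qed

lemma bilinear_onI:
  assumes "\<And>u u' v. u \<in> A \<Longrightarrow> u' \<in> A \<Longrightarrow> v \<in> B \<Longrightarrow> b (u + u') v = b u v + b u' v"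
    and "\<And>u v v'. u \<in> A \<Longrightarrow> v \<in> B \<Longrightarrow> v' \<in> B \<Longrightarrow> b u (v + v') = b u v + b u v'"
    and "\<And>c u v. u \<in> A \<Longrightarrow> v \<in> B \<Longrightarrow> b (c *\<^sub>C u) v = c *\<^sub>C b u v"
    and "\<And>c u v. u \<in> A \<Longrightarrow> v \<in> B \<Longrightarrow> b u (c *\<^sub>C v) = c *\<^sub>C b u v"
  shows "bilinear_on A B b"
  using assms by (simp add: bilinear_on_def clinear_on_def)

lemma bilinear_onD:
  assumes "bilinear_on A B b"
  shows "u \<in> A \<Longrightarrow> u' \<in> A \<Longrightarrow> v \<in> B \<Longrightarrow> b (u + u') v = b u v + b u' v"
    and "u \<in> A \<Longrightarrow> v \<in> B \<Longrightarrow> v' \<in> B \<Longrightarrow> b u (v + v') = b u v + b u v'"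
    and "u \<in> A \<Longrightarrow> v \<in> B \<Longrightarrow> b (c *\<^sub>C u) v = c *\<^sub>C b u v"
    and "u \<in> A \<Longrightarrow> v \<in> B \<Longrightarrow> b u (c *\<^sub>C v) = c *\<^sub>C b u v"
  using assms by (simp_all add: bilinear_on_def clinear_on_def)

lemma bilinear_on_zero:
  assumes "bilinear_on A B b"
  shows "0 \<in> A \<Longrightarrow> v \<in> B \<Longrightarrow> b 0 v = 0" and "0 \<in> B \<Longrightarrow> u \<in> A \<Longrightarrow> b u 0 = 0"
  using bilinear_onD(3)[OF assms, of 0 v 0] bilinear_onD(4)[OF assms, of u 0 0] by simp_all

section \<open>Coordinates, separating functionals and finite bases\<close>

lemma clinear_on_extend:
  assumes "cvs.independent B"
  obtains f where "clinear_on UNIV f" "\<And>b. b \<in> B \<Longrightarrow> f b = g b"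
proof -
  interpret vector_space_pair scaleC scaleC ..
  show thesis
    using linear_independent_extend[OF assms, of g] that by (auto simp: clinear_on_UNIV_iff)
qed

text \<open>Only meaningful for independent \<open>B\<close> and \<open>b \<in> B\<close>; outside the span of \<open>B\<close> the functional is an
  unspecified linear extension.\<close>

definition coord :: "'a::complex_vector set \<Rightarrow> 'a \<Rightarrow> 'a \<Rightarrow> complex" where
  "coord B b = (SOME f. clinear_on UNIV f \<and> (\<forall>b'\<in>B. f b' = (if b' = b then 1 else 0)))"

lemma coord:
  assumes "cvs.independent B"
  shows clinear_on_coord: "clinear_on UNIV (coord B b)"
    and coord_basis: "b' \<in> B \<Longrightarrow> coord B b b' = (if b' = b then 1 else 0)"
proof -
  have "\<exists>f. clinear_on UNIV f \<and> (\<forall>b'\<in>B. f b' = (if b' = b then 1 else (0::complex)))"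
    by (rule clinear_on_extend[OF assms, of "\<lambda>b'. if b' = b then 1 else (0::complex)"]) auto
  from someI_ex[OF this] show "clinear_on UNIV (coord B b)"
    and "b' \<in> B \<Longrightarrow> coord B b b' = (if b' = b then 1 else 0)"
    unfolding coord_def by auto
qed

lemma sum_coord:
  assumes "cvs.independent B" "finite B" "x \<in> cvs.span B"
  shows "(\<Sum>b\<in>B. coord B b x *\<^sub>C b) = x"
proof (rule clinear_on_span_eq[OF _ _ cvs.subspace_UNIV subset_UNIV assms(3)])
  have *: "coord B b (x + y) = coord B b x + coord B b y"
    "coord B b (c *\<^sub>C x) = c * coord B b x" for b x y c
    using clinear_on_coord[OF assms(1), of b]
    by (simp_all add: clinear_on_def scaleC_complex_def)
  show "clinear_on UNIV (\<lambda>x. \<Sum>b\<in>B. coord B b x *\<^sub>C b)"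
    unfolding clinear_on_def
    by (simp add: * cvs.scale_left_distrib sum.distrib cvs.scale_sum_right)
  show "clinear_on UNIV (\<lambda>x::'a. x)" by (rule clinear_on_ident)
  fix s assume s: "s \<in> B"
  have "(\<Sum>b\<in>B. coord B b s *\<^sub>C b) = (\<Sum>b\<in>B. if b = s then s else 0)"
    by (rule sum.cong) (use s assms(1) in \<open>auto simp: coord_basis\<close>)
  then show "(\<Sum>b\<in>B. coord B b s *\<^sub>C b) = s"
    using s assms(2) by simp
qed

lemma functional_eqI:
  fixes x y :: "'a::complex_vector"
  assumes "\<And>f :: 'a \<Rightarrow> complex. clinear_on UNIV f \<Longrightarrow> f x = f y"
  shows "x = y"
proof (rule ccontr)
  assume "x \<noteq> y"
  then have ind: "cvs.independent {x - y}" by simp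
  have "coord {x - y} (x - y) (x - y) = 0"
    using assms[OF clinear_on_coord[OF ind]]
      clinear_on_diff[OF clinear_on_coord[OF ind] cvs.subspace_UNIV, of x y]
    by simp
  then show False using coord_basis[OF ind] by simp
qed

lemma basis_of_subspace:
  assumes "finite_dim C" "S \<subseteq> C" "cvs.independent S"
  obtains B where "S \<subseteq> B" "finite B" "cvs.independent B" "cvs.span B = C"
proof -
  obtain E where E: "finite E" "cvs.span E = C"
    using assms(1) by (auto simp: finite_dim_def)
  obtain B where B: "S \<subseteq> B" "B \<subseteq> C" "cvs.independent B" "C \<subseteq> cvs.span B"
    using cvs.maximal_independent_subset_extend[OF assms(2,3)] .
  have "finite B"
    using cvs.independent_span_bound[OF E(1) B(3)] B(2) E(2) by auto
  moreover have "cvs.span B = C"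
    using B E cvs.span_minimal[OF B(2)] by auto
  ultimately show thesis using that B by auto
qed

lemma finite_dim_subspace:
  assumes "finite_dim C" "cvs.subspace W" "W \<subseteq> C"
  shows "finite_dim W"
proof -
  obtain B where B: "B \<subseteq> W" "cvs.independent B" "W \<subseteq> cvs.span B"
    using cvs.basis_exists by metis
  obtain B' where "B \<subseteq> B'" "finite B'"
    using basis_of_subspace[OF assms(1) subset_trans[OF B(1) assms(3)] B(2)] by metis
  then show ?thesis
    unfolding finite_dim_def
    using cvs.span_minimal[OF B(1) assms(2)] B(3) finite_subset[of B B'] by (intro exI[of _ B]) auto
qed

lemma finite_independent_in:
  assumes "finite_dim C" "S \<subseteq> C" "cvs.independent S"
  shows "finite S"
  using basis_of_subspace[OF assms] finite_subset by metis

text \<open>An injective map sends a basis of \<open>J\<close> to an independent family of the same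
  size inside \<open>J\<close>, and such a family spans \<open>J\<close>. This turns the inclusion
  \<theta>(J) \<subseteq> J in the antipode argument into an equality.\<close>

lemma clinear_on_injective_imp_surjective:
  fixes f :: "'a::complex_vector \<Rightarrow> 'a"
  assumes "finite_dim J" "cvs.subspace J" "clinear_on J f" "inj_on f J" "f ` J \<subseteq> J"
  shows "f ` J = J"
proof -
  obtain B where B: "finite B" "cvs.independent B" "cvs.span B = J"
    using basis_of_subspace[OF assms(1), of "{}"] by (auto simp: cvs.independent_empty)
  obtain p where p: "clinear_on UNIV p" "range p \<subseteq> J" "\<And>x. x \<in> J \<Longrightarrow> p x = x"
    using subspace_projection[OF assms(2)] by metis
  interpret vector_space_pair "scaleC :: complex \<Rightarrow> 'a \<Rightarrow> 'a" "scaleC :: complex \<Rightarrow> 'a \<Rightarrow> 'a" ..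
  \<comment> \<open>Composing with the projection \<open>p\<close> onto \<open>J\<close> gives a map
    that is linear on the whole type and agrees with \<open>f\<close> on \<open>J\<close>.\<close>
  have "clinear_on UNIV (\<lambda>x. f (p x))"
    by (rule clinear_on_compose[OF p(1) assms(3) p(2)])
  then have lin: "Vector_Spaces.linear scaleC scaleC (\<lambda>x. f (p x))"
    by (simp add: clinear_on_UNIV_iff)
  have BJ: "B \<subseteq> J" using B cvs.span_superset by blast
  have inj: "inj_on (\<lambda>x. f (p x)) (cvs.span B)"
    using assms(4) p(3) B(3) by (simp add: inj_on_def)
  have "cvs.independent ((\<lambda>x. f (p x)) ` B)"
    by (rule linear_independent_injective_image[OF lin B(2) inj])
  moreover have eq: "(\<lambda>x. f (p x)) ` B = f ` B"
    using p(3) BJ by (auto simp: subset_iff image_iff)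
  ultimately have ind: "cvs.independent (f ` B)" by simp
  have sub: "f ` B \<subseteq> J" using BJ assms(5) by auto
  have "inj_on f B" using assms(4) BJ inj_on_subset by blast
  then have card: "card (f ` B) = card B" by (rule card_image)
  have "J \<subseteq> cvs.span (f ` B)"
  proof
    fix v assume v: "v \<in> J"
    show "v \<in> cvs.span (f ` B)"
    proof (rule ccontr)
      assume n: "v \<notin> cvs.span (f ` B)"
      then have "cvs.independent (insert v (f ` B))" using ind by (rule cvs.independent_insertI)
      moreover have "insert v (f ` B) \<subseteq> cvs.span B" using v sub B(3) by auto
      ultimately have "card (insert v (f ` B)) \<le> card B"
        using cvs.independent_span_bound[OF B(1)] by blast
      moreover have "v \<notin> f ` B" using n cvs.span_base by blast
      ultimately show False using B(1) card by simp
    qed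
  qed
  also have "cvs.span (f ` B) = (\<lambda>x. f (p x)) ` cvs.span B"
    using linear_span_image[OF lin, of B] eq by simp
  also have "\<dots> = f ` J" using p(3) B(3) by (simp add: image_def)
  finally show ?thesis using assms(5) by blast
qed

text \<open>Take the least \<open>n\<close> for which \<open>s n\<close> lies in the span of its
  predecessors; it exists since an independent set in \<open>C\<close> is no larger than a spanning
  set. It is applied to the iterates of an operator on a vector and to the powers of a primitive
  element; in the second case the independence of the earlier terms supplies coordinate
  functionals.\<close>

lemma first_linear_dependence:
  fixes s :: "nat \<Rightarrow> 'a::complex_vector"
  assumes "finite_dim C" "range s \<subseteq> C"
  obtains n c where "s n = (\<Sum>i<n. c i *\<^sub>C s i)" "cvs.independent (s ` {..<n})" "inj_on s {..<n}"
proof -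
  obtain E where E: "finite E" "cvs.span E = C"
    using assms(1) by (auto simp: finite_dim_def)
  have *: "cvs.independent (s ` {..<n}) \<and> inj_on s {..<n}"
    if "\<And>m. m < n \<Longrightarrow> s m \<notin> cvs.span (s ` {..<m})" for n
    using that
  proof (induction n)
    case (Suc n)
    have "s n \<notin> cvs.span (s ` {..<n})" using Suc.prems by blast
    moreover from this have "s n \<notin> s ` {..<n}" using cvs.span_base by metis
    moreover have "cvs.independent (s ` {..<n}) \<and> inj_on s {..<n}"
      using Suc.prems by (intro Suc.IH) auto
    ultimately show ?case
      by (simp add: lessThan_Suc cvs.independent_insertI)
  qed (simp add: cvs.independent_empty)
  have "\<exists>n. s n \<in> cvs.span (s ` {..<n})"
  proof (rule ccontr)
    assume "\<nexists>n. s n \<in> cvs.span (s ` {..<n})"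
    then have "cvs.independent (s ` {..<Suc (card E)})" "inj_on s {..<Suc (card E)}"
      using * by auto
    moreover from this have "card (s ` {..<Suc (card E)}) = Suc (card E)"
      by (simp add: card_image)
    moreover have "s ` {..<Suc (card E)} \<subseteq> cvs.span E" using assms(2) E(2) by auto
    ultimately show False using cvs.independent_span_bound[OF E(1)] by fastforce
  qed
  then obtain n where n: "s n \<in> cvs.span (s ` {..<n})"
    "\<And>m. m < n \<Longrightarrow> s m \<notin> cvs.span (s ` {..<m})"
    using exists_least_iff[of "\<lambda>n. s n \<in> cvs.span (s ` {..<n})"] by blast
  have ind: "cvs.independent (s ` {..<n})" "inj_on s {..<n}" using * n(2) by auto
  obtain u where "s n = (\<Sum>v\<in>s ` {..<n}. u v *\<^sub>C v)"
    using n(1) by (auto simp: cvs.span_finite)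
  then have "s n = (\<Sum>i<n. u (s i) *\<^sub>C s i)"
    using ind(2) by (simp add: sum.reindex)
  then show thesis using that[of n "\<lambda>i. u (s i)"] ind by blast
qed

lemma dim_strict_mono:
  assumes "finite_dim U" "cvs.subspace W" "W \<subset> U"
  shows "cvs.dim W < cvs.dim U"
proof -
  have "finite_dim W" using finite_dim_subspace assms by blast
  then obtain A where A: "finite A" "cvs.independent A" "cvs.span A = W"
    using basis_of_subspace[of W "{}"] by (auto simp: cvs.independent_empty)
  have "A \<subseteq> U" using A(3) assms(3) cvs.span_superset by blast
  then obtain B where B: "A \<subseteq> B" "finite B" "cvs.independent B" "cvs.span B = U"
    using basis_of_subspace[OF assms(1) _ A(2)] by metis
  have "A \<noteq> B" using A(3) B(4) assms(3) by blast
  then have "card A < card B" using A B by (intro psubset_card_mono) auto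
  then show ?thesis
    using A B cvs.dim_span_eq_card_independent by metis
qed

section \<open>Polynomials in an operator and eigenvectors modulo a subspace\<close>

definition poly_act :: "('a \<Rightarrow> 'a) \<Rightarrow> complex poly \<Rightarrow> 'a \<Rightarrow> 'a::complex_vector" where
  "poly_act T p x = (\<Sum>i\<le>degree p. coeff p i *\<^sub>C (T ^^ i) x)"

lemma poly_act_ge:
  "degree p \<le> n \<Longrightarrow> poly_act T p x = (\<Sum>i\<le>n. coeff p i *\<^sub>C (T ^^ i) x)"
  unfolding poly_act_def by (rule sum.mono_neutral_left) (auto simp: coeff_eq_0)

lemma poly_act_linear_factor:
  assumes "clinear_on U T" "cvs.subspace U" "T ` U \<subseteq> U" "x \<in> U"
  shows "poly_act T ([:- l, 1:] * q) x = T (poly_act T q x) - l *\<^sub>C poly_act T q x"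
proof -
  have pow: "(T ^^ i) x \<in> U" for i
    using assms by (induction i) auto
  let ?n = "degree q"
  have "degree ([:- l, 1:] * q) \<le> Suc ?n"
    by (rule order_trans[OF degree_mult_le]) simp
  then have "poly_act T ([:- l, 1:] * q) x =
      (\<Sum>i\<le>Suc ?n. coeff ([:- l, 1:] * q) i *\<^sub>C (T ^^ i) x)"
    by (rule poly_act_ge)
  also have "\<dots> = (\<Sum>i\<le>Suc ?n. coeff (pCons 0 q) i *\<^sub>C (T ^^ i) x) -
      (\<Sum>i\<le>Suc ?n. (l * coeff q i) *\<^sub>C (T ^^ i) x)"
    by (simp add: cvs.scale_left_diff_distrib cvs.scale_left_distrib sum_subtractf sum.distrib)
  also have "(\<Sum>i\<le>Suc ?n. coeff (pCons 0 q) i *\<^sub>C (T ^^ i) x) =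
      (\<Sum>i\<le>?n. coeff q i *\<^sub>C T ((T ^^ i) x))"
    by (subst sum.atMost_Suc_shift) simp
  also have "\<dots> = T (poly_act T q x)"
    unfolding poly_act_def using assms(1,2) pow
    by (subst clinear_on_sum[OF assms(1,2)]) (auto simp: cvs.subspace_scale clinear_on_scale)
  also have "(\<Sum>i\<le>Suc ?n. (l * coeff q i) *\<^sub>C (T ^^ i) x) = l *\<^sub>C poly_act T q x"
    by (subst poly_act_ge[of q "Suc ?n"]) (simp_all add: cvs.scale_sum_right cvs.scale_right_distrib)
  finally show ?thesis .
qed

text \<open>Among the nonzero polynomials q with q(T)x in W choose one of least degree. It is not
  constant because x is not in W, so it has a root l; writing q = (X - l) r, the vector y = r(T)x
  lies outside W by minimality.\<close>

lemma eigenvector_mod: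
  assumes "finite_dim U" "cvs.subspace U" "clinear_on U T" "T ` U \<subseteq> U"
    and "cvs.subspace W" "x \<in> U" "x \<notin> W"
  obtains l y where "y \<in> U" "y \<notin> W" "T y - l *\<^sub>C y \<in> W"
proof -
  have pow: "(T ^^ i) x \<in> U" for i
    using assms by (induction i) auto
  have pU: "poly_act T p x \<in> U" for p
    unfolding poly_act_def using pow assms(2) by (intro cvs.subspace_sum) (auto simp: cvs.subspace_scale)
  obtain n c where n: "(T ^^ n) x = (\<Sum>i<n. c i *\<^sub>C (T ^^ i) x)"
    using first_linear_dependence[OF assms(1), of "\<lambda>i. (T ^^ i) x"] pow by blast
  \<comment> \<open>The monic polynomial of the first linear relation among the iterates of
    \<open>x\<close>: it annihilates \<open>x\<close> and shows that the minimum below is taken over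
    a nonempty set.\<close>
  define p where "p = monom 1 n - (\<Sum>i<n. monom (c i) i)"
  have coeff_p: "coeff p i = (if i = n then 1 else if i < n then - c i else 0)" for i
    by (auto simp: p_def coeff_sum)
  have "degree p \<le> n" by (rule degree_le) (simp add: coeff_p)
  then have "poly_act T p x = (\<Sum>i\<le>n. coeff p i *\<^sub>C (T ^^ i) x)" by (rule poly_act_ge)
  also have "\<dots> = (\<Sum>i<n. coeff p i *\<^sub>C (T ^^ i) x) + (T ^^ n) x"
    by (simp add: lessThan_Suc_atMost[symmetric] coeff_p)
  also have "(\<Sum>i<n. coeff p i *\<^sub>C (T ^^ i) x) = - (\<Sum>i<n. c i *\<^sub>C (T ^^ i) x)"
    by (simp add: coeff_p sum_negf)
  finally have "poly_act T p x = 0" using n by simp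
  moreover have "p \<noteq> 0" using coeff_p[of n] by auto
  ultimately have ex: "\<exists>p. p \<noteq> 0 \<and> poly_act T p x \<in> W"
    using cvs.subspace_0[OF assms(5)] by metis
  define q where "q = (ARG_MIN degree p. p \<noteq> 0 \<and> poly_act T p x \<in> W)"
  have q: "q \<noteq> 0" "poly_act T q x \<in> W"
    and qmin: "\<And>r. r \<noteq> 0 \<Longrightarrow> poly_act T r x \<in> W \<Longrightarrow> degree q \<le> degree r"
    using arg_min_natI[of "\<lambda>p. p \<noteq> 0 \<and> poly_act T p x \<in> W" _ degree] ex
      arg_min_nat_le[of "\<lambda>p. p \<noteq> 0 \<and> poly_act T p x \<in> W" _ degree]
    by (auto simp: q_def)
  have "degree q \<noteq> 0"
  proof
    assume d: "degree q = 0"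
    then have "coeff q 0 *\<^sub>C x \<in> W" using q(2) by (simp add: poly_act_def)
    then have "inverse (coeff q 0) *\<^sub>C (coeff q 0 *\<^sub>C x) \<in> W" using assms(5) cvs.subspace_scale by blast
    moreover have "coeff q 0 \<noteq> 0" using d q(1) leading_coeff_0_iff by metis
    ultimately show False using assms(7) by simp
  qed
  then obtain l where "poly q l = 0"
    using fundamental_theorem_of_algebra[of q] by (auto simp: constant_degree)
  then obtain r where r: "q = [:- l, 1:] * r" by (auto simp: poly_eq_0_iff_dvd)
  have r0: "r \<noteq> 0" using r q(1) by auto
  have "degree q = Suc (degree r)"
    unfolding r by (subst degree_mult_eq) (use r0 in auto)
  then have "poly_act T r x \<notin> W" using qmin[OF r0] by fastforce
  moreover have "T (poly_act T r x) - l *\<^sub>C poly_act T r x \<in> W"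
    using q(2) poly_act_linear_factor[OF assms(3,2,4,6)] unfolding r by simp
  ultimately show thesis using that pU by blast
qed

text \<open>Choose an invariant U of least dimension strictly above W. For T in the family and an
  eigenvalue l of T on U modulo W, the subspace of those y in U with T y - l y in W strictly
  contains W, and it is invariant because the family commutes; by minimality it is U. So every T is
  scalar on U modulo W, and any x in U outside W will do. The minimal choice of U handles all
  members of a possibly infinite family at once.\<close>

lemma common_eigenvector_mod:
  fixes \<T> :: "('a::complex_vector \<Rightarrow> 'a) set"
  assumes "finite_dim C" "cvs.subspace C" "cvs.subspace W" "W \<subset> C"
    and lin: "\<And>T. T \<in> \<T> \<Longrightarrow> clinear_on C T"
    and inv: "\<And>T. T \<in> \<T> \<Longrightarrow> T ` C \<subseteq> C" "\<And>T. T \<in> \<T> \<Longrightarrow> T ` W \<subseteq> W"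
    and comm: "\<And>S T x. S \<in> \<T> \<Longrightarrow> T \<in> \<T> \<Longrightarrow> x \<in> C \<Longrightarrow> S (T x) = T (S x)"
  obtains x where "x \<in> C" "x \<notin> W" "\<And>T. T \<in> \<T> \<Longrightarrow> \<exists>l. T x - l *\<^sub>C x \<in> W"
proof -
  let ?P = "\<lambda>U. cvs.subspace U \<and> W \<subset> U \<and> U \<subseteq> C \<and> (\<forall>T\<in>\<T>. T ` U \<subseteq> U)"
  define U where "U = (ARG_MIN cvs.dim U. ?P U)"
  have "?P C" using assms by auto
  then have U: "cvs.subspace U" "W \<subset> U" "U \<subseteq> C" "\<forall>T\<in>\<T>. T ` U \<subseteq> U"
    and min: "\<And>U'. ?P U' \<Longrightarrow> cvs.dim U \<le> cvs.dim U'"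
    using arg_min_nat_lemma[of ?P C cvs.dim] unfolding U_def by blast+
  have fdU: "finite_dim U" using finite_dim_subspace assms(1) U by blast
  obtain x where x: "x \<in> U" "x \<notin> W" using U(2) by blast
  have "\<exists>l. T x - l *\<^sub>C x \<in> W" if T: "T \<in> \<T>" for T
  proof -
    have linU: "clinear_on U T" using lin[OF T] U(3) clinear_on_subset by blast
    obtain l y where y: "y \<in> U" "y \<notin> W" "T y - l *\<^sub>C y \<in> W"
      using eigenvector_mod[OF fdU U(1) linU bspec[OF U(4) T] assms(3) x] by metis
    define U' where "U' = {y \<in> U. T y - l *\<^sub>C y \<in> W}"
    have "U' = U"
    proof (rule ccontr)
      assume "U' \<noteq> U"
      then have "U' \<subset> U" by (auto simp: U'_def)
      have sub: "cvs.subspace U'"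
      proof (rule cvs.subspaceI)
        show "0 \<in> U'"
          using cvs.subspace_0[OF U(1)] cvs.subspace_0[OF assms(3)] clinear_on_zero[OF linU]
          by (simp add: U'_def)
      next
        fix a b assume "a \<in> U'" "b \<in> U'"
        then have *: "a \<in> U" "b \<in> U" "T a - l *\<^sub>C a \<in> W" "T b - l *\<^sub>C b \<in> W"
          by (auto simp: U'_def)
        then have "(T a - l *\<^sub>C a) + (T b - l *\<^sub>C b) \<in> W"
          by (intro cvs.subspace_add assms(3))
        moreover have "T (a + b) - l *\<^sub>C (a + b) = (T a - l *\<^sub>C a) + (T b - l *\<^sub>C b)"
          using * linU by (simp add: clinear_on_add cvs.scale_right_distrib)
        ultimately show "a + b \<in> U'" using * U(1) by (simp add: U'_def cvs.subspace_add)
      next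
        fix c a assume "a \<in> U'"
        then have *: "a \<in> U" "T a - l *\<^sub>C a \<in> W" by (auto simp: U'_def)
        then have "c *\<^sub>C (T a - l *\<^sub>C a) \<in> W" by (intro cvs.subspace_scale assms(3))
        moreover have "T (c *\<^sub>C a) - l *\<^sub>C (c *\<^sub>C a) = c *\<^sub>C (T a - l *\<^sub>C a)"
          using * linU by (simp add: clinear_on_scale cvs.scale_right_diff_distrib mult.commute)
        ultimately show "c *\<^sub>C a \<in> U'" using * U(1) by (simp add: U'_def cvs.subspace_scale)
      qed
      have "W \<subseteq> U'"
      proof
        fix w assume w: "w \<in> W"
        then have "T w \<in> W" "l *\<^sub>C w \<in> W" using inv(2)[OF T] cvs.subspace_scale[OF assms(3)] by auto
        then show "w \<in> U'" using w U(2) cvs.subspace_diff[OF assms(3)] by (auto simp: U'_def)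
      qed
      moreover have "y \<in> U'" using y by (simp add: U'_def)
      ultimately have "W \<subset> U'" using y(2) by blast
      moreover have "S a \<in> U'" if S: "S \<in> \<T>" and a: "a \<in> U'" for S a
      proof -
        have a': "a \<in> U" "T a - l *\<^sub>C a \<in> W" using a by (auto simp: U'_def)
        then have aC: "a \<in> C" "T a \<in> C" using U(3) inv(1)[OF T] by auto
        have "S (T a - l *\<^sub>C a) \<in> W" using a'(2) inv(2)[OF S] by blast
        also have "S (T a - l *\<^sub>C a) = T (S a) - l *\<^sub>C S a"
          using aC comm[OF S T aC(1)] lin[OF S] clinear_on_diff[OF lin[OF S] assms(2)]
            cvs.subspace_scale[OF assms(2)] clinear_on_scale by metis
        finally show ?thesis using a'(1) U(4) S by (auto simp: U'_def)
      qed
      ultimately have "cvs.dim U \<le> cvs.dim U'"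
        using sub \<open>U' \<subset> U\<close> U(3) by (intro min) auto
      then show False using dim_strict_mono[OF fdU sub \<open>U' \<subset> U\<close>] by simp
    qed
    then show ?thesis using x by (auto simp: U'_def)
  qed
  then show thesis using that x U(3) by blast
qed

section \<open>Tensors\<close>

lemma tens_eqI: "x - y \<in> tensor_relators \<Longrightarrow> abs_tensor x = abs_tensor y"
  by (simp add: tensor.abs_eq_iff tensor_rel_def cvs.span_base)

lemma
  shows tens_add_left: "(u + u') \<otimes>\<^sub>C v = u \<otimes>\<^sub>C v + u' \<otimes>\<^sub>C v"
    and tens_add_right: "u \<otimes>\<^sub>C (v + v') = u \<otimes>\<^sub>C v + u \<otimes>\<^sub>C v'"
    and tens_scale_left: "(c *\<^sub>C u) \<otimes>\<^sub>C v = c *\<^sub>C (u \<otimes>\<^sub>C v)"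
    and tens_scale_right: "u \<otimes>\<^sub>C (c *\<^sub>C v) = c *\<^sub>C (u \<otimes>\<^sub>C v)"
proof -
  show "(u + u') \<otimes>\<^sub>C v = u \<otimes>\<^sub>C v + u' \<otimes>\<^sub>C v"
    unfolding tens.abs_eq plus_tensor.abs_eq
    by (rule tens_eqI, simp only: tensor_relators_def diff_diff_eq[symmetric]) blast
  show "u \<otimes>\<^sub>C (v + v') = u \<otimes>\<^sub>C v + u \<otimes>\<^sub>C v'"
    unfolding tens.abs_eq plus_tensor.abs_eq
    by (rule tens_eqI, simp only: tensor_relators_def diff_diff_eq[symmetric]) blast
  show "(c *\<^sub>C u) \<otimes>\<^sub>C v = c *\<^sub>C (u \<otimes>\<^sub>C v)"
    unfolding tens.abs_eq scaleC_tensor.abs_eq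
    by (rule tens_eqI, simp only: tensor_relators_def) blast
  show "u \<otimes>\<^sub>C (c *\<^sub>C v) = c *\<^sub>C (u \<otimes>\<^sub>C v)"
    unfolding tens.abs_eq scaleC_tensor.abs_eq
    by (rule tens_eqI, simp only: tensor_relators_def) blast
qed

lemmas tens_linear = tens_add_left tens_add_right tens_scale_left tens_scale_right

lemma bilinear_on_tens: "bilinear_on A B (\<otimes>\<^sub>C)"
  by (rule bilinear_onI) (rule tens_linear)+

lemma tens_zero [simp]: "0 \<otimes>\<^sub>C v = 0" "u \<otimes>\<^sub>C 0 = 0"
  using tens_scale_left[of 0 0 v] tens_scale_right[of u 0 0] by simp_all

lemma tens_in_tensor_space: "u \<in> A \<Longrightarrow> v \<in> B \<Longrightarrow> u \<otimes>\<^sub>C v \<in> tensor_space A B"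
  unfolding tensor_space_def by (rule cvs.span_base) blast

lemma subspace_tensor_space: "cvs.subspace (tensor_space A B)"
  unfolding tensor_space_def by (rule cvs.subspace_span)

lemma tensor_space_mono: "A \<subseteq> A' \<Longrightarrow> B \<subseteq> B' \<Longrightarrow> tensor_space A B \<subseteq> tensor_space A' B'"
  unfolding tensor_space_def by (rule cvs.span_mono) blast

lemma tensor_space_image_subset:
  assumes "clinear_on T f" "cvs.subspace T" "tensor_space A B \<subseteq> T" "cvs.subspace J"
    and "\<And>a b. a \<in> A \<Longrightarrow> b \<in> B \<Longrightarrow> f (a \<otimes>\<^sub>C b) \<in> J"
  shows "f ` tensor_space A B \<subseteq> J"
proof
  fix y assume "y \<in> f ` tensor_space A B"
  then obtain t where t: "t \<in> tensor_space A B" "y = f t" by blast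
  have "t \<in> T \<and> f t \<in> J"
    using t(1) unfolding tensor_space_def
  proof (induction rule: cvs.span_induct_alt)
    case base
    then show ?case
      using assms(1,2,4) by (simp add: clinear_on_zero cvs.subspace_0)
  next
    case (step c s t)
    then obtain a b where "a \<in> A" "b \<in> B" "s = a \<otimes>\<^sub>C b" by blast
    then have "s \<in> T" "f s \<in> J" using assms(3,5) tens_in_tensor_space[of a A b B] by auto
    then show ?case
      using step assms(1,2,4)
      by (simp add: clinear_on_add clinear_on_scale cvs.subspace_add cvs.subspace_scale)
  qed
  then show "y \<in> J" using t(2) by simp
qed

lemma clinear_on_tensor_space_eq:
  assumes "clinear_on (tensor_space A B) f" "clinear_on (tensor_space A B) g"
    and "t \<in> tensor_space A B" "\<And>a b. a \<in> A \<Longrightarrow> b \<in> B \<Longrightarrow> f (a \<otimes>\<^sub>C b) = g (a \<otimes>\<^sub>C b)"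
  shows "f t = g t"
  by (rule clinear_on_span_eq[OF assms(1,2) subspace_tensor_space, of "{u \<otimes>\<^sub>C v |u v. u \<in> A \<and> v \<in> B}"])
    (use assms(3,4) in \<open>auto simp: tensor_space_def intro: cvs.span_base\<close>)

lemma finite_dim_tensor_space:
  assumes "finite_dim A" "finite_dim B"
  shows "finite_dim (tensor_space A B)"
proof -
  obtain E F where E: "finite E" "cvs.span E = A" and F: "finite F" "cvs.span F = B"
    using assms by (auto simp: finite_dim_def)
  let ?T = "{u \<otimes>\<^sub>C v |u v. u \<in> E \<and> v \<in> F}"
  have "?T = (\<lambda>(u, v). u \<otimes>\<^sub>C v) ` (E \<times> F)" by auto
  then have fin: "finite ?T" using E F by simp
  have lin: "clinear_on UNIV (\<lambda>u. u \<otimes>\<^sub>C v)" "clinear_on UNIV (\<lambda>v. u \<otimes>\<^sub>C v)" for u :: 'a and v :: 'b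
    by (simp_all add: clinear_on_def tens_linear)
  have *: "u \<otimes>\<^sub>C v \<in> cvs.span ?T" if "u \<in> E" "v \<in> cvs.span F" for u v
    using that(2)
  proof (induction rule: cvs.span_induct_alt)
    case (step c x y)
    have "u \<otimes>\<^sub>C x \<in> cvs.span ?T" using step that(1) by (auto intro: cvs.span_base)
    then show ?case
      using step by (simp add: tens_linear cvs.span_add cvs.span_scale)
  qed (simp add: cvs.span_zero)
  have "u \<otimes>\<^sub>C v \<in> cvs.span ?T" if "u \<in> cvs.span E" "v \<in> cvs.span F" for u v
    using that(1)
  proof (induction rule: cvs.span_induct_alt)
    case (step c x y)
    then show ?case
      using * that(2) by (simp add: tens_linear cvs.span_add cvs.span_scale)
  qed (simp add: cvs.span_zero)
  then have "tensor_space A B \<subseteq> cvs.span ?T"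
    unfolding tensor_space_def E(2)[symmetric] F(2)[symmetric]
    by (intro cvs.span_minimal cvs.subspace_span) auto
  moreover have "cvs.span ?T \<subseteq> tensor_space A B"
    unfolding tensor_space_def E(2)[symmetric] F(2)[symmetric]
    by (rule cvs.span_mono) (auto intro: cvs.span_base)
  ultimately have "cvs.span ?T = tensor_space A B" by (intro equalityI)
  then show ?thesis unfolding finite_dim_def using fin by blast
qed

text \<open>The formal sum that \<open>tensor_lift\<close> selects. It depends on the tensor but not
  on the map being lifted, so sums, scalars and linear maps can be moved through
  \<open>tensor_lift\<close> in its map argument without bilinearity.\<close>

definition tensor_rep ::
  "'a::complex_vector set \<Rightarrow> 'b::complex_vector set \<Rightarrow> ('a, 'b) tensor \<Rightarrow> ('a \<times> 'b) \<Rightarrow>\<^sub>0 complex"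
  where "tensor_rep A B t = (SOME x. Poly_Mapping.keys x \<subseteq> A \<times> B \<and> abs_tensor x = t)"

lemma tensor_lift_rep:
  "tensor_lift A B b t = (\<Sum>p\<in>Poly_Mapping.keys (tensor_rep A B t).
     Poly_Mapping.lookup (tensor_rep A B t) p *\<^sub>C b (fst p) (snd p))"
  by (simp add: tensor_lift_def tensor_rep_def formal_eval_def)

lemma keys_tensor_rep:
  assumes "t \<in> tensor_space A B" "cvs.subspace A"
  shows "Poly_Mapping.keys (tensor_rep A B t) \<subseteq> A \<times> B"
  using someI_ex[OF tensor_space_rep[OF assms]] by (simp add: tensor_rep_def)

lemma tensor_lift_cong:
  assumes "t \<in> tensor_space A B" "cvs.subspace A"
    and "\<And>a b. a \<in> A \<Longrightarrow> b \<in> B \<Longrightarrow> F a b = G a b"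
  shows "tensor_lift A B F t = tensor_lift A B G t"
  unfolding tensor_lift_rep
  by (rule sum.cong) (use keys_tensor_rep[OF assms(1,2)] assms(3) in auto)

lemma tensor_lift_add:
  "tensor_lift A B (\<lambda>a b. F a b + G a b) t = tensor_lift A B F t + tensor_lift A B G t"
  by (simp add: tensor_lift_rep cvs.scale_right_distrib sum.distrib)

lemma tensor_lift_scale:
  "tensor_lift A B (\<lambda>a b. c *\<^sub>C F a b) t = c *\<^sub>C tensor_lift A B F t"
  by (simp add: tensor_lift_rep cvs.scale_sum_right mult.commute)

lemma tensor_lift_sum:
  "tensor_lift A B (\<lambda>a b. \<Sum>i\<in>I. F i a b) t = (\<Sum>i\<in>I. tensor_lift A B (F i) t)"
  unfolding tensor_lift_rep cvs.scale_sum_right by (rule sum.swap)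

lemma tensor_lift_zero: "tensor_lift A B (\<lambda>a b. 0) t = 0"
  by (simp add: tensor_lift_rep)

lemma tensor_lift_closed:
  assumes "t \<in> tensor_space A B" "cvs.subspace A" "cvs.subspace S"
    and "\<And>a b. a \<in> A \<Longrightarrow> b \<in> B \<Longrightarrow> F a b \<in> S"
  shows "tensor_lift A B F t \<in> S"
  unfolding tensor_lift_rep
  by (intro cvs.subspace_sum[OF assms(3)] cvs.subspace_scale[OF assms(3)] assms(4))
    (use keys_tensor_rep[OF assms(1,2)] in auto)

lemma tensor_lift_linear:
  assumes "t \<in> tensor_space A B" "cvs.subspace A" "clinear_on S \<phi>" "cvs.subspace S"
    and "\<And>a b. a \<in> A \<Longrightarrow> b \<in> B \<Longrightarrow> F a b \<in> S"
  shows "\<phi> (tensor_lift A B F t) = tensor_lift A B (\<lambda>a b. \<phi> (F a b)) t"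
proof -
  have S: "F (fst p) (snd p) \<in> S" if "p \<in> Poly_Mapping.keys (tensor_rep A B t)" for p
    by (rule assms(5)) (use that keys_tensor_rep[OF assms(1,2)] in auto)
  have "\<phi> (tensor_lift A B F t) =
      (\<Sum>p\<in>Poly_Mapping.keys (tensor_rep A B t).
        \<phi> (Poly_Mapping.lookup (tensor_rep A B t) p *\<^sub>C F (fst p) (snd p)))"
    unfolding tensor_lift_rep
    by (rule clinear_on_sum[OF assms(3,4)]) (intro cvs.subspace_scale assms(4) S)
  also have "\<dots> = tensor_lift A B (\<lambda>a b. \<phi> (F a b)) t"
    unfolding tensor_lift_rep by (rule sum.cong) (use assms(3) S in \<open>auto simp: clinear_on_scale\<close>)
  finally show ?thesis .
qed

lemma tensor_lift_self:
  assumes "t \<in> tensor_space A B" "cvs.subspace A" "cvs.subspace B"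
  shows "tensor_lift A B (\<otimes>\<^sub>C) t = t"
  by (rule clinear_on_tensor_space_eq[OF clinear_on_tensor_lift[OF assms(2,3) bilinear_on_tens]
        clinear_on_ident assms(1)])
    (simp add: tensor_lift_tens[OF assms(2,3) bilinear_on_tens])

text \<open>The kernel of a tensor product of linear maps, stated for a family \<open>R\<close> of maps that together
  have kernel \<open>K\<close>.\<close>

lemma tensor_kernel:
  fixes R :: "'i \<Rightarrow> 'a::complex_vector \<Rightarrow> 'x::complex_vector"
  assumes C: "cvs.subspace C" "finite_dim C"
    and R: "\<And>i. clinear_on C (R i)"
    and K: "K = {a \<in> C. \<forall>i. R i a = 0}"
    and t: "t \<in> tensor_space C C"
    and R_t: "\<And>i j. tensor_lift C C (\<lambda>a b. R i a \<otimes>\<^sub>C R j b) t = 0"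
  shows "\<exists>s\<in>tensor_space C K. \<exists>s'\<in>tensor_space K C. t = s + s'"
proof -
  have KC: "K \<subseteq> C" using K by auto
  have subK: "cvs.subspace K"
    unfolding K
    by (rule cvs.subspaceI)
      (use C R in \<open>auto simp: cvs.subspace_0 cvs.subspace_add cvs.subspace_scale clinear_on_zero[OF R]
          clinear_on_add[OF R] clinear_on_scale[OF R]\<close>)
  obtain BK where BK: "finite BK" "cvs.independent BK" "cvs.span BK = K"
    using basis_of_subspace[OF finite_dim_subspace[OF C(2) subK KC], of "{}"]
    by (auto simp: cvs.independent_empty)
  have BKC: "BK \<subseteq> C" using BK(3) KC cvs.span_superset by blast
  obtain B where B: "BK \<subseteq> B" "finite B" "cvs.independent B" "cvs.span B = C"
    using basis_of_subspace[OF C(2) BKC BK(2)] by metis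
  have BC: "B \<subseteq> C" using B(4) cvs.span_superset by blast
  \<comment> \<open>The span of \<open>M\<close> is a complement of \<open>K\<close> in
    \<open>C\<close>. It remains to show that the coordinates of \<open>t\<close> on
    \<open>M\<close> \<times> \<open>M\<close> vanish: every other basis tensor has a factor in
    \<open>K\<close>.\<close>
  define M where "M = B - BK"
  have M: "finite M" "M \<subseteq> B" "M \<subseteq> C" using B BC by (auto simp: M_def)
  have zero: "s m = 0" if s: "(\<Sum>m\<in>M. s m *\<^sub>C m) \<in> K" and m: "m \<in> M" for s m
  proof -
    let ?x = "\<Sum>m\<in>M. s m *\<^sub>C m"
    have lin: "clinear_on UNIV (coord B m)" by (rule clinear_on_coord[OF B(3)])
    have "coord B m ?x = (\<Sum>m'\<in>M. s m' * coord B m m')"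
      by (subst clinear_on_sum[OF lin cvs.subspace_UNIV])
        (simp_all add: clinear_on_scale[OF lin] scaleC_complex_def)
    also have "\<dots> = (\<Sum>m'\<in>M. if m' = m then s m' else 0)"
      by (rule sum.cong) (use M(2) in \<open>auto simp: coord_basis[OF B(3)]\<close>)
    finally have "coord B m ?x = s m" using m M(1) by simp
    moreover have "coord B m ?x = 0"
    proof (rule clinear_on_span_eq[OF lin _ cvs.subspace_UNIV subset_UNIV, of "\<lambda>_. 0"])
      show "?x \<in> cvs.span BK" using s BK(3) by simp
      show "clinear_on UNIV (\<lambda>_::'a. 0::complex)" by (simp add: clinear_on_def)
      show "\<And>k. k \<in> BK \<Longrightarrow> coord B m k = 0"
        using m B(1) by (auto simp: coord_basis[OF B(3)] M_def)
    qed
    ultimately show ?thesis by simp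
  qed
  \<comment> \<open>The coordinates of \<open>t\<close> in the basis tensors; by the next fact every
    bilinear map is evaluated on \<open>t\<close> through this matrix.\<close>
  define c where "c m n = tensor_lift C C (\<lambda>a b. coord B m a * coord B n b) t" for m n
  have lift: "tensor_lift C C F t = (\<Sum>m\<in>B. \<Sum>n\<in>B. c m n *\<^sub>C F m n)"
    if F: "bilinear_on C C F" for F :: "'a \<Rightarrow> 'a \<Rightarrow> 'z::complex_vector"
  proof -
    have exp: "F a b = (\<Sum>m\<in>B. \<Sum>n\<in>B. (coord B m a * coord B n b) *\<^sub>C F m n)"
      if ab: "a \<in> C" "b \<in> C" for a b
    proof -
      have linl: "clinear_on C (\<lambda>a. F a b)" and linr: "clinear_on C (F a)" if "a \<in> C" for a
        using F ab that by (auto simp: bilinear_on_def)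
      have "F a b = F (\<Sum>m\<in>B. coord B m a *\<^sub>C m) b"
        using sum_coord[OF B(3,2)] ab B(4) by simp
      also have "\<dots> = (\<Sum>m\<in>B. coord B m a *\<^sub>C F m b)"
        using BC C(1) clinear_on_scale[OF linl[OF ab(1)]]
        by (subst clinear_on_sum[OF linl[OF ab(1)] C(1)]) (auto simp: cvs.subspace_scale intro!: sum.cong)
      also have "\<dots> = (\<Sum>m\<in>B. coord B m a *\<^sub>C (\<Sum>n\<in>B. coord B n b *\<^sub>C F m n))"
      proof (rule sum.cong[OF refl])
        fix m assume "m \<in> B"
        then have m: "m \<in> C" using BC by blast
        have "F m b = F m (\<Sum>n\<in>B. coord B n b *\<^sub>C n)"
          using sum_coord[OF B(3,2)] ab B(4) by simp
        also have "\<dots> = (\<Sum>n\<in>B. coord B n b *\<^sub>C F m n)"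
          using BC C(1) clinear_on_scale[OF linr[OF m]]
          by (subst clinear_on_sum[OF linr[OF m] C(1)]) (auto simp: cvs.subspace_scale intro!: sum.cong)
        finally show "coord B m a *\<^sub>C F m b = coord B m a *\<^sub>C (\<Sum>n\<in>B. coord B n b *\<^sub>C F m n)"
          by simp
      qed
      finally show ?thesis by (simp add: cvs.scale_sum_right)
    qed
    have "tensor_lift C C F t =
        tensor_lift C C (\<lambda>a b. \<Sum>m\<in>B. \<Sum>n\<in>B. (coord B m a * coord B n b) *\<^sub>C F m n) t"
      by (rule tensor_lift_cong[OF t C(1) exp])
    also have "\<dots> = (\<Sum>m\<in>B. \<Sum>n\<in>B.
        tensor_lift C C (\<lambda>a b. (coord B m a * coord B n b) *\<^sub>C F m n) t)"
      by (simp add: tensor_lift_sum)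
    also have "\<dots> = (\<Sum>m\<in>B. \<Sum>n\<in>B. c m n *\<^sub>C F m n)"
      unfolding c_def
      by (intro sum.cong refl tensor_lift_linear[OF t C(1) _ cvs.subspace_UNIV, symmetric])
        (auto simp: clinear_on_def cvs.scale_left_distrib scaleC_complex_def)
    finally show ?thesis .
  qed
  have c0: "c m n = 0" if m: "m \<in> M" and n: "n \<in> M" for m n
  proof -
    have RB: "R i k = 0" if "k \<in> B" "k \<notin> M" for i k
      using that BK(3) K cvs.span_superset[of BK] by (auto simp: M_def)
    \<comment> \<open>Pair the hypothesis on \<open>t\<close> with the functional \<phi> \<otimes>
      \<psi>. The indices in \<open>BK\<close> drop out because every \<open>R i\<close> kills
      \<open>K\<close>.\<close>
    have *: "(\<Sum>m\<in>M. \<Sum>n\<in>M. c m n * (\<phi> (R i m) * \<psi> (R j n))) = 0"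
      if \<phi>: "clinear_on UNIV \<phi>" and \<psi>: "clinear_on UNIV \<psi>" for i j and \<phi> \<psi> :: "'x \<Rightarrow> complex"
    proof -
      let ?b = "\<lambda>x y. \<phi> x * \<psi> y"
      have b: "bilinear_on UNIV UNIV ?b"
        by (rule bilinear_onI) (use \<phi> \<psi> in \<open>simp_all add: clinear_on_def scaleC_complex_def algebra_simps\<close>)
      let ?F = "\<lambda>a b. \<phi> (R i a) * \<psi> (R j b)"
      have F: "bilinear_on C C ?F"
        by (rule bilinear_onI)
          (use \<phi> \<psi> R[of i] R[of j] in
            \<open>simp_all add: clinear_on_def scaleC_complex_def algebra_simps\<close>)
      have "0 = tensor_lift UNIV UNIV ?b (tensor_lift C C (\<lambda>a b. R i a \<otimes>\<^sub>C R j b) t)"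
        using R_t clinear_on_zero[OF clinear_on_tensor_lift[OF cvs.subspace_UNIV cvs.subspace_UNIV b]]
          cvs.subspace_0[OF subspace_tensor_space] by metis
      also have "\<dots> = tensor_lift C C (\<lambda>a c. tensor_lift UNIV UNIV ?b (R i a \<otimes>\<^sub>C R j c)) t"
        by (rule tensor_lift_linear[OF t C(1)
              clinear_on_tensor_lift[OF cvs.subspace_UNIV cvs.subspace_UNIV b]
              subspace_tensor_space])
          (simp add: tens_in_tensor_space)
      also have "\<dots> = tensor_lift C C ?F t"
        by (simp add: tensor_lift_tens[OF cvs.subspace_UNIV cvs.subspace_UNIV b])
      also have "\<dots> = (\<Sum>m\<in>B. \<Sum>n\<in>B. c m n *\<^sub>C ?F m n)"
        by (rule lift[OF F])
      also have "\<dots> = (\<Sum>m\<in>M. \<Sum>n\<in>B. c m n *\<^sub>C ?F m n)"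
        by (rule sum.mono_neutral_right)
          (use B(2) M RB clinear_on_zero[OF \<phi>] in auto)
      also have "\<dots> = (\<Sum>m\<in>M. \<Sum>n\<in>M. c m n *\<^sub>C ?F m n)"
        by (intro sum.cong refl sum.mono_neutral_right)
          (use B(2) M RB clinear_on_zero[OF \<psi>] in auto)
      finally show ?thesis by (simp add: scaleC_complex_def)
    qed
    have R_sum: "\<phi> (R i (\<Sum>m\<in>M. s m *\<^sub>C m)) = (\<Sum>m\<in>M. s m * \<phi> (R i m))"
      if \<phi>: "clinear_on UNIV \<phi>" for \<phi> :: "'x \<Rightarrow> complex" and s i
    proof -
      have "R i (\<Sum>m\<in>M. s m *\<^sub>C m) = (\<Sum>m\<in>M. s m *\<^sub>C R i m)"
        using M(3) C(1) clinear_on_scale[OF R]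
        by (subst clinear_on_sum[OF R C(1)]) (auto simp: cvs.subspace_scale subset_iff)
      then show ?thesis
        by (simp add: clinear_on_sum[OF \<phi> cvs.subspace_UNIV] clinear_on_scale[OF \<phi>]
            scaleC_complex_def)
    qed
    have in_K: "(\<Sum>m\<in>M. s m *\<^sub>C m) \<in> K"
      if "\<And>i \<phi>. clinear_on UNIV \<phi> \<Longrightarrow> (\<Sum>m\<in>M. s m * \<phi> (R i m)) = (0::complex)" for s
    proof -
      have "R i (\<Sum>m\<in>M. s m *\<^sub>C m) = 0" for i
        by (rule functional_eqI) (simp add: R_sum that clinear_on_zero)
      moreover have "(\<Sum>m\<in>M. s m *\<^sub>C m) \<in> C"
        using M(3) C(1) by (auto intro!: cvs.subspace_sum cvs.subspace_scale)
      ultimately show ?thesis using K by simp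
    qed
    \<comment> \<open>With \<psi> and j fixed, the inner sums are coefficients of a combination of
      \<open>M\<close> that all the \<open>R i\<close> annihilate. It lies in \<open>K\<close>, so
      its coefficients vanish. The same argument in the second index then gives
      \<open>c m n = 0\<close>.\<close>
    have s0: "(\<Sum>n\<in>M. c m' n * \<psi> (R j n)) = 0"
      if \<psi>: "clinear_on UNIV \<psi>" and m': "m' \<in> M" for \<psi> :: "'x \<Rightarrow> complex" and j m'
    proof (rule zero[OF in_K m'])
      fix i and \<phi> :: "'x \<Rightarrow> complex" assume "clinear_on UNIV \<phi>"
      from *[OF this \<psi>, of i j]
      show "(\<Sum>m\<in>M. (\<Sum>n\<in>M. c m n * \<psi> (R j n)) * \<phi> (R i m)) = 0"
        by (simp add: sum_distrib_right sum_distrib_left mult_ac)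
    qed
    show ?thesis
      by (rule zero[OF in_K n]) (rule s0[OF _ m])
  qed
  have mem: "c m n *\<^sub>C (m \<otimes>\<^sub>C n) \<in> tensor_space A A'" if "m \<in> A" "n \<in> A'" for m n A A'
    using that by (intro cvs.subspace_scale subspace_tensor_space tens_in_tensor_space)
  have BKK: "BK \<subseteq> K" using BK(3) cvs.span_superset by blast
  have split: "sum f B = sum f BK + sum f M" for f :: "'a \<Rightarrow> ('a, 'a) tensor"
    unfolding M_def using B(1,2) by (simp add: sum.subset_diff add.commute)
  have "t = (\<Sum>m\<in>B. \<Sum>n\<in>B. c m n *\<^sub>C (m \<otimes>\<^sub>C n))"
    using lift[OF bilinear_on_tens] tensor_lift_self[OF t C(1) C(1)] by simp
  also have "\<dots> = (\<Sum>m\<in>M. \<Sum>n\<in>B. c m n *\<^sub>C (m \<otimes>\<^sub>C n)) + (\<Sum>m\<in>BK. \<Sum>n\<in>B. c m n *\<^sub>C (m \<otimes>\<^sub>C n))"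
    by (subst split) (rule add.commute)
  also have "(\<Sum>m\<in>M. \<Sum>n\<in>B. c m n *\<^sub>C (m \<otimes>\<^sub>C n)) = (\<Sum>m\<in>M. \<Sum>n\<in>BK. c m n *\<^sub>C (m \<otimes>\<^sub>C n))"
    by (simp add: split c0)
  finally have "t = (\<Sum>m\<in>M. \<Sum>n\<in>BK. c m n *\<^sub>C (m \<otimes>\<^sub>C n)) +
      (\<Sum>m\<in>BK. \<Sum>n\<in>B. c m n *\<^sub>C (m \<otimes>\<^sub>C n))" .
  moreover have "(\<Sum>m\<in>M. \<Sum>n\<in>BK. c m n *\<^sub>C (m \<otimes>\<^sub>C n)) \<in> tensor_space C K"
    by (intro cvs.subspace_sum subspace_tensor_space mem) (use M BKK in auto)
  moreover have "(\<Sum>m\<in>BK. \<Sum>n\<in>B. c m n *\<^sub>C (m \<otimes>\<^sub>C n)) \<in> tensor_space K C"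
    by (intro cvs.subspace_sum subspace_tensor_space mem) (use BC BKK in auto)
  ultimately show ?thesis by blast
qed

section \<open>Hopf algebras\<close>

context hopf_algebra
begin

text \<open>\<open>sw h F\<close> is \<open>\<Sum> F h\<^sub>1 h\<^sub>2\<close>.\<close>

abbreviation sw :: "'a \<Rightarrow> ('a \<Rightarrow> 'a \<Rightarrow> 'c::complex_vector) \<Rightarrow> 'c" where
  "sw h F \<equiv> tensor_lift (carrier H) (carrier H) F (comult H h)"

lemma comult_in: "h \<in> carrier H \<Longrightarrow> comult H h \<in> tensor_space (carrier H) (carrier H)"
  using comult_closed by (rule funcset_mem)

lemma antipode_in: "h \<in> carrier H \<Longrightarrow> antipode H h \<in> carrier H"
  using antipode_closed by (rule funcset_mem)

lemmas carrier_add = cvs.subspace_add[OF subspace_carrier]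
lemmas carrier_scale = cvs.subspace_scale[OF subspace_carrier]
lemmas carrier_diff = cvs.subspace_diff[OF subspace_carrier]
lemmas carrier_sum = cvs.subspace_sum[OF subspace_carrier]
lemmas carrier_simps = carrier_add carrier_scale carrier_diff carrier_sum
  cvs.subspace_0[OF subspace_carrier] antipode_in

lemmas mult_linear = bilinear_onD[OF mult_bilinear]
lemmas mult_zero = bilinear_on_zero[OF mult_bilinear, OF cvs.subspace_0[OF subspace_carrier]]
lemmas counit_simps = clinear_on_add[OF counit_linear] clinear_on_scale[OF counit_linear]
  clinear_on_diff[OF counit_linear subspace_carrier]
lemmas antipode_simps = clinear_on_add[OF antipode_linear] clinear_on_scale[OF antipode_linear]

lemma mult_linear_left: "b \<in> carrier H \<Longrightarrow> clinear_on (carrier H) (\<lambda>a. a \<otimes> b)"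
  and mult_linear_right: "a \<in> carrier H \<Longrightarrow> clinear_on (carrier H) (\<lambda>b. a \<otimes> b)"
  using mult_bilinear by (simp_all add: bilinear_on_def)

lemma counit_zero: "counit H 0 = 0"
  by (rule clinear_on_zero[OF counit_linear cvs.subspace_0[OF subspace_carrier]])

lemma one_neq_zero: "\<one> \<noteq> 0"
  using counit_one counit_zero by auto

section \<open>Rules for computing with Sweedler sums\<close>

lemma sw_cong:
  "h \<in> carrier H \<Longrightarrow> (\<And>a b. a \<in> carrier H \<Longrightarrow> b \<in> carrier H \<Longrightarrow> F a b = G a b) \<Longrightarrow> sw h F = sw h G"
  by (rule tensor_lift_cong[OF comult_in subspace_carrier])

lemma sw_linear:
  "h \<in> carrier H \<Longrightarrow> clinear_on S \<phi> \<Longrightarrow> cvs.subspace S \<Longrightarrow>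
    (\<And>a b. a \<in> carrier H \<Longrightarrow> b \<in> carrier H \<Longrightarrow> F a b \<in> S) \<Longrightarrow>
    \<phi> (sw h F) = sw h (\<lambda>a b. \<phi> (F a b))"
  by (rule tensor_lift_linear[OF comult_in subspace_carrier])

lemma sw_closed:
  "h \<in> carrier H \<Longrightarrow> cvs.subspace S \<Longrightarrow>
    (\<And>a b. a \<in> carrier H \<Longrightarrow> b \<in> carrier H \<Longrightarrow> F a b \<in> S) \<Longrightarrow> sw h F \<in> S"
  by (rule tensor_lift_closed[OF comult_in subspace_carrier])

lemmas clinear_on_lift = clinear_on_tensor_lift[OF subspace_carrier subspace_carrier]
lemmas lift_tens = tensor_lift_tens[OF subspace_carrier subspace_carrier]

lemma clinear_on_sw:
  assumes "bilinear_on (carrier H) (carrier H) F"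
  shows "clinear_on (carrier H) (\<lambda>h. sw h F)"
  by (rule clinear_on_compose[OF comult_linear clinear_on_lift[OF assms]])
    (use comult_in in blast)

lemma sw_tens: "h \<in> carrier H \<Longrightarrow> sw h (\<otimes>\<^sub>C) = comult H h"
  by (rule tensor_lift_self[OF comult_in subspace_carrier subspace_carrier])

text \<open>Converts trilinearity into bilinearity in a parameter and a tensor, so that a trilinear
  map can be lifted in two stages to a triple tensor product.\<close>

lemma bilinear_on_lift:
  assumes "\<And>c. c \<in> A \<Longrightarrow> bilinear_on (carrier H) (carrier H) (F c)"
    and "\<And>a b. a \<in> carrier H \<Longrightarrow> b \<in> carrier H \<Longrightarrow> clinear_on A (\<lambda>c. F c a b)"
    and "cvs.subspace A"
  shows "bilinear_on A (tensor_space (carrier H) (carrier H))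
    (\<lambda>c. tensor_lift (carrier H) (carrier H) (F c))"
proof (rule bilinear_onI)
  fix c c' and t :: "('a, 'a) tensor" and k
  assume t: "t \<in> tensor_space (carrier H) (carrier H)" and c: "c \<in> A"
  note cong = tensor_lift_cong[OF t subspace_carrier]
  show "tensor_lift (carrier H) (carrier H) (F (k *\<^sub>C c)) t =
      k *\<^sub>C tensor_lift (carrier H) (carrier H) (F c) t"
    unfolding tensor_lift_scale[symmetric]
    by (rule cong) (use assms(2) c in \<open>auto simp: clinear_on_def\<close>)
  assume c': "c' \<in> A"
  show "tensor_lift (carrier H) (carrier H) (F (c + c')) t =
      tensor_lift (carrier H) (carrier H) (F c) t + tensor_lift (carrier H) (carrier H) (F c') t"
    unfolding tensor_lift_add[symmetric]
    by (rule cong) (use assms(2) c c' in \<open>auto simp: clinear_on_def\<close>)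
qed (use clinear_on_lift[OF assms(1)] in \<open>auto simp: clinear_on_def\<close>)

lemma bilinear_on_flip: "bilinear_on A B F \<Longrightarrow> bilinear_on B A (\<lambda>b a. F a b)"
  by (simp add: bilinear_on_def)

text \<open>Coassociativity tested against a trilinear map. \<open>F\<close> factors through a
  linear map \<open>?L\<close> on H \<otimes> (H \<otimes> H); applying \<open>?L\<close> to the two
  sides of the coassociativity axiom and moving it inside the Sweedler sums gives the two iterated
  sums.\<close>

lemma sw_coassoc:
  assumes h: "h \<in> carrier H"
    and F12: "\<And>c. c \<in> carrier H \<Longrightarrow> bilinear_on (carrier H) (carrier H) (\<lambda>a b. F a b c)"
    and F23: "\<And>a. a \<in> carrier H \<Longrightarrow> bilinear_on (carrier H) (carrier H) (F a)"
  shows "sw h (\<lambda>r c. sw r (\<lambda>a b. F a b c)) = sw h (\<lambda>a r. sw r (\<lambda>b c. F a b c))"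
proof -
  let ?C = "carrier H" and ?T = "tensor_space (carrier H) (carrier H)"
  let ?G = "\<lambda>a t. tensor_lift ?C ?C (F a) t"
  have G: "bilinear_on ?C ?T ?G"
    by (rule bilinear_on_lift[OF F23 _ subspace_carrier]) (use F12 in \<open>auto simp: bilinear_on_def\<close>)
  let ?L = "tensor_lift ?C ?T ?G"
  note L = clinear_on_tensor_lift[OF subspace_carrier subspace_tensor_space G]
    and L_tens = tensor_lift_tens[OF subspace_carrier subspace_tensor_space G]
  let ?P = "\<lambda>t c. tensor_lift ?C ?C (\<lambda>a b. a \<otimes>\<^sub>C (b \<otimes>\<^sub>C c)) t"
  have P: "bilinear_on ?T ?C ?P"
    by (rule bilinear_on_flip, rule bilinear_on_lift[OF _ _ subspace_carrier])
      (auto intro!: bilinear_onI simp: clinear_on_def tens_linear)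
  note A = clinear_on_tensor_lift[OF subspace_tensor_space subspace_carrier P]
    and A_tens = tensor_lift_tens[OF subspace_tensor_space subspace_carrier P]
  have "sw h (\<lambda>a r. sw r (F a)) = sw h (\<lambda>a r. ?L (a \<otimes>\<^sub>C comult H r))"
    by (rule sw_cong[OF h]) (simp add: L_tens comult_in)
  also have "\<dots> = ?L (sw h (\<lambda>a r. a \<otimes>\<^sub>C comult H r))"
    by (rule sw_linear[OF h L subspace_tensor_space, symmetric])
      (simp add: tens_in_tensor_space comult_in)
  also have "sw h (\<lambda>a r. a \<otimes>\<^sub>C comult H r) = tensor_assoc ?C (sw h (\<lambda>r c. comult H r \<otimes>\<^sub>C c))"
    by (rule coassoc[OF h, symmetric])
  also have "\<dots> = sw h (\<lambda>r c. tensor_lift ?T ?C ?P (comult H r \<otimes>\<^sub>C c))"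
    unfolding tensor_assoc_def
    by (rule sw_linear[OF h A subspace_tensor_space]) (simp add: tens_in_tensor_space comult_in)
  also have "\<dots> = sw h (\<lambda>r c. sw r (\<lambda>a b. a \<otimes>\<^sub>C (b \<otimes>\<^sub>C c)))"
    by (rule sw_cong[OF h]) (simp add: A_tens comult_in)
  also have "?L \<dots> = sw h (\<lambda>r c. ?L (sw r (\<lambda>a b. a \<otimes>\<^sub>C (b \<otimes>\<^sub>C c))))"
    by (intro sw_linear[OF h L subspace_tensor_space] sw_closed subspace_tensor_space)
      (simp_all add: tens_in_tensor_space)
  also have "\<dots> = sw h (\<lambda>r c. sw r (\<lambda>a b. F a b c))"
  proof (rule sw_cong[OF h])
    fix r c assume r: "r \<in> ?C" and c: "c \<in> ?C"
    have "?L (sw r (\<lambda>a b. a \<otimes>\<^sub>C (b \<otimes>\<^sub>C c))) = sw r (\<lambda>a b. ?L (a \<otimes>\<^sub>C (b \<otimes>\<^sub>C c)))"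
      by (rule sw_linear[OF r L subspace_tensor_space]) (simp add: tens_in_tensor_space c)
    also have "\<dots> = sw r (\<lambda>a b. F a b c)"
      by (rule sw_cong[OF r]) (simp add: L_tens tens_in_tensor_space c lift_tens[OF F23])
    finally show "?L (sw r (\<lambda>a b. a \<otimes>\<^sub>C (b \<otimes>\<^sub>C c))) = sw r (\<lambda>a b. F a b c)" .
  qed
  finally show ?thesis ..
qed

lemma sw_mult:
  assumes "h \<in> carrier H" "k \<in> carrier H" and F: "bilinear_on (carrier H) (carrier H) F"
  shows "sw (h \<otimes> k) F = sw h (\<lambda>a b. sw k (\<lambda>c d. F (a \<otimes> c) (b \<otimes> d)))"
proof -
  have "sw (h \<otimes> k) F = tensor_lift (carrier H) (carrier H) F
      (sw h (\<lambda>a b. sw k (\<lambda>c d. (a \<otimes> c) \<otimes>\<^sub>C (b \<otimes> d))))"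
    using assms(1,2) by (simp add: comult_mult tensor_mult_def)
  also have "\<dots> = sw h (\<lambda>a b. tensor_lift (carrier H) (carrier H) F
      (sw k (\<lambda>c d. (a \<otimes> c) \<otimes>\<^sub>C (b \<otimes> d))))"
    by (intro sw_linear[OF assms(1) clinear_on_lift[OF F] subspace_tensor_space]
        sw_closed[OF assms(2)] subspace_tensor_space) (simp add: tens_in_tensor_space)
  also have "\<dots> = sw h (\<lambda>a b. sw k (\<lambda>c d. F (a \<otimes> c) (b \<otimes> d)))"
  proof (rule sw_cong[OF assms(1)])
    fix a b assume ab: "a \<in> carrier H" "b \<in> carrier H"
    have "tensor_lift (carrier H) (carrier H) F (sw k (\<lambda>c d. (a \<otimes> c) \<otimes>\<^sub>C (b \<otimes> d))) =
        sw k (\<lambda>c d. tensor_lift (carrier H) (carrier H) F ((a \<otimes> c) \<otimes>\<^sub>C (b \<otimes> d)))"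
      by (rule sw_linear[OF assms(2) clinear_on_lift[OF F] subspace_tensor_space])
        (use ab in \<open>simp add: tens_in_tensor_space\<close>)
    also have "\<dots> = sw k (\<lambda>c d. F (a \<otimes> c) (b \<otimes> d))"
      by (rule sw_cong[OF assms(2)]) (use ab in \<open>simp add: lift_tens[OF F]\<close>)
    finally show "tensor_lift (carrier H) (carrier H) F (sw k (\<lambda>c d. (a \<otimes> c) \<otimes>\<^sub>C (b \<otimes> d))) = \<dots>" .
  qed
  finally show ?thesis .
qed

lemma sw_comult_tens:
  assumes "comult H h = a \<otimes>\<^sub>C b" "a \<in> carrier H" "b \<in> carrier H"
    and "bilinear_on (carrier H) (carrier H) F"
  shows "sw h F = F a b"
  using assms by (simp add: lift_tens)

lemma sw_comult_tens2:
  assumes "comult H h = a \<otimes>\<^sub>C b + c \<otimes>\<^sub>C d"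
    and "a \<in> carrier H" "b \<in> carrier H" "c \<in> carrier H" "d \<in> carrier H"
    and "bilinear_on (carrier H) (carrier H) F"
  shows "sw h F = F a b + F c d"
  using assms by (simp add: lift_tens clinear_on_add[OF clinear_on_lift] tens_in_tensor_space)


subsection \<open>Group-like and primitive elements\<close>

definition grouplikes :: "'a set" where
  "grouplikes = {g \<in> carrier H. counit H g = 1 \<and> comult H g = g \<otimes>\<^sub>C g}"

lemma grouplikesD:
  assumes "g \<in> grouplikes"
  shows "g \<in> carrier H" "counit H g = 1" "comult H g = g \<otimes>\<^sub>C g"
  using assms by (simp_all add: grouplikes_def)

lemma sw_grouplike:
  "g \<in> grouplikes \<Longrightarrow> bilinear_on (carrier H) (carrier H) F \<Longrightarrow> sw g F = F g g"
  by (rule sw_comult_tens) (auto dest: grouplikesD)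

lemma grouplikesI:
  assumes "g \<in> carrier H" "counit H g = 1"
    and "sw g (\<otimes>\<^sub>C) = g \<otimes>\<^sub>C g"
  shows "g \<in> grouplikes"
  using assms by (simp add: grouplikes_def sw_tens)

lemma one_grouplike: "\<one> \<in> grouplikes"
  by (simp add: grouplikes_def counit_one comult_one)

lemma bilinear_on_mult_mult:
  assumes "bilinear_on (carrier H) (carrier H) F" "x \<in> carrier H" "y \<in> carrier H"
  shows "bilinear_on (carrier H) (carrier H) (\<lambda>a b. F (x \<otimes> a) (y \<otimes> b))"
  by (rule bilinear_onI) (use assms in \<open>simp_all add: mult_linear bilinear_onD[OF assms(1)]\<close>)

lemma bilinear_on_sw:
  assumes "bilinear_on (carrier H) (carrier H) F" "k \<in> carrier H"
  shows "bilinear_on (carrier H) (carrier H) (\<lambda>a b. sw k (\<lambda>c d. F (a \<otimes> c) (b \<otimes> d)))"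
proof (rule bilinear_onI)
  note F = bilinear_onD[OF assms(1)]
  fix c u u' v v'
  note [simp] = mult_linear F
  assume uv [simp]: "u \<in> carrier H" "v \<in> carrier H"
  show "sw k (\<lambda>a b. F (c *\<^sub>C u \<otimes> a) (v \<otimes> b)) = c *\<^sub>C sw k (\<lambda>a b. F (u \<otimes> a) (v \<otimes> b))"
    unfolding tensor_lift_scale[symmetric] by (rule sw_cong[OF assms(2)]) simp
  show "sw k (\<lambda>a b. F (u \<otimes> a) (c *\<^sub>C v \<otimes> b)) = c *\<^sub>C sw k (\<lambda>a b. F (u \<otimes> a) (v \<otimes> b))"
    unfolding tensor_lift_scale[symmetric] by (rule sw_cong[OF assms(2)]) simp
  show "sw k (\<lambda>a b. F ((u + u') \<otimes> a) (v \<otimes> b)) =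
      sw k (\<lambda>a b. F (u \<otimes> a) (v \<otimes> b)) + sw k (\<lambda>a b. F (u' \<otimes> a) (v \<otimes> b))" if "u' \<in> carrier H"
    unfolding tensor_lift_add[symmetric] by (rule sw_cong[OF assms(2)]) (simp add: that)
  show "sw k (\<lambda>a b. F (u \<otimes> a) ((v + v') \<otimes> b)) =
      sw k (\<lambda>a b. F (u \<otimes> a) (v \<otimes> b)) + sw k (\<lambda>a b. F (u \<otimes> a) (v' \<otimes> b))" if "v' \<in> carrier H"
    unfolding tensor_lift_add[symmetric] by (rule sw_cong[OF assms(2)]) (simp add: that)
qed

lemma sw_grouplike_mult:
  assumes "g \<in> grouplikes" "k \<in> carrier H" "bilinear_on (carrier H) (carrier H) F"
  shows "sw (g \<otimes> k) F = sw k (\<lambda>c d. F (g \<otimes> c) (g \<otimes> d))"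
  using sw_mult[OF _ assms(2,3), of g] sw_grouplike[OF assms(1) bilinear_on_sw[OF assms(3,2)]]
    grouplikesD(1)[OF assms(1)] by simp

lemma mult_grouplike:
  assumes "g \<in> grouplikes" "k \<in> grouplikes"
  shows "g \<otimes> k \<in> grouplikes"
proof (rule grouplikesI)
  note gk = grouplikesD[OF assms(1)] grouplikesD[OF assms(2)]
  show "sw (g \<otimes> k) (\<otimes>\<^sub>C) = (g \<otimes> k) \<otimes>\<^sub>C (g \<otimes> k)"
    unfolding sw_grouplike_mult[OF assms(1) gk(4) bilinear_on_tens]
    by (rule sw_grouplike[OF assms(2) bilinear_on_mult_mult[OF bilinear_on_tens gk(1,1)]])
qed (use assms in \<open>auto simp: grouplikes_def counit_mult\<close>)

lemma antipode_grouplike_mult: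
  assumes "g \<in> grouplikes"
  shows "antipode H g \<otimes> g = \<one>" "g \<otimes> antipode H g = \<one>"
proof -
  note g = grouplikesD[OF assms]
  have "bilinear_on (carrier H) (carrier H) (\<lambda>a b. antipode H a \<otimes> b)"
    "bilinear_on (carrier H) (carrier H) (\<lambda>a b. a \<otimes> antipode H b)"
    by (auto intro!: bilinear_onI simp: antipode_simps antipode_in mult_linear)
  from this[THEN sw_grouplike[OF assms]]
  show "antipode H g \<otimes> g = \<one>" "g \<otimes> antipode H g = \<one>"
    using antipode_left[OF g(1)] antipode_right[OF g(1)] g(2) by simp_all
qed

text \<open>For y = S(g), since gy = 1 and yg = 1: \<Delta>(y) = (y \<otimes> y)(g \<otimes>
  g)\<Delta>(y) = (y \<otimes> y)\<Delta>(gy) = (y \<otimes> y)\<Delta>(1) = y \<otimes> y.\<close>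

lemma antipode_grouplike:
  assumes "g \<in> grouplikes"
  shows "antipode H g \<in> grouplikes"
proof (rule grouplikesI)
  note g = grouplikesD[OF assms]
  let ?y = "antipode H g"
  show y: "?y \<in> carrier H" using g(1) by (rule antipode_in)
  have "counit H (?y \<otimes> g) = counit H ?y * counit H g"
    using y g(1) by (rule counit_mult)
  then show "counit H ?y = 1" using antipode_grouplike_mult[OF assms] g(2) counit_one by simp
  note b = bilinear_on_mult_mult[OF bilinear_on_tens y y]
  have "sw ?y (\<otimes>\<^sub>C) = sw ?y (\<lambda>c d. (?y \<otimes> (g \<otimes> c)) \<otimes>\<^sub>C (?y \<otimes> (g \<otimes> d)))"
    by (rule sw_cong[OF y])
      (simp add: m_assoc[symmetric] y g(1) antipode_grouplike_mult[OF assms])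
  also have "\<dots> = sw (g \<otimes> ?y) (\<lambda>c d. (?y \<otimes> c) \<otimes>\<^sub>C (?y \<otimes> d))"
    by (rule sw_grouplike_mult[OF assms y b, symmetric])
  also have "\<dots> = ?y \<otimes>\<^sub>C ?y"
    using sw_grouplike[OF one_grouplike b] y by (simp add: antipode_grouplike_mult[OF assms])
  finally show "sw ?y (\<otimes>\<^sub>C) = ?y \<otimes>\<^sub>C ?y" .
qed

lemma bilinear_on_functional:
  assumes "clinear_on A f" "clinear_on B g"
  shows "bilinear_on A B (\<lambda>a b. f a *\<^sub>C g b)"
  by (rule bilinear_onI) (use assms in \<open>simp_all add: clinear_on_def cvs.scale_left_distrib
      cvs.scale_right_distrib scaleC_complex_def mult.commute\<close>)

lemma clinear_on_carrier: "clinear_on UNIV f \<Longrightarrow> clinear_on (carrier H) f"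
  by (rule clinear_on_subset[OF _ subset_UNIV])

text \<open>Suppose g lies in the span of independent group-likes A that do not contain g. Applying
  the coordinate of k in A to the left factor of \<Delta>(g) gives coord(g) g from g itself and
  coord(g) k from its expansion. As g differs from k, all coordinates of g vanish, contradicting
  \<epsilon>(g) = 1.\<close>

lemma independent_grouplikes: "cvs.independent grouplikes"
proof -
  have "cvs.independent A" if "finite A" "A \<subseteq> grouplikes" for A
    using that
  proof (induction A rule: finite_induct)
    case empty
    show ?case by (rule cvs.independent_empty)
  next
    case (insert g A)
    then have ind: "cvs.independent A" and A: "A \<subseteq> grouplikes" and g: "g \<in> grouplikes" by auto
    have AC: "A \<subseteq> carrier H" using A grouplikesD(1) by blast
    have "g \<notin> cvs.span A"
    proof
      assume gA: "g \<in> cvs.span A"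
      have c: "coord A k g *\<^sub>C g = coord A k g *\<^sub>C k" if k: "k \<in> A" for k
      proof -
        let ?F = "\<lambda>a b. coord A k a *\<^sub>C b"
        have F: "bilinear_on (carrier H) (carrier H) ?F"
          by (rule bilinear_on_functional[OF clinear_on_carrier[OF clinear_on_coord[OF ind]]
                clinear_on_ident])
        have "(\<lambda>h. sw h ?F) g = (\<lambda>h. coord A k h *\<^sub>C k) g"
        proof (rule clinear_on_span_eq[OF clinear_on_sw[OF F] _ subspace_carrier AC gA])
          show "clinear_on (carrier H) (\<lambda>h. coord A k h *\<^sub>C k)"
            using clinear_on_coord[OF ind, of k]
            by (simp add: clinear_on_def cvs.scale_left_distrib scaleC_complex_def)
          fix s assume s: "s \<in> A"
          then show "sw s ?F = coord A k s *\<^sub>C k"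
            using A sw_grouplike[OF _ F] by (auto simp: coord_basis[OF ind])
        qed
        then show ?thesis using sw_grouplike[OF g F] by simp
      qed
      have "coord A k g = 0" if "k \<in> A" for k
        using c[OF that] that insert.hyps(2) by auto
      then have "g = 0" using sum_coord[OF ind insert.hyps(1) gA] by simp
      then show False
        using grouplikesD(2)[OF g] counit_zero by simp
    qed
    then show ?case using ind by (rule cvs.independent_insertI)
  qed
  then show ?thesis
    unfolding cvs.dependent_explicit by blast
qed

text \<open>The binomial theorem for the commuting elements x \<otimes> 1 and 1 \<otimes> x. In the
  induction the factor \<Delta>(x) is absorbed into the bilinear map, so \<open>F\<close> has to
  stay arbitrary.\<close>

lemma sw_primitive_pow:
  assumes x: "x \<in> carrier H" "comult H x = x \<otimes>\<^sub>C \<one> + \<one> \<otimes>\<^sub>C x"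
    and F: "bilinear_on (carrier H) (carrier H) F"
  shows "sw (x [^] n) F = (\<Sum>k\<le>n. of_nat (n choose k) *\<^sub>C F (x [^] k) (x [^] (n - k)))"
  using F
proof (induction n arbitrary: F)
  case 0
  then show ?case using sw_grouplike[OF one_grouplike, of F] by simp
next
  case (Suc n)
  let ?G = "\<lambda>a b. F (a \<otimes> x) b + F a (b \<otimes> x)"
  have G: "bilinear_on (carrier H) (carrier H) ?G"
    by (rule bilinear_onI)
      (simp_all add: x(1) mult_linear bilinear_onD[OF Suc.prems] cvs.scale_right_distrib)
  let ?f = "\<lambda>k. F (x [^] k) (x [^] (Suc n - k))"
  have xn: "x [^] k \<in> carrier H" for k :: nat using x(1) by (rule nat_pow_closed)
  have "sw (x [^] Suc n) F = sw (x [^] n) (\<lambda>a b. sw x (\<lambda>c d. F (a \<otimes> c) (b \<otimes> d)))"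
    using sw_mult[OF xn x(1) Suc.prems] by simp
  also have "\<dots> = sw (x [^] n) ?G"
  proof (rule sw_cong[OF xn])
    fix a b assume ab: "a \<in> carrier H" "b \<in> carrier H"
    show "sw x (\<lambda>c d. F (a \<otimes> c) (b \<otimes> d)) = ?G a b"
      using sw_comult_tens2[OF x(2) x(1) one_closed one_closed x(1)
          bilinear_on_mult_mult[OF Suc.prems ab]] ab by simp
  qed
  also have "\<dots> = (\<Sum>k\<le>n. of_nat (n choose k) *\<^sub>C ?G (x [^] k) (x [^] (n - k)))"
    by (rule Suc.IH[OF G])
  also have "\<dots> = (\<Sum>k\<le>n. of_nat (n choose k) *\<^sub>C (?f (Suc k) + ?f k))"
    by (rule sum.cong) (simp_all add: Suc_diff_le)
  also have "\<dots> = (\<Sum>k\<le>n. of_nat (n choose k) *\<^sub>C ?f (Suc k)) +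
      (\<Sum>k\<le>Suc n. of_nat (n choose k) *\<^sub>C ?f k)"
    by (simp add: cvs.scale_right_distrib sum.distrib)
  also have "(\<Sum>k\<le>Suc n. of_nat (n choose k) *\<^sub>C ?f k) =
      ?f 0 + (\<Sum>k\<le>n. of_nat (n choose Suc k) *\<^sub>C ?f (Suc k))"
    by (subst sum.atMost_Suc_shift) simp
  also have "(\<Sum>k\<le>n. of_nat (n choose k) *\<^sub>C ?f (Suc k)) +
      (?f 0 + (\<Sum>k\<le>n. of_nat (n choose Suc k) *\<^sub>C ?f (Suc k))) =
      ?f 0 + (\<Sum>k\<le>n. of_nat (Suc n choose Suc k) *\<^sub>C ?f (Suc k))"
    by (simp add: cvs.scale_left_distrib sum.distrib del: diff_Suc_Suc)
  also have "\<dots> = (\<Sum>k\<le>Suc n. of_nat (Suc n choose k) *\<^sub>C ?f k)"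
    by (subst sum.atMost_Suc_shift) simp
  finally show ?case .
qed

text \<open>The powers of a nonzero primitive element would be linearly independent: in a first relation
  expressing \<open>x\<^sup>n\<close> by lower powers, compare the coefficients of \<open>x \<otimes> x\<^sup>n\<^sup>-\<^sup>1\<close> in the coproduct.\<close>

lemma primitive_eq_0:
  assumes fd: "finite_dim (carrier H)"
    and x: "x \<in> carrier H" "comult H x = x \<otimes>\<^sub>C \<one> + \<one> \<otimes>\<^sub>C x"
  shows "x = 0"
proof -
  define s where "s n = x [^] n" for n :: nat
  have s: "s n \<in> carrier H" for n unfolding s_def using x(1) by (rule nat_pow_closed)
  obtain n c where n: "s n = (\<Sum>i<n. c i *\<^sub>C s i)" "cvs.independent (s ` {..<n})" "inj_on s {..<n}"
    by (rule first_linear_dependence[OF fd, of s]) (use s in auto)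
  have bl: "bilinear_on (carrier H) (carrier H) (\<lambda>a b. counit H a *\<^sub>C b)"
    by (rule bilinear_on_functional[OF counit_linear clinear_on_ident])
  have "x = counit H x *\<^sub>C \<one> + x"
    using counit_left[OF x(1)] sw_comult_tens2[OF x(2) x(1) one_closed one_closed x(1) bl]
    by (simp add: counit_one)
  \<comment> \<open>Used when the first relation already occurs at \<open>n = 1\<close>: then
    \<open>x\<close> is a multiple of \<one>, and the counit shows that the multiple is 0.\<close>
  then have ex: "counit H x = 0" using one_neq_zero by simp
  consider "n = 0" | "n = 1" | "n \<ge> 2" by linarith
  then show ?thesis
  proof cases
    case 1
    then show ?thesis using n(1) one_neq_zero by (simp add: s_def)
  next
    case 2
    then have "x = c 0 *\<^sub>C \<one>" using n(1) x(1) by (simp add: s_def)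
    moreover from this have "c 0 = 0"
      using ex by (simp add: counit_simps counit_one scaleC_complex_def)
    ultimately show ?thesis by simp
  next
    case 3
    let ?B = "s ` {..<n}"
    \<comment> \<open>\<open>?F\<close> reads off the coefficient of x \<otimes> x^(n-1). On
      \<Delta>(x^n) it gives the binomial coefficient n, on \<Delta>(x^i) with i < n it gives
      0.\<close>
    let ?f = "coord ?B (s 1)" and ?g = "coord ?B (s (n - 1))"
    have f: "?f (s i) = (if i = 1 then 1 else 0)" and g: "?g (s i) = (if i = n - 1 then 1 else 0)"
      if "i < n" for i
      using that 3 n(3) by (auto simp: coord_basis[OF n(2)] inj_on_def)
    let ?F = "\<lambda>a b. ?f a *\<^sub>C ?g b"
    have F: "bilinear_on (carrier H) (carrier H) ?F"
      by (rule bilinear_on_functional) (intro clinear_on_carrier clinear_on_coord n(2))+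
    have sw: "sw (s i) ?F = (\<Sum>k\<le>i. of_nat (i choose k) *\<^sub>C ?F (s k) (s (i - k)))" for i
      unfolding s_def[of i] using sw_primitive_pow[OF x F, of i] by (simp add: s_def)
    have "sw (s n) ?F = (\<Sum>k\<le>n. if k = 1 then of_nat n else 0)"
      unfolding sw
    proof (rule sum.cong[OF refl])
      fix k assume "k \<in> {..n}"
      \<comment> \<open>The two end terms contain \<open>s n\<close>, which is not one of the basis
        vectors, so its coordinates are not known directly. There the other factor is
        \<open>s 0\<close>, which both functionals kill since \<open>n \<ge> 2\<close>.\<close>
      then consider "k = 0" | "k = n" | "0 < k" "k < n" by fastforce
      then show "of_nat (n choose k) *\<^sub>C ?F (s k) (s (n - k)) = (if k = 1 then of_nat n else 0)"
        by cases (use 3 f[of k] g[of "n - k"] in \<open>auto simp: scaleC_complex_def f g\<close>)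
    qed
    also have "\<dots> = of_nat n" using 3 by simp
    finally have "sw (s n) ?F = of_nat n" .
    moreover have "sw (s n) ?F = (\<Sum>i<n. c i *\<^sub>C sw (s i) ?F)"
      unfolding n(1)
      by (subst clinear_on_sum[OF clinear_on_sw[OF F] subspace_carrier])
        (simp_all add: s carrier_scale clinear_on_scale[OF clinear_on_sw[OF F]] del: One_nat_def)
    moreover have "sw (s i) ?F = 0" if "i < n" for i
      unfolding sw
    proof (intro sum.neutral ballI)
      fix k assume k: "k \<in> {..i}"
      show "of_nat (i choose k) *\<^sub>C ?F (s k) (s (i - k)) = 0"
      proof (cases "k = 1")
        case True
        then have "?g (s (i - k)) = 0" using that 3 k by (subst g) auto
        then show ?thesis by simp
      next
        case False
        then have "?f (s k) = 0" using that k by (subst f) auto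
        then show ?thesis by simp
      qed
    qed
    then have "(\<Sum>i<n. c i *\<^sub>C sw (s i) ?F) = 0"
      by (intro sum.neutral ballI) (simp only: lessThan_iff cvs.scale_zero_right)
    ultimately have "of_nat n = (0::complex)" by (simp only:)
    then show ?thesis using 3 by simp
  qed
qed

subsection \<open>Cocommutative Hopf algebras\<close>

definition cocommutative :: bool where
  "cocommutative \<longleftrightarrow> (\<forall>h\<in>carrier H. sw h (\<lambda>a b. b \<otimes>\<^sub>C a) = comult H h)"

lemma sw_flip:
  assumes cocommutative "h \<in> carrier H" and F: "bilinear_on (carrier H) (carrier H) F"
  shows "sw h (\<lambda>a b. F b a) = sw h F"
proof -
  have "sw h F = tensor_lift (carrier H) (carrier H) F (sw h (\<lambda>a b. b \<otimes>\<^sub>C a))"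
    using assms(1,2) by (simp add: cocommutative_def)
  also have "\<dots> = sw h (\<lambda>a b. tensor_lift (carrier H) (carrier H) F (b \<otimes>\<^sub>C a))"
    by (rule sw_linear[OF assms(2) clinear_on_lift[OF F] subspace_tensor_space])
      (simp add: tens_in_tensor_space)
  also have "\<dots> = sw h (\<lambda>a b. F b a)"
    by (rule sw_cong[OF assms(2)]) (simp add: lift_tens[OF F])
  finally show ?thesis ..
qed

lemma bilinear_on_trilinear:
  assumes "clinear_on UNIV f" "bilinear_on (carrier H) (carrier H) F"
  shows "c \<in> carrier H \<Longrightarrow> bilinear_on (carrier H) (carrier H) (\<lambda>a b. f a *\<^sub>C F b c)"
    and "bilinear_on (carrier H) (carrier H) (\<lambda>b c. f a *\<^sub>C F b c)"
  using assms(1)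
  by (auto intro!: bilinear_onI simp: bilinear_onD[OF assms(2)] clinear_on_def scaleC_complex_def
      cvs.scale_left_distrib cvs.scale_right_distrib mult.commute)

text \<open>The action of the dual algebra on H, in which \<open>f\<close> sends h to h1 f(h2).
  Group-likes are simultaneous eigenvectors, g having eigenvalue f(g).\<close>

definition functional_op :: "('a \<Rightarrow> complex) \<Rightarrow> 'a \<Rightarrow> 'a" where
  "functional_op f h = sw h (\<lambda>a b. f b *\<^sub>C a)"

lemma bilinear_on_functional':
  "clinear_on UNIV f \<Longrightarrow> bilinear_on (carrier H) (carrier H) (\<lambda>a b. f b *\<^sub>C a)"
  by (rule bilinear_on_flip, rule bilinear_on_functional)
    (auto intro: clinear_on_carrier clinear_on_ident)

lemma functional_op_closed: "h \<in> carrier H \<Longrightarrow> functional_op f h \<in> carrier H"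
  unfolding functional_op_def
  by (rule sw_closed[OF _ subspace_carrier]) (auto intro: carrier_scale)

lemma functional_op_linear: "clinear_on UNIV f \<Longrightarrow> clinear_on (carrier H) (functional_op f)"
  unfolding functional_op_def[abs_def] by (rule clinear_on_sw[OF bilinear_on_functional'])

text \<open>By coassociativity the two composites are h1 f(h2) g(h3) and h1 g(h2) f(h3);
  cocommutativity exchanges h2 and h3.\<close>

lemma functional_op_commute:
  assumes cocommutative "clinear_on UNIV f" "clinear_on UNIV g" "h \<in> carrier H"
  shows "functional_op f (functional_op g h) = functional_op g (functional_op f h)"
proof -
  let ?T = "\<lambda>f g a b c. (f b * g c) *\<^sub>C a"
  have *: "functional_op f (functional_op g h) = sw h (\<lambda>a r. sw r (\<lambda>b c. ?T f g a b c))"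
    if f: "clinear_on UNIV f" and g: "clinear_on UNIV g" for f g
  proof -
    have "functional_op f (functional_op g h) = sw h (\<lambda>r c. functional_op f (g c *\<^sub>C r))"
      unfolding functional_op_def[of g]
      by (rule sw_linear[OF assms(4) functional_op_linear[OF f] subspace_carrier])
        (rule carrier_scale)
    also have "\<dots> = sw h (\<lambda>r c. sw r (\<lambda>a b. ?T f g a b c))"
    proof (rule sw_cong[OF assms(4)])
      fix r c assume r: "r \<in> carrier H"
      have "functional_op f (g c *\<^sub>C r) = g c *\<^sub>C functional_op f r"
        by (rule clinear_on_scale[OF functional_op_linear[OF f] r])
      also have "\<dots> = sw r (\<lambda>a b. ?T f g a b c)"
        unfolding functional_op_def tensor_lift_scale[symmetric] by (simp add: mult.commute)
      finally show "functional_op f (g c *\<^sub>C r) = sw r (\<lambda>a b. ?T f g a b c)" .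
    qed
    also have "\<dots> = sw h (\<lambda>a r. sw r (\<lambda>b c. ?T f g a b c))"
      by (rule sw_coassoc[OF assms(4)])
        (use f g in \<open>auto intro!: bilinear_onI simp: clinear_on_def scaleC_complex_def
          cvs.scale_left_distrib cvs.scale_right_distrib algebra_simps\<close>)
    finally show ?thesis .
  qed
  have "sw h (\<lambda>a r. sw r (\<lambda>b c. ?T f g a b c)) = sw h (\<lambda>a r. sw r (\<lambda>b c. ?T g f a b c))"
  proof (rule sw_cong[OF assms(4)])
    fix a r assume r: "r \<in> carrier H"
    have "bilinear_on (carrier H) (carrier H) (\<lambda>b c. ?T f g a b c)"
      by (rule bilinear_onI)
        (use assms(2,3) in \<open>auto simp: clinear_on_def scaleC_complex_def
          cvs.scale_left_distrib cvs.scale_right_distrib algebra_simps\<close>)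
    from sw_flip[OF assms(1) r this]
    show "sw r (\<lambda>b c. ?T f g a b c) = sw r (\<lambda>b c. ?T g f a b c)"
      by (simp add: mult.commute)
  qed
  then show ?thesis using *[OF assms(2,3)] *[OF assms(3,2)] by simp
qed

text \<open>For \<open>c \<noteq> g\<close> this is cocommutativity; for \<open>c = g\<close> translation by \<open>g\<^sup>-\<^sup>1\<close> makes \<open>y\<close> primitive,
  hence zero.\<close>

lemma skew_primitive:
  assumes "finite_dim (carrier H)" cocommutative
    and g: "g \<in> grouplikes" and c: "c \<in> grouplikes" and y: "y \<in> carrier H"
    and \<Delta>: "comult H y = y \<otimes>\<^sub>C c + g \<otimes>\<^sub>C y"
  shows "y \<in> cvs.span grouplikes"
proof (cases "c = g")
  case True
  let ?g' = "antipode H g"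
  have g': "?g' \<in> grouplikes" by (rule antipode_grouplike[OF g])
  note G = grouplikesD(1)[OF g] grouplikesD(1)[OF g']
  let ?z = "?g' \<otimes> y"
  have z: "?z \<in> carrier H" using G y by simp
  have "comult H ?z = sw ?z (\<otimes>\<^sub>C)" using sw_tens[OF z] ..
  also have "\<dots> = sw y (\<lambda>a b. (?g' \<otimes> a) \<otimes>\<^sub>C (?g' \<otimes> b))"
    by (rule sw_grouplike_mult[OF g' y bilinear_on_tens])
  also have "\<dots> = ?z \<otimes>\<^sub>C (?g' \<otimes> g) + (?g' \<otimes> g) \<otimes>\<^sub>C ?z"
    using sw_comult_tens2[OF \<Delta> y grouplikesD(1)[OF c] G(1) y
        bilinear_on_mult_mult[OF bilinear_on_tens G(2,2)]] True by simp
  finally have "comult H ?z = ?z \<otimes>\<^sub>C \<one> + \<one> \<otimes>\<^sub>C ?z"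
    by (simp add: antipode_grouplike_mult[OF g])
  then have "?z = 0" by (rule primitive_eq_0[OF assms(1) z])
  moreover have "y = g \<otimes> ?z"
    using G y by (simp add: m_assoc[symmetric] antipode_grouplike_mult[OF g])
  ultimately have "y = 0" using G mult_zero by simp
  then show ?thesis by (simp add: cvs.span_zero)
next
  case False
  note ind = independent_grouplikes
  let ?f = "coord grouplikes c"
  have f: "?f c = 1" "?f g = 0" using coord_basis[OF ind] c g False by auto
  let ?F = "\<lambda>a b. ?f a *\<^sub>C b"
  have F: "bilinear_on (carrier H) (carrier H) ?F"
    by (rule bilinear_on_functional[OF clinear_on_carrier[OF clinear_on_coord[OF ind]]
          clinear_on_ident])
  note C = y grouplikesD(1)[OF c] grouplikesD(1)[OF g] y
  \<comment> \<open>Evaluate \<open>?f\<close>, which is 1 at \<open>c\<close> and 0 at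
    \<open>g\<close>, on the left factor of \<Delta>(y) and then on the right one: the results are
    f(y) c and y + f(y) g. Cocommutativity equates them.\<close>
  have "?f y *\<^sub>C c = sw y ?F"
    using sw_comult_tens2[OF \<Delta> C F] f by simp
  also have "\<dots> = sw y (\<lambda>a b. ?F b a)"
    by (rule sw_flip[OF assms(2) y F, symmetric])
  also have "\<dots> = y + ?f y *\<^sub>C g"
    using sw_comult_tens2[OF \<Delta> C bilinear_on_flip[OF F]] f by simp
  finally have "y = ?f y *\<^sub>C c - ?f y *\<^sub>C g" by (simp add: algebra_simps)
  then show ?thesis
    using c g cvs.span_base cvs.span_scale cvs.span_diff by metis
qed

text \<open>Let x be a common eigenvector modulo W as in \<open>common_eigenvector_mod\<close>. In a
  basis that contains x and the group-likes, f(h2) h1 at h = x has no component outside x and W,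
  which gives \<Delta>(x) = x \<otimes> c + \<Sum> g \<otimes> y(g). Coassociativity yields
  \<Delta>(c) = c \<otimes> c and \<Delta>(y(g)) = y(g) \<otimes> c + g \<otimes> y(g). By
  \<open>skew_primitive\<close> every y(g) lies in W, so x = \<epsilon>(x) c + \<Sum> y(g) lies in
  W, a contradiction.\<close>

theorem span_grouplikes:
  assumes fd: "finite_dim (carrier H)" and cc: cocommutative
  shows "cvs.span grouplikes = carrier H"
proof (rule ccontr)
  let ?W = "cvs.span grouplikes" and ?C = "carrier H"
  assume "?W \<noteq> ?C"
  have GC: "grouplikes \<subseteq> ?C" using grouplikesD(1) by blast
  then have "?W \<subseteq> ?C" by (rule cvs.span_minimal) (rule subspace_carrier)
  with \<open>?W \<noteq> ?C\<close> have WC: "?W \<subset> ?C" by blast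
  let ?T = "functional_op ` {f. clinear_on UNIV f}"
  obtain x where x: "x \<in> ?C" "x \<notin> ?W" "\<And>T. T \<in> ?T \<Longrightarrow> \<exists>l. T x - l *\<^sub>C x \<in> ?W"
  proof (rule common_eigenvector_mod[OF fd subspace_carrier cvs.subspace_span WC, of ?T])
    fix T assume "T \<in> ?T"
    then obtain f where f: "T = functional_op f" "clinear_on UNIV f" by blast
    show lin: "clinear_on ?C T" using f functional_op_linear by simp
    show "T ` ?C \<subseteq> ?C" using f functional_op_closed by auto
    show "T ` ?W \<subseteq> ?W"
    proof
      fix y assume "y \<in> T ` ?W"
      then obtain w where w: "w \<in> ?W" "y = T w" by blast
      have "w \<in> ?C \<and> T w \<in> ?W"
        using w(1)
      proof (induction rule: cvs.span_induct_alt)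
        case base
        show ?case
          using clinear_on_zero[OF lin cvs.subspace_0[OF subspace_carrier]]
          by (simp add: cvs.span_zero cvs.subspace_0[OF subspace_carrier])
      next
        case (step k g w)
        have "T g = f g *\<^sub>C g"
          using sw_grouplike[OF step(1) bilinear_on_functional'[OF f(2)]]
          by (simp add: f(1) functional_op_def)
        moreover have "w \<in> ?C" "g \<in> ?C" using step GC by auto
        ultimately have "T (k *\<^sub>C g + w) = k *\<^sub>C (f g *\<^sub>C g) + T w"
          using lin by (simp add: clinear_on_add clinear_on_scale carrier_scale)
        with \<open>w \<in> ?C\<close> \<open>g \<in> ?C\<close> show ?case
          using step by (simp add: cvs.span_add cvs.span_scale cvs.span_base carrier_simps)
      qed
      then show "y \<in> ?W" using w by simp
    qed
  next
    fix S T y assume "S \<in> ?T" "T \<in> ?T" "y \<in> ?C"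
    then show "S (T y) = T (S y)" using functional_op_commute[OF cc] by auto
  qed blast
  have indx: "cvs.independent (insert x grouplikes)"
    using x(2) independent_grouplikes by (rule cvs.independent_insertI)
  have xG: "x \<notin> grouplikes" using x(2) cvs.span_base by blast
  have sub: "insert x grouplikes \<subseteq> ?C" using GC x(1) by simp
  obtain B where B: "insert x grouplikes \<subseteq> B" "finite B" "cvs.independent B" "cvs.span B = ?C"
    using basis_of_subspace[OF fd sub indx] by metis
  have BC: "B \<subseteq> ?C" using B(4) cvs.span_superset by blast
  have finG: "finite grouplikes" using B(1,2) by (auto intro: finite_subset)
  \<comment> \<open>The right-hand factors of \<Delta>(x) when the left-hand ones are expanded in
    \<open>B\<close>, that is, \<Delta>(x) = \<Sum> m \<otimes> y m.\<close>
  define y where "y m = sw x (\<lambda>a b. coord B m a *\<^sub>C b)" for m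
  have yC: "y m \<in> ?C" for m
    unfolding y_def by (rule sw_closed[OF x(1) subspace_carrier]) (rule carrier_scale)
  have exp: "sw x F = (\<Sum>m\<in>B. F m (y m))" if F: "bilinear_on ?C ?C F"
    for F :: "'a \<Rightarrow> 'a \<Rightarrow> 'z::complex_vector"
  proof -
    have lin: "clinear_on ?C (\<lambda>a. F a b)" "clinear_on ?C (F b)" if "b \<in> ?C" for b
      using F that by (auto simp: bilinear_on_def)
    have "sw x F = sw x (\<lambda>a b. \<Sum>m\<in>B. coord B m a *\<^sub>C F m b)"
    proof (rule sw_cong[OF x(1)])
      fix a b assume a: "a \<in> ?C" and b: "b \<in> ?C"
      have "F a b = F (\<Sum>m\<in>B. coord B m a *\<^sub>C m) b"
        using sum_coord[OF B(3,2)] a B(4) by simp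
      also have "\<dots> = (\<Sum>m\<in>B. coord B m a *\<^sub>C F m b)"
        using BC clinear_on_scale[OF lin(1)[OF b]]
        by (subst clinear_on_sum[OF lin(1)[OF b] subspace_carrier])
          (auto simp: carrier_scale intro!: sum.cong)
      finally show "F a b = (\<Sum>m\<in>B. coord B m a *\<^sub>C F m b)" .
    qed
    also have "\<dots> = (\<Sum>m\<in>B. sw x (\<lambda>a b. coord B m a *\<^sub>C F m b))"
      by (rule tensor_lift_sum)
    also have "\<dots> = (\<Sum>m\<in>B. F m (y m))"
    proof (rule sum.cong[OF refl])
      fix m assume "m \<in> B"
      then have m: "m \<in> ?C" using BC by blast
      have "F m (y m) = sw x (\<lambda>a b. F m (coord B m a *\<^sub>C b))"
        unfolding y_def
        by (rule sw_linear[OF x(1) lin(2)[OF m] subspace_carrier]) (rule carrier_scale)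
      also have "\<dots> = sw x (\<lambda>a b. coord B m a *\<^sub>C F m b)"
        by (rule sw_cong[OF x(1)]) (rule clinear_on_scale[OF lin(2)[OF m]])
      finally show "sw x (\<lambda>a b. coord B m a *\<^sub>C F m b) = F m (y m)" ..
    qed
    finally show ?thesis .
  qed
  \<comment> \<open>The coordinate at \<open>m\<close> of \<open>functional_op f x\<close> is f(y
    m), while that vector lies in W up to a multiple of \<open>x\<close>. So every functional kills
    \<open>y m\<close>.\<close>
  have y0: "y m = 0" if m: "m \<in> B" "m \<notin> insert x grouplikes" for m
  proof (rule functional_eqI)
    fix f :: "'a \<Rightarrow> complex" assume f: "clinear_on UNIV f"
    have "functional_op f \<in> ?T" using f by blast
    from x(3)[OF this] obtain l where l: "functional_op f x - l *\<^sub>C x \<in> ?W" by blast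
    have e: "functional_op f x = (\<Sum>k\<in>B. f (y k) *\<^sub>C k)"
      unfolding functional_op_def by (rule exp[OF bilinear_on_functional'[OF f]])
    note lin = clinear_on_coord[OF B(3), of m]
    have "coord B m (functional_op f x - l *\<^sub>C x) = 0"
    proof (rule clinear_on_span_eq[OF lin _ cvs.subspace_UNIV subset_UNIV l, of "\<lambda>_. 0"])
      show "clinear_on UNIV (\<lambda>_::'a. 0::complex)" by (simp add: clinear_on_def)
      fix s assume "s \<in> grouplikes"
      then show "coord B m s = 0" using m B(1) by (auto simp: coord_basis[OF B(3)])
    qed
    moreover have "coord B m x = 0" using m B(1) by (auto simp: coord_basis[OF B(3)])
    ultimately have "coord B m (functional_op f x) = 0"
      by (simp add: clinear_on_diff[OF lin cvs.subspace_UNIV] clinear_on_scale[OF lin])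
    moreover have "coord B m (functional_op f x) = (\<Sum>k\<in>B. f (y k) * coord B m k)"
      unfolding e
      by (simp add: clinear_on_sum[OF lin cvs.subspace_UNIV] clinear_on_scale[OF lin]
          scaleC_complex_def)
    moreover have "\<dots> = (\<Sum>k\<in>B. if k = m then f (y k) else 0)"
      by (rule sum.cong) (auto simp: coord_basis[OF B(3)])
    ultimately show "f (y m) = f 0" using m B(2) clinear_on_zero[OF f] by simp
  qed
  define c where "c = y x"
  have cC: "c \<in> ?C" unfolding c_def by (rule yC)
  have sw_x: "sw x F = F x c + (\<Sum>g\<in>grouplikes. F g (y g))" if F: "bilinear_on ?C ?C F"
    for F :: "'a \<Rightarrow> 'a \<Rightarrow> 'z::complex_vector"
  proof -
    have "sw x F = (\<Sum>m\<in>B. F m (y m))" by (rule exp[OF F])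
    also have "\<dots> = (\<Sum>m\<in>insert x grouplikes. F m (y m))"
      by (rule sum.mono_neutral_right)
        (use B(1,2) y0 BC bilinear_on_zero(2)[OF F] cvs.subspace_0[OF subspace_carrier] in auto)
    also have "\<dots> = F x c + (\<Sum>g\<in>grouplikes. F g (y g))"
      using xG finG by (simp add: c_def)
    finally show ?thesis .
  qed
  \<comment> \<open>Apply the coordinate at \<open>m\<close> to the first factor of both sides of
    coassociativity at \<open>x\<close>. The choice m = x will give the coproduct of
    \<open>c\<close>, and m = g that of \<open>y g\<close>.\<close>
  have sw_y: "sw (y m) F = F (y m) c + (\<Sum>g\<in>grouplikes. coord B m g *\<^sub>C F g (y g))"
    if F: "bilinear_on ?C ?C F" for m and F :: "'a \<Rightarrow> 'a \<Rightarrow> 'z::complex_vector"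
  proof -
    let ?e = "coord B m"
    note e = clinear_on_coord[OF B(3), of m]
    let ?G = "\<lambda>r b. sw r (\<lambda>p q. ?e p *\<^sub>C F q b)"
    note tri = bilinear_on_trilinear[OF e F]
    have G: "bilinear_on ?C ?C ?G"
    proof (rule bilinear_onI)
      fix r r' b b' k assume r: "r \<in> ?C" and b: "b \<in> ?C"
      note lin = clinear_on_sw[OF tri(1)[OF b]]
      show "?G (k *\<^sub>C r) b = k *\<^sub>C ?G r b" by (rule clinear_on_scale[OF lin r])
      show "?G (r + r') b = ?G r b + ?G r' b" if "r' \<in> ?C" by (rule clinear_on_add[OF lin r that])
      show "?G r (k *\<^sub>C b) = k *\<^sub>C ?G r b"
        unfolding tensor_lift_scale[symmetric]
        by (rule sw_cong[OF r]) (simp add: bilinear_onD[OF F] b mult.commute)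
      show "?G r (b + b') = ?G r b + ?G r b'" if "b' \<in> ?C"
        unfolding tensor_lift_add[symmetric]
        by (rule sw_cong[OF r]) (simp add: bilinear_onD[OF F] b that cvs.scale_right_distrib)
    qed
    have "sw (y m) F = sw x (\<lambda>a b. sw (coord B m a *\<^sub>C b) F)"
      unfolding y_def
      by (rule sw_linear[OF x(1) clinear_on_sw[OF F] subspace_carrier]) (rule carrier_scale)
    also have "\<dots> = sw x (\<lambda>a r. sw r (\<lambda>b c. ?e a *\<^sub>C F b c))"
      by (rule sw_cong[OF x(1)]) (simp add: clinear_on_scale[OF clinear_on_sw[OF F]] tensor_lift_scale)
    also have "\<dots> = sw x ?G"
      by (rule sw_coassoc[OF x(1) tri, symmetric])
    also have "\<dots> = ?G x c + (\<Sum>g\<in>grouplikes. ?G g (y g))"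
      by (rule sw_x[OF G])
    also have "?G x c = F (y m) c"
    proof -
      have lin: "clinear_on ?C (\<lambda>q. F q c)" using F cC by (simp add: bilinear_on_def)
      have "F (y m) c = sw x (\<lambda>p q. F (?e p *\<^sub>C q) c)"
        unfolding y_def by (rule sw_linear[OF x(1) lin subspace_carrier]) (rule carrier_scale)
      also have "\<dots> = ?G x c"
        by (rule sw_cong[OF x(1)]) (rule clinear_on_scale[OF lin])
      finally show ?thesis ..
    qed
    also have "(\<Sum>g\<in>grouplikes. ?G g (y g)) = (\<Sum>g\<in>grouplikes. ?e g *\<^sub>C F g (y g))"
      by (rule sum.cong) (simp_all add: sw_grouplike[OF _ tri(1)[OF yC]])
    finally show ?thesis .
  qed
  have bl: "bilinear_on ?C ?C (\<lambda>a b. counit H a *\<^sub>C b)"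
    by (rule bilinear_on_functional[OF counit_linear clinear_on_ident])
  \<comment> \<open>The counit on the right factor shows that (1 - \<epsilon>(c)) x lies in W. Since
    x does not, \<epsilon>(c) = 1.\<close>
  have "x = sw x (\<lambda>a b. counit H b *\<^sub>C a)" using counit_right[OF x(1)] by simp
  also have "\<dots> = counit H c *\<^sub>C x + (\<Sum>g\<in>grouplikes. counit H (y g) *\<^sub>C g)"
    by (rule sw_x[OF bilinear_on_flip[OF bl]])
  finally have "x - counit H c *\<^sub>C x = (\<Sum>g\<in>grouplikes. counit H (y g) *\<^sub>C g)"
    by (simp add: algebra_simps)
  also have "\<dots> \<in> ?W" by (intro cvs.span_sum cvs.span_scale cvs.span_base)
  finally have "(1 - counit H c) *\<^sub>C x \<in> ?W" by (simp add: cvs.scale_left_diff_distrib)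
  then have "inverse (1 - counit H c) *\<^sub>C ((1 - counit H c) *\<^sub>C x) \<in> ?W" by (rule cvs.span_scale)
  then have ec: "counit H c = 1" using x(2) by (cases "counit H c = 1") simp_all
  have cG: "c \<in> grouplikes"
  proof (rule grouplikesI[OF cC ec])
    have "coord B x g = 0" if "g \<in> grouplikes" for g
      using that xG B(1) by (auto simp: coord_basis[OF B(3)])
    then show "sw c (\<otimes>\<^sub>C) = c \<otimes>\<^sub>C c"
      using sw_y[OF bilinear_on_tens, of x] by (simp add: c_def)
  qed
  have "y g \<in> ?W" if g: "g \<in> grouplikes" for g
  proof (rule skew_primitive[OF fd cc g cG yC])
    have "(\<Sum>k\<in>grouplikes. coord B g k *\<^sub>C (k \<otimes>\<^sub>C y k)) =
        (\<Sum>k\<in>grouplikes. if k = g then k \<otimes>\<^sub>C y k else 0)"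
      by (rule sum.cong) (use B(1) in \<open>auto simp: coord_basis[OF B(3)]\<close>)
    then show "comult H (y g) = y g \<otimes>\<^sub>C c + g \<otimes>\<^sub>C y g"
      using sw_y[OF bilinear_on_tens, of g] g finG by (simp add: sw_tens[OF yC])
  qed
  then have "(\<Sum>g\<in>grouplikes. y g) \<in> ?W" by (rule cvs.span_sum)
  moreover have "x = counit H x *\<^sub>C c + (\<Sum>g\<in>grouplikes. y g)"
    using sw_x[OF bl] counit_left[OF x(1)] by (simp add: grouplikesD(2))
  moreover have "counit H x *\<^sub>C c \<in> ?W" using cG by (simp add: cvs.span_scale cvs.span_base)
  ultimately show False using x(2) cvs.span_add by metis
qed


subsection \<open>Bi-ideals\<close>

text \<open>For the bijection \<open>\<theta>(a \<otimes> b) = a\<^sub>1 \<otimes> a\<^sub>2 b\<close>, with inverse \<open>\<theta>\<^sup>-\<^sup>1(a \<otimes> b) = a\<^sub>1 \<otimes> S(a\<^sub>2) b\<close>, the subspace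
  \<open>J = H \<otimes> K + K \<otimes> H\<close> satisfies \<open>\<theta>(J) \<subseteq> J\<close>, hence \<open>\<theta>(J) = J\<close> in finite dimension. So
  \<open>\<theta>\<^sup>-\<^sup>1(k \<otimes> 1) = k\<^sub>1 \<otimes> S(k\<^sub>2)\<close> lies in \<open>J\<close> for \<open>k \<in> K\<close>, and applying \<open>\<epsilon>\<close> to the left factor gives
  \<open>S(k) \<in> K\<close>.\<close>

lemma antipode_biideal:
  assumes fd: "finite_dim (carrier H)" and K: "cvs.subspace K" "K \<subseteq> carrier H"
    and ideal: "\<And>x h. x \<in> K \<Longrightarrow> h \<in> carrier H \<Longrightarrow> x \<otimes> h \<in> K \<and> h \<otimes> x \<in> K"
    and coideal: "\<And>x. x \<in> K \<Longrightarrow>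
      \<exists>s\<in>tensor_space (carrier H) K. \<exists>t\<in>tensor_space K (carrier H). comult H x = s + t"
    and counit: "\<And>x. x \<in> K \<Longrightarrow> counit H x = 0"
    and k: "k \<in> K"
  shows "antipode H k \<in> K"
proof -
  let ?C = "carrier H"
  let ?T = "tensor_space ?C ?C"
  let ?J = "{s + t | s t. s \<in> tensor_space ?C K \<and> t \<in> tensor_space K ?C}"
  have J: "cvs.subspace ?J" by (rule cvs.subspace_sums[OF subspace_tensor_space subspace_tensor_space])
  have JT: "?J \<subseteq> ?T"
    using tensor_space_mono[of ?C ?C K ?C] tensor_space_mono[of K ?C ?C ?C] K(2)
      cvs.subspace_add[OF subspace_tensor_space] by blast
  have J1: "s \<in> ?J" if "s \<in> tensor_space ?C K" for s
    using that cvs.subspace_0[OF subspace_tensor_space] by force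
  have J2: "s \<in> ?J" if "s \<in> tensor_space K ?C" for s
    using that cvs.subspace_0[OF subspace_tensor_space] by force
  have J_image: "f ` ?J \<subseteq> S" if f: "clinear_on ?T f" and S: "cvs.subspace S"
    and f1: "\<And>a b. a \<in> ?C \<Longrightarrow> b \<in> K \<Longrightarrow> f (a \<otimes>\<^sub>C b) \<in> S"
    and f2: "\<And>a b. a \<in> K \<Longrightarrow> b \<in> ?C \<Longrightarrow> f (a \<otimes>\<^sub>C b) \<in> S"
    for f :: "('a, 'a) tensor \<Rightarrow> 'z::complex_vector" and S
  proof -
    have sub: "tensor_space ?C K \<subseteq> ?T" "tensor_space K ?C \<subseteq> ?T"
      using K(2) by (simp_all add: tensor_space_mono)
    have "f ` tensor_space ?C K \<subseteq> S" "f ` tensor_space K ?C \<subseteq> S"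
      using tensor_space_image_subset[OF f subspace_tensor_space sub(1) S f1]
        tensor_space_image_subset[OF f subspace_tensor_space sub(2) S f2] by simp_all
    moreover have "f (s + t) = f s + f t" if "s \<in> tensor_space ?C K" "t \<in> tensor_space K ?C" for s t
      using that sub by (intro clinear_on_add[OF f]) auto
    ultimately show ?thesis using cvs.subspace_add[OF S] by (auto simp: image_subset_iff)
  qed
  have bl: "bilinear_on ?C ?C (\<lambda>p q. p \<otimes>\<^sub>C (\<phi> q \<otimes> b))"
    if "clinear_on ?C \<phi>" "\<phi> \<in> ?C \<rightarrow> ?C" "b \<in> ?C" for \<phi> b
    by (rule bilinear_onI) (use that in \<open>simp_all add: Pi_iff clinear_on_def tens_linear mult_linear\<close>)
  \<comment> \<open>This map is a \<otimes> b -> a1 \<otimes> \<phi>(a2) b. The identity in place of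
    \<phi> gives \<theta>, the antipode gives its inverse.\<close>
  define shear where "shear \<phi> = tensor_lift ?C ?C (\<lambda>a b. sw a (\<lambda>p q. p \<otimes>\<^sub>C (\<phi> q \<otimes> b)))"
    for \<phi> :: "'a \<Rightarrow> 'a"
  have bsh: "bilinear_on ?C ?C (\<lambda>a b. sw a (\<lambda>p q. p \<otimes>\<^sub>C (\<phi> q \<otimes> b)))"
    if \<phi>: "clinear_on ?C \<phi>" "\<phi> \<in> ?C \<rightarrow> ?C" for \<phi>
  proof (rule bilinear_onI)
    fix r r' b b' l assume r: "r \<in> ?C" and b: "b \<in> ?C"
    let ?G = "\<lambda>r b. sw r (\<lambda>p q. p \<otimes>\<^sub>C (\<phi> q \<otimes> b))"
    note lin = clinear_on_sw[OF bl[OF \<phi> b]]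
    show "?G (l *\<^sub>C r) b = l *\<^sub>C ?G r b" by (rule clinear_on_scale[OF lin r])
    show "?G (r + r') b = ?G r b + ?G r' b" if "r' \<in> ?C" by (rule clinear_on_add[OF lin r that])
    show "?G r (l *\<^sub>C b) = l *\<^sub>C ?G r b"
      unfolding tensor_lift_scale[symmetric]
      by (rule sw_cong[OF r]) (use \<phi>(2) b in \<open>simp add: Pi_iff mult_linear tens_linear\<close>)
    show "?G r (b + b') = ?G r b + ?G r b'" if "b' \<in> ?C"
      unfolding tensor_lift_add[symmetric]
      by (rule sw_cong[OF r]) (use \<phi>(2) b that in \<open>simp add: Pi_iff mult_linear tens_linear\<close>)
  qed
  have sh_lin: "clinear_on ?T (shear \<phi>)"
    and sh_tens: "\<And>a b. a \<in> ?C \<Longrightarrow> b \<in> ?C \<Longrightarrow> shear \<phi> (a \<otimes>\<^sub>C b) = sw a (\<lambda>p q. p \<otimes>\<^sub>C (\<phi> q \<otimes> b))"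
    if \<phi>: "clinear_on ?C \<phi>" "\<phi> \<in> ?C \<rightarrow> ?C" for \<phi>
    unfolding shear_def using clinear_on_lift[OF bsh[OF \<phi>]] lift_tens[OF bsh[OF \<phi>]] by auto
  have id: "clinear_on ?C (\<lambda>q. q)" "(\<lambda>q. q) \<in> ?C \<rightarrow> ?C" by (auto intro: clinear_on_ident)
  note S = antipode_linear antipode_closed
  let ?\<theta> = "shear (\<lambda>q. q)" and ?\<theta>' = "shear (antipode H)"
  have \<theta>T: "?\<theta> ` ?T \<subseteq> ?T"
    by (rule tensor_space_image_subset[OF sh_lin[OF id] subspace_tensor_space order_refl
          subspace_tensor_space])
      (auto simp: sh_tens[OF id] intro!: sw_closed subspace_tensor_space tens_in_tensor_space)
  \<comment> \<open>On pure tensors the composite is a1 \<otimes> S(a2) a3 b = a1 \<otimes>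
    \<epsilon>(a2) b = a \<otimes> b. This left inverse makes \<theta> injective on
    \<open>?J\<close>.\<close>
  have inv: "?\<theta>' (?\<theta> t) = t" if t: "t \<in> ?T" for t
  proof (rule clinear_on_tensor_space_eq[OF clinear_on_compose[OF sh_lin[OF id] sh_lin[OF S] \<theta>T]
        clinear_on_ident t])
    fix a b assume a: "a \<in> ?C" and b: "b \<in> ?C"
    let ?F = "\<lambda>p q c. p \<otimes>\<^sub>C (antipode H q \<otimes> (c \<otimes> b))"
    have "?\<theta>' (?\<theta> (a \<otimes>\<^sub>C b)) = ?\<theta>' (sw a (\<lambda>r c. r \<otimes>\<^sub>C (c \<otimes> b)))"
      by (simp add: sh_tens[OF id] a b)
    also have "\<dots> = sw a (\<lambda>r c. ?\<theta>' (r \<otimes>\<^sub>C (c \<otimes> b)))"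
      by (rule sw_linear[OF a sh_lin[OF S] subspace_tensor_space]) (simp add: tens_in_tensor_space b)
    also have "\<dots> = sw a (\<lambda>r c. sw r (\<lambda>p q. ?F p q c))"
      by (rule sw_cong[OF a]) (simp add: sh_tens[OF S] b)
    also have "\<dots> = sw a (\<lambda>p r. sw r (\<lambda>q c. ?F p q c))"
      by (rule sw_coassoc[OF a])
        (auto intro!: bilinear_onI simp: tens_linear mult_linear antipode_simps antipode_in b)
    also have "\<dots> = sw a (\<lambda>p r. (counit H r *\<^sub>C p) \<otimes>\<^sub>C b)"
    proof (rule sw_cong[OF a])
      fix p r assume p: "p \<in> ?C" and r: "r \<in> ?C"
      have lin: "clinear_on ?C (\<lambda>z. p \<otimes>\<^sub>C (z \<otimes> b))"
        by (simp add: clinear_on_def tens_linear mult_linear b)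
      have "sw r (\<lambda>q c. ?F p q c) = sw r (\<lambda>q c. p \<otimes>\<^sub>C ((antipode H q \<otimes> c) \<otimes> b))"
        by (rule sw_cong[OF r]) (simp add: m_assoc antipode_in b)
      also have "\<dots> = p \<otimes>\<^sub>C (sw r (\<lambda>q c. antipode H q \<otimes> c) \<otimes> b)"
        by (rule sw_linear[OF r lin subspace_carrier, symmetric]) (simp add: antipode_in)
      also have "\<dots> = (counit H r *\<^sub>C p) \<otimes>\<^sub>C b"
        by (simp add: antipode_left r b mult_linear tens_linear)
      finally show "sw r (\<lambda>q c. ?F p q c) = (counit H r *\<^sub>C p) \<otimes>\<^sub>C b" .
    qed
    also have "\<dots> = sw a (\<lambda>p r. counit H r *\<^sub>C p) \<otimes>\<^sub>C b"
      by (rule sw_linear[OF a _ subspace_carrier, symmetric, where \<phi> = "\<lambda>z. z \<otimes>\<^sub>C b"])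
        (auto simp: clinear_on_def tens_linear carrier_scale)
    finally show "?\<theta>' (?\<theta> (a \<otimes>\<^sub>C b)) = a \<otimes>\<^sub>C b" by (simp add: counit_right a)
  qed
  have \<theta>J: "?\<theta> ` ?J \<subseteq> ?J"
  proof (rule J_image[OF sh_lin[OF id] J])
    fix a b assume a: "a \<in> ?C" and b: "b \<in> K"
    from b have "b \<in> ?C" using K(2) by blast
    with a have "?\<theta> (a \<otimes>\<^sub>C b) = sw a (\<lambda>p q. p \<otimes>\<^sub>C (q \<otimes> b))" by (rule sh_tens[OF id])
    also have "\<dots> \<in> tensor_space ?C K"
      by (rule sw_closed[OF a subspace_tensor_space]) (simp add: tens_in_tensor_space ideal b)
    finally show "?\<theta> (a \<otimes>\<^sub>C b) \<in> ?J" by (rule J1)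
  next
    fix a b assume a: "a \<in> K" and b: "b \<in> ?C"
    have blF: "bilinear_on ?C ?C (\<lambda>p q. p \<otimes>\<^sub>C (q \<otimes> b))" using bl[OF id b] .
    \<comment> \<open>For \<open>a\<close> in \<open>K\<close> the coproduct of \<open>a\<close>
      lies in \<open>?J\<close>, and multiplying its right factors by \<open>b\<close> stays in
      \<open>?J\<close> because \<open>K\<close> absorbs products.\<close>
    have "tensor_lift ?C ?C (\<lambda>p q. p \<otimes>\<^sub>C (q \<otimes> b)) ` ?J \<subseteq> ?J"
    proof (rule J_image[OF clinear_on_lift[OF blF] J])
      fix p q assume p: "p \<in> ?C" and q: "q \<in> K"
      moreover from q have "q \<in> ?C" using K(2) by blast
      ultimately show "tensor_lift ?C ?C (\<lambda>p q. p \<otimes>\<^sub>C (q \<otimes> b)) (p \<otimes>\<^sub>C q) \<in> ?J"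
        using ideal[OF q b] by (intro J1) (simp add: lift_tens[OF blF] tens_in_tensor_space)
    next
      fix p q assume p: "p \<in> K" and q: "q \<in> ?C"
      moreover from p have "p \<in> ?C" using K(2) by blast
      ultimately show "tensor_lift ?C ?C (\<lambda>p q. p \<otimes>\<^sub>C (q \<otimes> b)) (p \<otimes>\<^sub>C q) \<in> ?J"
        using b by (intro J2) (simp add: lift_tens[OF blF] tens_in_tensor_space)
    qed
    moreover have "comult H a \<in> ?J" using coideal[OF a] by blast
    ultimately have "tensor_lift ?C ?C (\<lambda>p q. p \<otimes>\<^sub>C (q \<otimes> b)) (comult H a) \<in> ?J"
      by (rule subsetD[OF _ imageI])
    moreover have "a \<in> ?C" using a K(2) by blast
    then have "?\<theta> (a \<otimes>\<^sub>C b) = sw a (\<lambda>p q. p \<otimes>\<^sub>C (q \<otimes> b))" using b by (rule sh_tens[OF id])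
    ultimately show "?\<theta> (a \<otimes>\<^sub>C b) \<in> ?J" by simp
  qed
  have "?\<theta> ` ?J = ?J"
  proof (rule clinear_on_injective_imp_surjective[OF _ J clinear_on_subset[OF sh_lin[OF id] JT] _ \<theta>J])
    show "finite_dim ?J"
      using finite_dim_subspace[OF finite_dim_tensor_space[OF fd fd] J JT] .
    show "inj_on ?\<theta> ?J" by (rule inj_on_inverseI[of _ ?\<theta>']) (use inv JT in blast)
  qed
  moreover have "k \<otimes>\<^sub>C \<one> \<in> ?J" using k by (intro J2 tens_in_tensor_space) auto
  ultimately obtain j where j: "j \<in> ?J" "?\<theta> j = k \<otimes>\<^sub>C \<one>" by (metis (no_types, lifting) imageE)
  have kC: "k \<in> ?C" using k K(2) by blast
  have "j = ?\<theta>' (k \<otimes>\<^sub>C \<one>)" using inv[of j] j JT by force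
  also have "\<dots> = sw k (\<lambda>p q. p \<otimes>\<^sub>C antipode H q)"
    unfolding sh_tens[OF S kC one_closed] by (rule sw_cong[OF kC]) (simp add: antipode_in)
  finally have j': "j = sw k (\<lambda>p q. p \<otimes>\<^sub>C antipode H q)" .
  have blE: "bilinear_on ?C ?C (\<lambda>a b. counit H a *\<^sub>C b)"
    by (rule bilinear_on_functional[OF counit_linear clinear_on_ident])
  let ?E = "tensor_lift ?C ?C (\<lambda>a b. counit H a *\<^sub>C b)"
  \<comment> \<open>The counit on the left factor maps H \<otimes> K into K, and it maps K \<otimes>
    H to 0 because it vanishes on K.\<close>
  have "?E ` ?J \<subseteq> K"
    by (rule J_image[OF clinear_on_lift[OF blE] K(1)])
      (use K in \<open>auto simp: lift_tens[OF blE] subset_iff counit cvs.subspace_scale cvs.subspace_0\<close>)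
  then have "?E j \<in> K" using j(1) by blast
  also have "?E j = sw k (\<lambda>p q. ?E (p \<otimes>\<^sub>C antipode H q))"
    unfolding j' by (rule sw_linear[OF kC clinear_on_lift[OF blE] subspace_tensor_space])
      (simp add: tens_in_tensor_space antipode_in)
  also have "\<dots> = sw k (\<lambda>p q. antipode H (counit H p *\<^sub>C q))"
    by (rule sw_cong[OF kC]) (simp add: lift_tens[OF blE] antipode_in antipode_simps)
  also have "\<dots> = antipode H (sw k (\<lambda>p q. counit H p *\<^sub>C q))"
    by (rule sw_linear[OF kC antipode_linear subspace_carrier, symmetric]) (rule carrier_scale)
  finally show ?thesis by (simp add: counit_left kC)
qed

text \<open>\<open>tensor_kernel\<close> turns the vanishing of all R(i) \<otimes> R(j) on
  \<Delta>(x) into the coideal condition, and \<open>antipode_biideal\<close> supplies the antipode.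
  The family \<open>R\<close> is the action on the individual vectors of V, or the counit alone when
  V = 0.\<close>

lemma hopf_ideal_kernel:
  fixes R :: "'i \<Rightarrow> 'a \<Rightarrow> 'x::complex_vector"
  assumes fd: "finite_dim (carrier H)"
    and R: "\<And>i. clinear_on (carrier H) (R i)"
    and K: "K = {h \<in> carrier H. \<forall>i. R i h = 0}"
    and ideal: "\<And>x h. x \<in> K \<Longrightarrow> h \<in> carrier H \<Longrightarrow> x \<otimes> h \<in> K \<and> h \<otimes> x \<in> K"
    and counit: "\<And>x. x \<in> K \<Longrightarrow> counit H x = 0"
    and R_comult: "\<And>x i j. x \<in> K \<Longrightarrow> sw x (\<lambda>a b. R i a \<otimes>\<^sub>C R j b) = 0"
  shows "hopf_ideal H K"
proof -
  have KC: "K \<subseteq> carrier H" using K by auto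
  have subK: "cvs.subspace K"
    unfolding K
    by (rule cvs.subspaceI)
      (auto simp: carrier_simps clinear_on_zero[OF R] clinear_on_add[OF R] clinear_on_scale[OF R])
  have coideal: "\<exists>s\<in>tensor_space (carrier H) K. \<exists>t\<in>tensor_space K (carrier H). comult H x = s + t"
    if "x \<in> K" for x
    by (rule tensor_kernel[OF subspace_carrier fd R K]) (use that KC R_comult comult_in in auto)
  show ?thesis
    unfolding hopf_ideal_def
    using KC subK ideal coideal counit antipode_biideal[OF fd subK KC ideal coideal counit] by blast
qed

text \<open>If the \<open>R i\<close> separate the points of H, then the maps R(i) \<otimes> R(j)
  separate those of H \<otimes> H, by \<open>tensor_kernel\<close> with kernel 0. Apply this to the
  difference of \<Delta>(h) and its flip.\<close>

lemma cocommutative_if_separating: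
  fixes R :: "'i \<Rightarrow> 'a \<Rightarrow> 'x::complex_vector"
  assumes fd: "finite_dim (carrier H)"
    and R: "\<And>i. clinear_on (carrier H) (R i)"
    and K: "{0} = {h \<in> carrier H. \<forall>i. R i h = 0}"
    and sym: "\<And>h i j. h \<in> carrier H \<Longrightarrow>
      sw h (\<lambda>a b. R i a \<otimes>\<^sub>C R j b) = sw h (\<lambda>a b. R i b \<otimes>\<^sub>C R j a)"
  shows cocommutative
  unfolding cocommutative_def
proof
  fix h assume h: "h \<in> carrier H"
  let ?t = "comult H h - sw h (\<lambda>a b. b \<otimes>\<^sub>C a)"
  have mem: "sw h (\<lambda>a b. b \<otimes>\<^sub>C a) \<in> tensor_space (carrier H) (carrier H)"
    by (rule sw_closed[OF h subspace_tensor_space]) (rule tens_in_tensor_space)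
  have t: "?t \<in> tensor_space (carrier H) (carrier H)"
    by (rule cvs.subspace_diff[OF subspace_tensor_space comult_in[OF h] mem])
  have bl: "bilinear_on (carrier H) (carrier H) (\<lambda>a b. R i a \<otimes>\<^sub>C R j b)" for i j
    by (rule bilinear_onI)
      (simp_all add: clinear_on_add[OF R] clinear_on_scale[OF R] tens_linear)
  have "\<exists>s\<in>tensor_space (carrier H) {0}. \<exists>s'\<in>tensor_space {0} (carrier H). ?t = s + s'"
  proof (rule tensor_kernel[OF subspace_carrier fd R K t])
    fix i j
    let ?F = "\<lambda>a b. R i a \<otimes>\<^sub>C R j b"
    have "tensor_lift (carrier H) (carrier H) ?F (sw h (\<lambda>a b. b \<otimes>\<^sub>C a)) =
        sw h (\<lambda>a b. tensor_lift (carrier H) (carrier H) ?F (b \<otimes>\<^sub>C a))"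
      by (rule sw_linear[OF h clinear_on_lift[OF bl] subspace_tensor_space])
        (rule tens_in_tensor_space)
    also have "\<dots> = sw h (\<lambda>a b. R i b \<otimes>\<^sub>C R j a)"
      by (rule sw_cong[OF h]) (simp add: lift_tens[OF bl])
    finally show "tensor_lift (carrier H) (carrier H) ?F ?t = 0"
      using sym[OF h] clinear_on_diff[OF clinear_on_lift[OF bl] subspace_tensor_space comult_in[OF h] mem]
      by simp
  qed
  moreover have "tensor_space (carrier H) {0} \<subseteq> {0}" "tensor_space {0} (carrier H) \<subseteq> {0}"
    unfolding tensor_space_def by (rule cvs.span_minimal[OF _ cvs.subspace_single_0]; auto)+
  ultimately have "?t = 0"
    by (metis (no_types, lifting) add.right_neutral singletonD subsetD)
  then show "sw h (\<lambda>a b. b \<otimes>\<^sub>C a) = comult H h" by simp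
qed

end


section \<open>Group algebras\<close>

text \<open>Every structure map of \<open>group_algebra\<close> can be written in this form, so its
  linearity and its values on group elements come from the same two lemmas.\<close>

definition linear_extension :: "('g \<Rightarrow> 'a::complex_vector) \<Rightarrow> ('g \<Rightarrow>\<^sub>0 complex) \<Rightarrow> 'a" where
  "linear_extension F f = (\<Sum>a\<in>Poly_Mapping.keys f. Poly_Mapping.lookup f a *\<^sub>C F a)"

lemma linear_extension_superset:
  assumes "finite S" "Poly_Mapping.keys f \<subseteq> S"
  shows "linear_extension F f = (\<Sum>a\<in>S. Poly_Mapping.lookup f a *\<^sub>C F a)"
  unfolding linear_extension_def
  by (rule sum.mono_neutral_left) (use assms in \<open>auto simp: in_keys_iff\<close>)

lemma clinear_on_linear_extension: "clinear_on A (linear_extension F)"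
  unfolding clinear_on_def
proof (intro conjI ballI allI)
  fix f g :: "'a \<Rightarrow>\<^sub>0 complex" and c
  let ?S = "Poly_Mapping.keys f \<union> Poly_Mapping.keys g"
  have "linear_extension F (f + g) = (\<Sum>a\<in>?S. Poly_Mapping.lookup (f + g) a *\<^sub>C F a)"
    by (rule linear_extension_superset) (use Poly_Mapping.keys_add[of f g] in auto)
  then show "linear_extension F (f + g) = linear_extension F f + linear_extension F g"
    by (simp add: linear_extension_superset[of ?S] lookup_add cvs.scale_left_distrib sum.distrib)
  have "linear_extension F (c *\<^sub>C f) =
      (\<Sum>a\<in>Poly_Mapping.keys f. Poly_Mapping.lookup (c *\<^sub>C f) a *\<^sub>C F a)"
    by (rule linear_extension_superset) (use keys_scaleC_subset[of c f] in auto)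
  then show "linear_extension F (c *\<^sub>C f) = c *\<^sub>C linear_extension F f"
    by (simp add: linear_extension_def cvs.scale_sum_right scaleC_complex_def)
qed

lemma linear_extension_single: "linear_extension F (Poly_Mapping.single a 1) = F a"
  by (simp add: linear_extension_def)

lemma single_scaleC: "c *\<^sub>C Poly_Mapping.single a d = Poly_Mapping.single a (c * d)"
  by (rule poly_mapping_eqI) (simp add: lookup_single when_def scaleC_complex_def)

lemma
  shows carrier_group_algebra: "carrier (group_algebra G) = {f. Poly_Mapping.keys f \<subseteq> carrier G}"
    and one_group_algebra: "\<one>\<^bsub>group_algebra G\<^esub> = Poly_Mapping.single \<one>\<^bsub>G\<^esub> 1"
    and mult_group_algebra: "f \<otimes>\<^bsub>group_algebra G\<^esub> f' =
      linear_extension (\<lambda>a. linear_extension (\<lambda>b. Poly_Mapping.single (a \<otimes>\<^bsub>G\<^esub> b) 1) f') f"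
    and comult_group_algebra: "comult (group_algebra G) =
      linear_extension (\<lambda>a. Poly_Mapping.single a 1 \<otimes>\<^sub>C Poly_Mapping.single a 1)"
    and counit_group_algebra: "counit (group_algebra G) = linear_extension (\<lambda>a. 1)"
    and antipode_group_algebra: "antipode (group_algebra G) =
      linear_extension (\<lambda>a. Poly_Mapping.single (inv\<^bsub>G\<^esub> a) 1)"
  by (simp_all add: group_algebra_def linear_extension_def[abs_def] cvs.scale_sum_right
      single_scaleC scaleC_complex_def)

lemma bilinear_on_group_algebra_mult:
  "bilinear_on UNIV UNIV (\<lambda>f f'. f \<otimes>\<^bsub>group_algebra G\<^esub> f')"
proof (rule bilinear_onI)
  fix f f' g :: "'a \<Rightarrow>\<^sub>0 complex" and c
  note add = clinear_on_add[OF clinear_on_linear_extension UNIV_I UNIV_I]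
    and scale = clinear_on_scale[OF clinear_on_linear_extension UNIV_I]
  show "(f + g) \<otimes>\<^bsub>group_algebra G\<^esub> f' = f \<otimes>\<^bsub>group_algebra G\<^esub> f' + g \<otimes>\<^bsub>group_algebra G\<^esub> f'"
    "(c *\<^sub>C f) \<otimes>\<^bsub>group_algebra G\<^esub> f' = c *\<^sub>C (f \<otimes>\<^bsub>group_algebra G\<^esub> f')"
    by (simp_all add: mult_group_algebra add scale)
  have *: "linear_extension (\<lambda>a. F a + F' a) f = linear_extension F f + linear_extension F' f"
    "linear_extension (\<lambda>a. c *\<^sub>C F a) f = c *\<^sub>C linear_extension F f" for F F' :: "'a \<Rightarrow> 'a \<Rightarrow>\<^sub>0 complex"
    by (simp_all add: linear_extension_def cvs.scale_right_distrib sum.distrib cvs.scale_sum_right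
        mult.commute)
  show "f \<otimes>\<^bsub>group_algebra G\<^esub> (f' + g) = f \<otimes>\<^bsub>group_algebra G\<^esub> f' + f \<otimes>\<^bsub>group_algebra G\<^esub> g"
    "f \<otimes>\<^bsub>group_algebra G\<^esub> (c *\<^sub>C f') = c *\<^sub>C (f \<otimes>\<^bsub>group_algebra G\<^esub> f')"
    by (simp_all add: mult_group_algebra add scale *)
qed

context hopf_algebra
begin

text \<open>The group-likes form a basis, so \<rho> extends to a linear map \<phi>. Both sides of
  each compatibility condition are linear in every argument, so agreement on group-likes is enough.
  Bijectivity holds because \<rho> matches this basis with the standard basis of the group
  algebra.\<close>

lemma hopf_isomorphic_group_algebra:
  assumes fd: "finite_dim (carrier H)"
    and span: "cvs.span grouplikes = carrier H"
    and \<rho>: "carrier A = \<rho> ` grouplikes" "inj_on \<rho> grouplikes"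
    and \<rho>_mult: "\<And>g k. g \<in> grouplikes \<Longrightarrow> k \<in> grouplikes \<Longrightarrow> \<rho> (g \<otimes> k) = \<rho> g \<otimes>\<^bsub>A\<^esub> \<rho> k"
    and \<rho>_one: "\<rho> \<one> = \<one>\<^bsub>A\<^esub>"
    and \<rho>_inv: "\<And>g. g \<in> grouplikes \<Longrightarrow> inv\<^bsub>A\<^esub> (\<rho> g) = \<rho> (antipode H g)"
  shows "hopf_isomorphic H (group_algebra A)"
proof -
  note ind = independent_grouplikes
  have GC: "grouplikes \<subseteq> carrier H" using grouplikesD(1) by blast
  have fin: "finite grouplikes" by (rule finite_independent_in[OF fd GC ind])
  define \<phi> where "\<phi> h = (\<Sum>g\<in>grouplikes. coord grouplikes g h *\<^sub>C Poly_Mapping.single (\<rho> g) (1::complex))"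
    for h
  let ?K = "group_algebra A"
  have \<phi>_lin: "clinear_on S \<phi>" for S
  proof (rule clinear_on_subset[OF _ subset_UNIV])
    have "coord grouplikes g (x + y) = coord grouplikes g x + coord grouplikes g y"
      "coord grouplikes g (c *\<^sub>C x) = c * coord grouplikes g x" for g x y c
      using clinear_on_coord[OF ind, of g] by (simp_all add: clinear_on_def scaleC_complex_def)
    then show "clinear_on UNIV \<phi>"
      by (simp add: clinear_on_def \<phi>_def cvs.scale_left_distrib sum.distrib cvs.scale_sum_right)
  qed
  have \<phi>_g: "\<phi> g = Poly_Mapping.single (\<rho> g) 1" if g: "g \<in> grouplikes" for g
  proof -
    have "\<phi> g = (\<Sum>k\<in>grouplikes. if k = g then Poly_Mapping.single (\<rho> g) (1::complex) else 0)"
      unfolding \<phi>_def by (rule sum.cong) (use g in \<open>auto simp: coord_basis[OF ind]\<close>)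
    then show ?thesis using g fin by simp
  qed
  have lookup_\<phi>: "Poly_Mapping.lookup (\<phi> h) (\<rho> g) = coord grouplikes g h"
    if g: "g \<in> grouplikes" for g h
  proof -
    have "Poly_Mapping.lookup (\<phi> h) (\<rho> g) = (\<Sum>k\<in>grouplikes. if k = g then coord grouplikes g h else 0)"
      unfolding \<phi>_def lookup_sum lookup_scaleC
      by (rule sum.cong)
        (use g \<rho>(2) in \<open>auto simp: lookup_single when_def scaleC_complex_def inj_on_def\<close>)
    then show ?thesis using g fin by simp
  qed
  have keys_\<phi>: "\<phi> h \<in> carrier ?K" for h
    unfolding carrier_group_algebra \<phi>_def \<rho>(1)
  proof (intro CollectI subsetI)
    fix a assume "a \<in> Poly_Mapping.keys
      (\<Sum>g\<in>grouplikes. coord grouplikes g h *\<^sub>C Poly_Mapping.single (\<rho> g) (1::complex))"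
    then have "(\<Sum>g\<in>grouplikes. coord grouplikes g h *\<^sub>C (if \<rho> g = a then 1 else (0::complex))) \<noteq> 0"
      by (simp add: in_keys_iff lookup_sum lookup_single when_def)
    then obtain g where "g \<in> grouplikes"
      "coord grouplikes g h *\<^sub>C (if \<rho> g = a then 1 else (0::complex)) \<noteq> 0"
      by (rule sum.not_neutral_contains_not_neutral)
    then show "a \<in> \<rho> ` grouplikes" by (auto split: if_splits)
  qed
  have eqI: "F h = F' h" if "clinear_on (carrier H) F" "clinear_on (carrier H) F'" "h \<in> carrier H"
    "\<And>g. g \<in> grouplikes \<Longrightarrow> F g = F' g" for F F' :: "'a \<Rightarrow> 'z::complex_vector" and h
    by (rule clinear_on_span_eq[OF that(1,2) subspace_carrier GC]) (use span that in auto)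
  have K_lin: "clinear_on (carrier H) (\<lambda>h. linear_extension F (\<phi> h))"
    for F :: "'b \<Rightarrow> 'z::complex_vector"
    by (rule clinear_on_compose[OF \<phi>_lin clinear_on_linear_extension subset_UNIV])
  have mult: "\<phi> (h \<otimes> k) = \<phi> h \<otimes>\<^bsub>?K\<^esub> \<phi> k" if h: "h \<in> carrier H" and k: "k \<in> carrier H" for h k
  proof -
    note bl = bilinear_on_group_algebra_mult[of A]
    have left: "clinear_on (carrier H) (\<lambda>h. \<phi> (h \<otimes> k))" if "k \<in> carrier H" for k
      using that by (intro clinear_on_compose[OF mult_linear_left \<phi>_lin[of UNIV]]) auto
    have right: "clinear_on (carrier H) (\<lambda>k. \<phi> (h \<otimes> k))" if "h \<in> carrier H" for h
      using that by (intro clinear_on_compose[OF mult_linear_right \<phi>_lin[of UNIV]]) auto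
    have left': "clinear_on (carrier H) (\<lambda>h. \<phi> h \<otimes>\<^bsub>?K\<^esub> f)"
      and right': "clinear_on (carrier H) (\<lambda>h. f \<otimes>\<^bsub>?K\<^esub> \<phi> h)" for f
      using bl \<phi>_lin[of "carrier H"] by (simp_all add: bilinear_on_def clinear_on_def)
    have gk: "\<phi> (g \<otimes> k) = \<phi> g \<otimes>\<^bsub>?K\<^esub> \<phi> k" if "g \<in> grouplikes" "k \<in> grouplikes" for g k
      using that by (simp add: \<phi>_g mult_grouplike mult_group_algebra linear_extension_single \<rho>_mult)
    have "\<phi> (g \<otimes> k) = \<phi> g \<otimes>\<^bsub>?K\<^esub> \<phi> k" if g: "g \<in> grouplikes" for g
      by (rule eqI[OF right[OF grouplikesD(1)[OF g]] right' k gk[OF g]])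
    then show ?thesis by (rule eqI[OF left[OF k] left' h])
  qed
  have comult: "comult ?K (\<phi> h) = sw h (\<lambda>a b. \<phi> a \<otimes>\<^sub>C \<phi> b)" if h: "h \<in> carrier H" for h
  proof -
    have bl: "bilinear_on (carrier H) (carrier H) (\<lambda>a b. \<phi> a \<otimes>\<^sub>C \<phi> b)"
      using \<phi>_lin[of "carrier H"] by (intro bilinear_onI) (simp_all add: clinear_on_def tens_linear)
    show ?thesis
      unfolding comult_group_algebra
      by (rule eqI[OF K_lin clinear_on_sw[OF bl] h])
        (simp add: sw_grouplike[OF _ bl] \<phi>_g linear_extension_single)
  qed
  have counit: "counit ?K (\<phi> h) = counit H h" if h: "h \<in> carrier H" for h
    unfolding counit_group_algebra
    by (rule eqI[OF K_lin counit_linear h]) (simp add: \<phi>_g linear_extension_single grouplikesD(2))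
  have antipode: "antipode ?K (\<phi> h) = \<phi> (antipode H h)" if h: "h \<in> carrier H" for h
    unfolding antipode_group_algebra
    by (rule eqI[OF K_lin clinear_on_compose[OF antipode_linear \<phi>_lin[of UNIV] subset_UNIV] h])
      (simp add: \<phi>_g linear_extension_single \<rho>_inv antipode_grouplike)
  have "bij_betw \<phi> (carrier H) (carrier ?K)"
  proof (rule bij_betw_imageI)
    show "inj_on \<phi> (carrier H)"
    proof (rule inj_onI)
      fix h h' assume *: "h \<in> carrier H" "h' \<in> carrier H" "\<phi> h = \<phi> h'"
      have "h = (\<Sum>g\<in>grouplikes. coord grouplikes g h *\<^sub>C g)"
        using sum_coord[OF ind fin, of h] * span by simp
      also have "\<dots> = (\<Sum>g\<in>grouplikes. coord grouplikes g h' *\<^sub>C g)"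
        by (rule sum.cong) (use lookup_\<phi>[of _ h] lookup_\<phi>[of _ h'] * in auto)
      also have "\<dots> = h'" using sum_coord[OF ind fin, of h'] * span by simp
      finally show "h = h'" .
    qed
    show "\<phi> ` carrier H = carrier ?K"
    proof
      show "\<phi> ` carrier H \<subseteq> carrier ?K" using keys_\<phi> by blast
      show "carrier ?K \<subseteq> \<phi> ` carrier H"
      proof
        fix f assume "f \<in> carrier ?K"
        then have f: "Poly_Mapping.keys f \<subseteq> \<rho> ` grouplikes" by (simp add: carrier_group_algebra \<rho>(1))
        let ?h = "\<Sum>g\<in>grouplikes. Poly_Mapping.lookup f (\<rho> g) *\<^sub>C g"
        have h: "?h \<in> carrier H" using GC by (intro carrier_sum carrier_scale) auto
        have "\<phi> ?h = (\<Sum>g\<in>grouplikes. Poly_Mapping.single (\<rho> g) (Poly_Mapping.lookup f (\<rho> g)))"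
          by (simp add: clinear_on_sum[OF \<phi>_lin cvs.subspace_UNIV]
              clinear_on_scale[OF \<phi>_lin[of UNIV]] \<phi>_g single_scaleC)
        also have "\<dots> = f"
        proof (rule poly_mapping_eqI)
          fix a
          have "Poly_Mapping.lookup
              (\<Sum>g\<in>grouplikes. Poly_Mapping.single (\<rho> g) (Poly_Mapping.lookup f (\<rho> g))) a =
              (\<Sum>b\<in>\<rho> ` grouplikes. if b = a then Poly_Mapping.lookup f a else 0)"
            by (subst sum.reindex[OF \<rho>(2)])
              (auto simp: lookup_sum lookup_single when_def intro!: sum.cong)
          also have "\<dots> = Poly_Mapping.lookup f a" using fin f by (auto simp: in_keys_iff)
          finally show "Poly_Mapping.lookup
              (\<Sum>g\<in>grouplikes. Poly_Mapping.single (\<rho> g) (Poly_Mapping.lookup f (\<rho> g))) a =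
              Poly_Mapping.lookup f a" .
        qed
        finally show "f \<in> \<phi> ` carrier H" using h by force
      qed
    qed
  qed
  then have "\<phi> \<in> hopf_iso H ?K"
    using keys_\<phi> mult comult counit antipode \<phi>_lin \<phi>_g[OF one_grouplike]
    by (auto simp: hopf_iso_def iso_def hom_def one_group_algebra \<rho>_one)
  then show ?thesis unfolding hopf_isomorphic_def by blast
qed

end

section \<open>Vertex superalgebras\<close>

context vertex_superalgebra
begin

lemma clinear_on_Y_left: "clinear_on UNIV (\<lambda>u. Y u n v)"
  using Y_bilinear[of n] by (simp add: bilinear_on_def)

lemmas Y_linear = bilinear_onD[OF Y_bilinear, OF UNIV_I UNIV_I, simplified]
lemmas Y_zero [simp] = bilinear_on_zero[OF Y_bilinear, OF UNIV_I UNIV_I]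

text \<open>The mode -1 of the vacuum is the identity map. Hence \<open>vac = 0\<close> detects V =
  0.\<close>

lemma vacuum_zero: "vac = 0 \<Longrightarrow> (v :: 'v) = 0"
  using vacuum[of "-1" v] by simp

text \<open>Skew symmetry, obtained from the Jacobi identity applied to the vacuum by comparing the
  coefficients of \<open>z\<^sub>0\<^sup>-\<^sup>l\<^sup>-\<^sup>1 z\<^sub>1\<^sup>0 z\<^sub>2\<^sup>-\<^sup>1\<close>.\<close>

lemma skew_symmetry:
  obtains e where "\<And>u v. u \<in> par \<alpha> \<Longrightarrow> v \<in> par \<beta> \<Longrightarrow>
    \<forall>\<^sub>F N in sequentially.
      Y v l u = e *\<^sub>C (\<Sum>i<N. (-1) ^ i *\<^sub>C Y (Y u (l + int i) v) (- 1 - int i) vac)"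
proof
  fix u v assume u: "u \<in> par \<alpha>" and v: "v \<in> par \<beta>"
  obtain N0 where N0: "\<And>n. n \<ge> N0 \<Longrightarrow> Y u n v = 0" using truncation by blast
  let ?a = "- l - 1"
  let ?F1 = "\<lambda>a b c. if a = (0::int) then Y u (- b - 1) (Y v (- c - 1) vac) else 0"
  let ?F2 = "\<lambda>a b c. if a = (0::int) then Y v (- c - 1) (Y u (- b - 1) vac) else 0"
  let ?F3 = "\<lambda>a b c. if b = (0::int) then Y (Y u (- a - 1) v) (- c - 1) vac else 0"
  \<comment> \<open>The expanded delta function has only nonnegative powers of the second variable,
    so only v_k \<one> with k \<ge> 0 occur; these vanish by the creation property.\<close>
  have 1: "dist_mult (\<lambda>i j k. delta_coeff 1 i j k) ?F1 ?a 0 (-1) = 0"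
  proof -
    have "(\<lambda>(i, j, k). delta_coeff 1 i j k *\<^sub>C ?F1 (?a - i) (0 - j) (- 1 - k)) = (\<lambda>_. 0)"
      by (auto simp: fun_eq_iff delta_coeff_def binomial_coeff_def creation)
    then show ?thesis unfolding dist_mult_def by (simp only: Sum_any.neutral)
  qed
  \<comment> \<open>Here the powers j of the first variable are nonnegative. The mode j - 1 of
    \<open>u\<close> on the vacuum vanishes unless j = 0, where creation gives back
    \<open>u\<close>, so one term survives.\<close>
  have 2: "dist_mult (\<lambda>i j k. delta_coeff (-1) i k j) ?F2 ?a 0 (-1) = ((-1) powi (- l)) *\<^sub>C Y v l u"
  proof -
    let ?g = "\<lambda>(i, j, k). delta_coeff (-1) i k j *\<^sub>C ?F2 (?a - i) (0 - j) (- 1 - k)"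
    have "Sum_any ?g = (\<Sum>p\<in>{(?a, 0, l)}. ?g p)"
    proof (rule Sum_any.expand_superset)
      show "{p. ?g p \<noteq> 0} \<subseteq> {(?a, 0, l)}"
      proof
        fix p assume p: "p \<in> {p. ?g p \<noteq> 0}"
        obtain i j k where ijk: "p = (i, j, k)" by (cases p) auto
        have d: "delta_coeff (-1) i k j \<noteq> 0" and F: "?F2 (?a - i) (0 - j) (- 1 - k) \<noteq> 0"
          using p by (auto simp: ijk)
        have i: "i = ?a" using F by (auto split: if_splits)
        have j: "0 \<le> j" "k + j = - i - 1"
          using d by (auto simp: delta_coeff_def binomial_coeff_def split: if_splits)
        have "j = 0"
        proof (rule ccontr)
          assume "j \<noteq> 0"
          then have "0 \<le> - (0 - j) - 1" using j by simp
          then show False using F creation(2)[of "- (0 - j) - 1" u] by (simp split: if_splits)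
        qed
        then show "p \<in> {(?a, 0, l)}" using i j ijk by simp
      qed
    qed simp
    also have "\<dots> = ((-1) powi (- l)) *\<^sub>C Y v l u"
      by (simp add: delta_coeff_def binomial_coeff_def creation)
    finally show ?thesis unfolding dist_mult_def .
  qed
  \<comment> \<open>The modes \<open>l + i\<close> of \<open>u\<close> with i \<ge> 0 remain, and
    truncation bounds i. The modes -1 - i on the vacuum play the part of the divided powers of D, so
    that D itself need not be introduced.\<close>
  have 3: "dist_mult (\<lambda>i j k. delta_coeff 1 k j i) ?F3 ?a 0 (-1) =
      (\<Sum>i<N. (-1) ^ i *\<^sub>C Y (Y u (l + int i) v) (- 1 - int i) vac)" if N: "N \<ge> nat (N0 - l)" for N
  proof -
    let ?g = "\<lambda>(i, j, k). delta_coeff 1 k j i *\<^sub>C ?F3 (?a - i) (0 - j) (- 1 - k)"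
    let ?h = "\<lambda>n. (int n, 0, - 1 - int n)"
    have "Sum_any ?g = (\<Sum>p\<in>?h ` {..<N}. ?g p)"
    proof (rule Sum_any.expand_superset)
      show "{p. ?g p \<noteq> 0} \<subseteq> ?h ` {..<N}"
      proof
        fix p assume p: "p \<in> {p. ?g p \<noteq> 0}"
        obtain i j k where ijk: "p = (i, j, k)" by (cases p) auto
        have d: "delta_coeff 1 k j i \<noteq> 0" and F: "?F3 (?a - i) (0 - j) (- 1 - k) \<noteq> 0"
          using p by (auto simp: ijk)
        have j: "j = 0" using F by (auto split: if_splits)
        have i: "0 \<le> i" "j + i = - k - 1"
          using d by (auto simp: delta_coeff_def binomial_coeff_def split: if_splits)
        have "Y u (l + i) v \<noteq> 0"
          using F by (auto split: if_splits simp: algebra_simps)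
        then have "l + i < N0" using N0 not_le by blast
        then have "nat i < N" using N i by linarith
        moreover have "p = ?h (nat i)" using ijk i j by simp
        ultimately show "p \<in> ?h ` {..<N}" by blast
      qed
    qed simp
    also have "\<dots> = (\<Sum>n<N. ?g (?h n))"
      by (rule sum.reindex_cong[of ?h]) (auto simp: inj_on_def)
    also have "\<dots> = (\<Sum>i<N. (-1) ^ i *\<^sub>C Y (Y u (l + int i) v) (- 1 - int i) vac)"
      by (rule sum.cong)
        (simp_all add: delta_coeff_def binomial_coeff_def binomial_gbinomial[symmetric] algebra_simps)
    finally show ?thesis unfolding dist_mult_def .
  qed
  \<comment> \<open>This scalar depends on \<open>l\<close> and the two parities but not on
    \<open>u\<close> and \<open>v\<close>, as the uniform choice of \<open>e\<close> in the
    statement requires.\<close>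
  let ?c = "- (koszul_sign \<alpha> \<beta> * (-1) powi (- l))"
  have c: "?c \<noteq> 0" by (simp add: koszul_sign_def)
  show "\<forall>\<^sub>F N in sequentially.
      Y v l u = inverse ?c *\<^sub>C (\<Sum>i<N. (-1) ^ i *\<^sub>C Y (Y u (l + int i) v) (- 1 - int i) vac)"
    unfolding eventually_sequentially
  proof (intro exI allI impI)
    fix N assume N: "nat (N0 - l) \<le> N"
    have "?c *\<^sub>C Y v l u = (\<Sum>i<N. (-1) ^ i *\<^sub>C Y (Y u (l + int i) v) (- 1 - int i) vac)"
      using jacobi[OF u v vac_even, of ?a 0 "-1"] unfolding 1 2 3[OF N] by simp
    then have "inverse ?c *\<^sub>C (?c *\<^sub>C Y v l u) =
        inverse ?c *\<^sub>C (\<Sum>i<N. (-1) ^ i *\<^sub>C Y (Y u (l + int i) v) (- 1 - int i) vac)"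
      by (rule arg_cong)
    then show "Y v l u = \<dots>" by (simp only: cvs.scale_scale left_inverse[OF c] cvs.scale_one)
  qed
qed

section \<open>Consequences of the injectivity of Y(z)\<close>

lemma nth_vertex_series: "fls_nth (vertex_series Y u v) n = Y u (- n - 1) v"
proof -
  obtain N where N: "\<And>n. n \<ge> N \<Longrightarrow> Y u n v = 0" using truncation by blast
  have "\<forall>\<^sub>\<infinity>m::nat. Y u (- (- int m) - 1) v = 0"
    unfolding MOST_nat_le by (rule exI[of _ "nat (N + 1)"]) (auto intro!: N)
  then show ?thesis unfolding vertex_series_def by (rule nth_Abs_fls)
qed

lemma bilinear_vertex_series: "bilinear_on UNIV UNIV (vertex_series Y)"
  by (rule bilinear_onI) (simp_all add: fls_eq_iff nth_vertex_series Y_linear scaleC_fls.rep_eq)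

lemma clinear_on_fls_nth: "clinear_on UNIV (\<lambda>f. fls_nth f n)"
  by (simp add: clinear_on_def scaleC_fls.rep_eq)

lemma nth_vertex_map:
  assumes "t \<in> tensor_space A B" "cvs.subspace A"
  shows "fls_nth (vertex_map Y (tensor_lift A B (\<lambda>a b. f a b \<otimes>\<^sub>C g a b) t)) n =
    tensor_lift A B (\<lambda>a b. Y (f a b) (- n - 1) (g a b)) t"
proof -
  note lift = clinear_on_tensor_lift[OF cvs.subspace_UNIV cvs.subspace_UNIV bilinear_vertex_series]
  have "vertex_map Y (tensor_lift A B (\<lambda>a b. f a b \<otimes>\<^sub>C g a b) t) =
      tensor_lift A B (\<lambda>a b. vertex_map Y (f a b \<otimes>\<^sub>C g a b)) t"
    unfolding vertex_map_def
    by (rule tensor_lift_linear[OF assms lift subspace_tensor_space]) (simp add: tens_in_tensor_space)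
  also have "\<dots> = tensor_lift A B (\<lambda>a b. vertex_series Y (f a b) (g a b)) t"
    unfolding vertex_map_def
    by (simp add: tensor_lift_tens[OF cvs.subspace_UNIV cvs.subspace_UNIV bilinear_vertex_series])
  also have "fls_nth \<dots> n = tensor_lift A B (\<lambda>a b. fls_nth (vertex_series Y (f a b) (g a b)) n) t"
    by (rule tensor_lift_linear[OF assms clinear_on_fls_nth cvs.subspace_UNIV]) simp
  finally show ?thesis by (simp add: nth_vertex_series)
qed

text \<open>The form in which injectivity is applied: an identity between Sweedler sums in V
  \<otimes> V may be checked on all n-th products.\<close>

lemma vertex_map_inj_eqI:
  assumes "inj (vertex_map Y)" "t \<in> tensor_space A B" "cvs.subspace A"
    and "\<And>n. tensor_lift A B (\<lambda>a b. Y (f a b) n (g a b)) t =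
      tensor_lift A B (\<lambda>a b. Y (f' a b) n (g' a b)) t"
  shows "tensor_lift A B (\<lambda>a b. f a b \<otimes>\<^sub>C g a b) t = tensor_lift A B (\<lambda>a b. f' a b \<otimes>\<^sub>C g' a b) t"
  by (rule injD[OF assms(1)]) (simp add: fls_eq_iff nth_vertex_map[OF assms(2,3)] assms(4))

end


section \<open>Hopf actions\<close>

context hopf_module_vertex_superalgebra
begin

lemma clinear_on_act: "clinear_on (carrier H) (\<lambda>h. act h v)"
  and clinear_act: "h \<in> carrier H \<Longrightarrow> clinear_on UNIV (act h)"
  using act_bilinear by (simp_all add: bilinear_on_def)

lemmas act_linear = bilinear_onD[OF act_bilinear, simplified]

text \<open>The factor h2 acts on the vacuum by the counit, so the coproduct collapses to h. This
  lets h pass through the correction terms of skew symmetry.\<close>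

lemma act_Y_vac:
  assumes h: "h \<in> carrier H"
  shows "act h (Y x n vac) = Y (act h x) n vac"
proof -
  have lin: "clinear_on (carrier H) (\<lambda>a. Y (act a x) n vac)"
    by (rule clinear_on_compose[OF clinear_on_act clinear_on_Y_left subset_UNIV])
  have "act h (Y x n vac) = sw h (\<lambda>a b. Y (act a x) n (act b vac))" by (rule act_Y[OF h])
  also have "\<dots> = sw h (\<lambda>a b. Y (act (counit H b *\<^sub>C a) x) n vac)"
    by (rule sw_cong[OF h]) (simp add: act_vac Y_linear clinear_on_scale[OF lin])
  also have "\<dots> = Y (act (sw h (\<lambda>a b. counit H b *\<^sub>C a)) x) n vac"
    by (rule sw_linear[OF h lin subspace_carrier, symmetric]) (rule carrier_scale)
  finally show ?thesis by (simp add: counit_right[OF h])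
qed

text \<open>Compute h(v_l u) in two ways. The module axiom gives the sum of (h1 v)_l (h2 u).
  Rewriting v_l u by skew symmetry, applying h, and undoing skew symmetry for each pair (h1 u, h2 v)
  gives the sum of (h2 v)_l (h1 u).\<close>

lemma sw_act_Y_swap_homogeneous:
  assumes h: "h \<in> carrier H" and u: "u \<in> par \<alpha>" and v: "v \<in> par \<beta>"
  shows "sw h (\<lambda>a b. Y (act a v) l (act b u)) = sw h (\<lambda>a b. Y (act b v) l (act a u))"
proof -
  obtain e where e: "\<And>u v. u \<in> par \<alpha> \<Longrightarrow> v \<in> par \<beta> \<Longrightarrow> \<forall>\<^sub>F N in sequentially.
      Y v l u = e *\<^sub>C (\<Sum>i<N. (-1) ^ i *\<^sub>C Y (Y u (l + int i) v) (- 1 - int i) vac)"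
    by (rule skew_symmetry[where \<alpha> = \<alpha> and \<beta> = \<beta> and l = l]) (rule that)
  let ?skew = "\<lambda>N u v. e *\<^sub>C (\<Sum>i<N. (-1) ^ i *\<^sub>C Y (Y u (l + int i) v) (- 1 - int i) vac)"
  \<comment> \<open>Skew symmetry holds only once the number \<open>N\<close> of terms is large
    enough for the given pair. The chosen representative of \<Delta>(h) has finitely many terms, so
    one \<open>N\<close> serves all of them and (u, v).\<close>
  let ?P = "Poly_Mapping.keys (tensor_rep (carrier H) (carrier H) (comult H h))"
  have P: "?P \<subseteq> carrier H \<times> carrier H"
    by (rule keys_tensor_rep[OF comult_in[OF h] subspace_carrier])
  have "\<forall>\<^sub>F N in sequentially. \<forall>p\<in>?P.
      Y (act (snd p) v) l (act (fst p) u) = ?skew N (act (fst p) u) (act (snd p) v)"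
    by (intro eventually_ball_finite ballI finite_keys e act_parity u v) (use P in auto)
  then have "\<forall>\<^sub>F N in sequentially. Y v l u = ?skew N u v \<and> (\<forall>p\<in>?P.
      Y (act (snd p) v) l (act (fst p) u) = ?skew N (act (fst p) u) (act (snd p) v))"
    by (rule eventually_conj[OF e[OF u v]])
  then obtain N where N: "Y v l u = ?skew N u v"
    "\<And>p. p \<in> ?P \<Longrightarrow> Y (act (snd p) v) l (act (fst p) u) = ?skew N (act (fst p) u) (act (snd p) v)"
    using eventually_happens'[OF sequentially_bot] by blast
  note lin = clinear_act[OF h]
  have "sw h (\<lambda>a b. Y (act a v) l (act b u)) = act h (?skew N u v)"
    using act_Y[OF h, of v l u] N(1) by simp
  also have "\<dots> = e *\<^sub>C (\<Sum>i<N. (-1) ^ i *\<^sub>C Y (act h (Y u (l + int i) v)) (- 1 - int i) vac)"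
    by (simp add: clinear_on_scale[OF lin] clinear_on_sum[OF lin cvs.subspace_UNIV] act_Y_vac[OF h])
  also have "\<dots> = sw h (\<lambda>a b. ?skew N (act a u) (act b v))"
    unfolding tensor_lift_scale tensor_lift_sum act_Y[OF h]
    by (intro arg_cong[of _ _ "(*\<^sub>C) e"] sum.cong refl arg_cong[of _ _ "(*\<^sub>C) ((-1) ^ _)"]
        sw_linear[OF h clinear_on_Y_left cvs.subspace_UNIV]) simp
  also have "\<dots> = sw h (\<lambda>a b. Y (act b v) l (act a u))"
    unfolding tensor_lift_rep by (rule sum.cong) (simp_all add: N(2))
  finally show ?thesis .
qed

lemma sw_act_Y_swap:
  assumes h: "h \<in> carrier H"
  shows "sw h (\<lambda>a b. Y (act a v) l (act b u)) = sw h (\<lambda>a b. Y (act b v) l (act a u))"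
proof -
  obtain u0 u1 v0 v1 where uv: "u = u0 + u1" "v = v0 + v1"
    "u0 \<in> par 0" "u1 \<in> par 1" "v0 \<in> par 0" "v1 \<in> par 1"
    using par_sum by metis
  note swap = sw_act_Y_swap_homogeneous[OF h]
  have "sw h (\<lambda>a b. Y (act a v) l (act b u)) =
      sw h (\<lambda>a b. (Y (act a v0) l (act b u0) + Y (act a v0) l (act b u1)) +
        (Y (act a v1) l (act b u0) + Y (act a v1) l (act b u1)))"
    by (rule sw_cong[OF h]) (simp add: uv(1,2) act_linear Y_linear)
  also have "\<dots> =
      sw h (\<lambda>a b. (Y (act b v0) l (act a u0) + Y (act b v0) l (act a u1)) +
        (Y (act b v1) l (act a u0) + Y (act b v1) l (act a u1)))"
    unfolding tensor_lift_add using swap uv(3-) by simp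
  also have "\<dots> = sw h (\<lambda>a b. Y (act b v) l (act a u))"
    by (rule sw_cong[OF h]) (simp add: uv(1,2) act_linear Y_linear)
  finally show ?thesis .
qed

text \<open>The condition on the counit makes one statement fit both cases: for V \<noteq> 0 it
  follows from annihilating the vacuum, and for V = 0 it is the only condition with content. It
  suits differences of group-likes, whose counit is 0.\<close>

lemma counit_act_kernel_trivial_cocommutative:
  assumes fd: "finite_dim (carrier H)" and inner: "inner_faithful H act"
    and inj: "inj (vertex_map Y)"
  shows "{h \<in> carrier H. counit H h = 0 \<and> (\<forall>v. act h v = 0)} = {0}" and cocommutative
proof -
  have 0: "counit H 0 = 0" "act 0 v = 0" for v
    using counit_zero clinear_on_zero[OF clinear_on_act cvs.subspace_0[OF subspace_carrier]] by auto
  have "{h \<in> carrier H. counit H h = 0 \<and> (\<forall>v. act h v = 0)} = {0} \<and> cocommutative"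
  proof (cases "vac = 0")
    case True
    then have V: "v = 0" for v :: 'v by (rule vacuum_zero)
    \<comment> \<open>The counit regarded as a family with one member, which is the form that
      \<open>hopf_ideal_kernel\<close> expects. The kernel is the augmentation ideal.\<close>
    define K where "K = {h \<in> carrier H. \<forall>i::unit. counit H h = 0}"
    have bl: "bilinear_on (carrier H) (carrier H) (\<lambda>a b. counit H a \<otimes>\<^sub>C counit H b)"
      by (rule bilinear_onI) (simp_all add: counit_simps tens_linear)
    have "hopf_ideal H K"
    proof (rule hopf_ideal_kernel[OF fd counit_linear K_def])
      show "x \<otimes> h \<in> K \<and> h \<otimes> x \<in> K" if "x \<in> K" "h \<in> carrier H" for x h
        using that by (simp add: K_def counit_mult)
      fix x and i j :: unit assume x: "x \<in> K"
      then show "counit H x = 0" by (simp add: K_def)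
      have xC: "x \<in> carrier H" using x by (simp add: K_def)
      have lin: "clinear_on (carrier H) (\<lambda>b. 1 \<otimes>\<^sub>C counit H b)"
        by (simp add: clinear_on_def counit_simps tens_linear)
      have "sw x (\<lambda>a b. counit H a \<otimes>\<^sub>C counit H b) = sw x (\<lambda>a b. 1 \<otimes>\<^sub>C counit H (counit H a *\<^sub>C b))"
      proof (rule sw_cong[OF xC])
        fix a b assume "a \<in> carrier H" "b \<in> carrier H"
        have "counit H a \<otimes>\<^sub>C counit H b = (counit H a *\<^sub>C 1) \<otimes>\<^sub>C counit H b"
          by (simp add: scaleC_complex_def)
        also have "\<dots> = 1 \<otimes>\<^sub>C counit H (counit H a *\<^sub>C b)"
          using \<open>b \<in> carrier H\<close> by (simp only: tens_linear counit_simps)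
        finally show "counit H a \<otimes>\<^sub>C counit H b = 1 \<otimes>\<^sub>C counit H (counit H a *\<^sub>C b)" .
      qed
      also have "\<dots> = 1 \<otimes>\<^sub>C counit H (sw x (\<lambda>a b. counit H a *\<^sub>C b))"
        by (rule sw_linear[OF xC lin subspace_carrier, symmetric]) (rule carrier_scale)
      finally show "sw x (\<lambda>a b. counit H a \<otimes>\<^sub>C counit H b) = 0"
        using x by (simp add: counit_left[OF xC] K_def)
    qed
    then have K0: "K = {0}" using inner V unfolding inner_faithful_def by metis
    have cocommutative
    proof (rule cocommutative_if_separating[OF fd, of "\<lambda>_::unit. counit H", OF counit_linear])
      show "{0} = {h \<in> carrier H. \<forall>i::unit. counit H h = 0}" using K0 by (simp add: K_def)
      fix h assume h: "h \<in> carrier H"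
      show "sw h (\<lambda>a b. counit H a \<otimes>\<^sub>C counit H b) = sw h (\<lambda>a b. counit H b \<otimes>\<^sub>C counit H a)"
      proof (rule sw_cong[OF h])
        fix a b
        have "counit H a \<otimes>\<^sub>C counit H b = (counit H a *\<^sub>C 1) \<otimes>\<^sub>C (counit H b *\<^sub>C 1)"
          by (simp add: scaleC_complex_def)
        also have "\<dots> = (counit H b *\<^sub>C 1) \<otimes>\<^sub>C (counit H a *\<^sub>C 1)"
          by (simp only: tens_linear cvs.scale_scale mult.commute)
        finally show "counit H a \<otimes>\<^sub>C counit H b = counit H b \<otimes>\<^sub>C counit H a"
          by (simp add: scaleC_complex_def)
      qed
    qed
    moreover have "{h \<in> carrier H. counit H h = 0 \<and> (\<forall>v. act h v = 0)} = K"
      using V by (auto simp: K_def)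
    ultimately show ?thesis using K0 by simp
  next
    case False
    define K where "K = {h \<in> carrier H. \<forall>v. act h v = 0}"
    have counitK: "counit H x = 0" if "x \<in> K" for x
    proof -
      have "counit H x *\<^sub>C vac = 0" using act_vac[of x] that by (simp add: K_def)
      then show ?thesis using False by simp
    qed
    have "hopf_ideal H K"
    proof (rule hopf_ideal_kernel[OF fd clinear_on_act K_def])
      show "x \<otimes> h \<in> K \<and> h \<otimes> x \<in> K" if "x \<in> K" "h \<in> carrier H" for x h
        using that clinear_on_zero[OF clinear_act UNIV_I] by (simp add: K_def act_mult)
      show "counit H x = 0" if "x \<in> K" for x using that by (rule counitK)
      fix x u v assume x: "x \<in> K"
      then have xC: "x \<in> carrier H" by (simp add: K_def)
      have "sw x (\<lambda>a b. act a u \<otimes>\<^sub>C act b v) = sw x (\<lambda>a b. 0 \<otimes>\<^sub>C 0)"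
      proof (rule vertex_map_inj_eqI[OF inj comult_in[OF xC] subspace_carrier])
        fix n
        have "sw x (\<lambda>a b. Y (act a u) n (act b v)) = 0"
          using act_Y[OF xC, of u n v] x by (simp add: K_def)
        then show "sw x (\<lambda>a b. Y (act a u) n (act b v)) = sw x (\<lambda>a b. Y 0 n 0)"
          by (simp add: tensor_lift_zero)
      qed
      then show "sw x (\<lambda>a b. act a u \<otimes>\<^sub>C act b v) = 0" by (simp add: tensor_lift_zero)
    qed
    moreover have "\<not> (\<exists>h\<in>K. \<exists>v. act h v \<noteq> 0)" by (simp add: K_def)
    ultimately have K0: "K = {0}" using inner unfolding inner_faithful_def by blast
    have cocommutative
    proof (rule cocommutative_if_separating[OF fd clinear_on_act])
      show "{0} = {h \<in> carrier H. \<forall>v. act h v = 0}" using K0 by (simp add: K_def)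
      fix h u v assume h: "h \<in> carrier H"
      show "sw h (\<lambda>a b. act a u \<otimes>\<^sub>C act b v) = sw h (\<lambda>a b. act b u \<otimes>\<^sub>C act a v)"
        by (rule vertex_map_inj_eqI[OF inj comult_in[OF h] subspace_carrier])
          (rule sw_act_Y_swap[OF h])
    qed
    moreover have "{h \<in> carrier H. counit H h = 0 \<and> (\<forall>v. act h v = 0)} = K"
      using counitK by (auto simp: K_def)
    ultimately show ?thesis using K0 by simp
  qed
  then show "{h \<in> carrier H. counit H h = 0 \<and> (\<forall>v. act h v = 0)} = {0}" and cocommutative
    by blast+
qed

section \<open>Group-like elements as automorphisms\<close>

lemma act_grouplike_vertex_aut:
  assumes g: "g \<in> grouplikes"
  shows "act g \<in> carrier (vertex_aut par Y vac)"
proof -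
  let ?g' = "antipode H g"
  note C = grouplikesD(1)[OF g] grouplikesD(1)[OF antipode_grouplike[OF g]]
  have inv: "act ?g' (act g v) = v" "act g (act ?g' v) = v" for v
    using act_mult[OF C(2,1), of v] act_mult[OF C, of v] antipode_grouplike_mult[OF g]
    by (simp_all add: act_one)
  have "bij (act g)" using inv by (intro o_bij[of "act ?g'"]) (auto simp: fun_eq_iff)
  moreover have inv_eq: "inv_into UNIV (act g) = act ?g'"
    by (rule inv_equality) (simp_all add: inv)
  moreover have "act g (Y u n v) = Y (act g u) n (act g v)" for u n v
  proof -
    have "bilinear_on (carrier H) (carrier H) (\<lambda>a b. Y (act a u) n (act b v))"
      by (rule bilinear_onI) (simp_all add: act_linear Y_linear)
    then show ?thesis using act_Y[OF C(1)] sw_grouplike[OF g] by simp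
  qed
  ultimately show ?thesis
    using clinear_act[OF C(1)] act_parity[OF C(1)] act_vac[OF C(1)] grouplikesD(2)[OF g] inv
    by (auto simp: vertex_aut_def fun_eq_iff)
qed

lemma act_comp: "h \<in> carrier H \<Longrightarrow> k \<in> carrier H \<Longrightarrow> act (h \<otimes> k) = act h \<circ> act k"
  by (simp add: fun_eq_iff act_mult)

text \<open>\<open>m_inv\<close> depends on the carrier, and two carriers occur: all automorphisms,
  for closure of the subgroup under inverses, and the image of the group-likes, for the antipode of
  the group algebra. In both, an inverse under composition is unique.\<close>

lemma act_grouplike_inv:
  assumes g: "g \<in> grouplikes" and M: "carrier M = act ` grouplikes \<or> carrier M = carrier (vertex_aut par Y vac)"
    and M': "monoid.mult M = (\<circ>)" "monoid.one M = id"
  shows "inv\<^bsub>M\<^esub> (act g) = act (antipode H g)"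
proof -
  let ?g' = "antipode H g"
  note g' = antipode_grouplike[OF g]
  note C = grouplikesD(1)[OF g] grouplikesD(1)[OF g']
  have inv: "act ?g' \<circ> act g = id" "act g \<circ> act ?g' = id"
    using act_comp[OF C(2,1)] act_comp[OF C] antipode_grouplike_mult[OF g]
    by (simp_all add: fun_eq_iff act_one)
  show ?thesis
    unfolding m_inv_def M'
  proof (rule the_equality)
    show "act ?g' \<in> carrier M \<and> act g \<circ> act ?g' = id \<and> act ?g' \<circ> act g = id"
      using M act_grouplike_vertex_aut[OF g'] g' inv by auto
    fix y assume "y \<in> carrier M \<and> act g \<circ> y = id \<and> y \<circ> act g = id"
    then have "y = (act ?g' \<circ> act g) \<circ> y" "act g \<circ> y = id" using inv by simp_all
    then show "y = act ?g'" by (simp add: comp_assoc)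
  qed
qed

end

theorem theorem5p12:
  fixes H :: "'h::complex_vector hopf"
    and par :: "bit \<Rightarrow> 'v::complex_vector set"
    and Y :: "'v \<Rightarrow> int \<Rightarrow> 'v \<Rightarrow> 'v"
    and vac :: 'v
    and act :: "'h \<Rightarrow> 'v \<Rightarrow> 'v"
  assumes "hopf_algebra H"
    and "finite_dim (carrier H)"
    and "hopf_module_vertex_superalgebra H par Y vac act"
    and "inner_faithful H act"
    and "inj (vertex_map Y)"
  shows "\<exists>G. subgroup G (vertex_aut par Y vac) \<and> finite G \<and>
    hopf_isomorphic H (group_algebra ((vertex_aut par Y vac)\<lparr>carrier := G\<rparr>))"
proof -
  interpret hopf_module_vertex_superalgebra H par Y vac act by fact
  let ?V = "vertex_aut par Y vac" and ?G = "act ` grouplikes"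
  let ?A = "?V\<lparr>carrier := ?G\<rparr>"
  have V: "monoid.mult ?V = (\<circ>)" "monoid.one ?V = id" by (simp_all add: vertex_aut_def)
  have kernel: "{h \<in> carrier H. counit H h = 0 \<and> (\<forall>v. act h v = 0)} = {0}"
    and cc: cocommutative
    by (rule counit_act_kernel_trivial_cocommutative[OF assms(2,4,5)])+
  have GC: "grouplikes \<subseteq> carrier H" using grouplikesD(1) by blast
  have fin: "finite grouplikes"
    by (rule finite_independent_in[OF assms(2) GC independent_grouplikes])
  have one: "act \<one>\<^bsub>H\<^esub> = id" by (simp add: fun_eq_iff act_one)
  have inj: "inj_on act grouplikes"
  proof (rule inj_onI)
    fix g k assume g: "g \<in> grouplikes" and k: "k \<in> grouplikes" and eq: "act g = act k"
    note gk = grouplikesD(1,2)[OF g] grouplikesD(1,2)[OF k]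
    \<comment> \<open>Both group-likes have counit 1, so their difference has counit 0. This is what
      separates them from each other when V = 0 as well.\<close>
    have "g - k \<in> {h \<in> carrier H. counit H h = 0 \<and> (\<forall>v. act h v = 0)}"
      using gk eq
      by (simp add: carrier_diff counit_simps clinear_on_diff[OF clinear_on_act subspace_carrier])
    then show "g = k" using kernel by simp
  qed
  have "subgroup ?G ?V"
  proof
    show "?G \<subseteq> carrier ?V" using act_grouplike_vertex_aut by blast
    show "\<one>\<^bsub>?V\<^esub> \<in> ?G" using one_grouplike one V by (metis image_eqI)
    show "x \<otimes>\<^bsub>?V\<^esub> y \<in> ?G" if xy: "x \<in> ?G" "y \<in> ?G" for x y
    proof -
      obtain g k where "g \<in> grouplikes" "k \<in> grouplikes" "x = act g" "y = act k"
        using xy by blast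
      then show ?thesis using act_comp[of g k] mult_grouplike[of g k] grouplikesD(1) V by force
    qed
    show "inv\<^bsub>?V\<^esub> x \<in> ?G" if "x \<in> ?G" for x
      using that act_grouplike_inv[of _ ?V] antipode_grouplike V by auto
  qed
  moreover have "hopf_isomorphic H (group_algebra ?A)"
  proof (rule hopf_isomorphic_group_algebra[OF assms(2) span_grouplikes[OF assms(2) cc]])
    show "carrier ?A = act ` grouplikes" by simp
    show "act (g \<otimes>\<^bsub>H\<^esub> k) = act g \<otimes>\<^bsub>?A\<^esub> act k" if "g \<in> grouplikes" "k \<in> grouplikes" for g k
      using that grouplikesD(1) V by (simp add: act_comp)
    show "inv\<^bsub>?A\<^esub> (act g) = act (antipode H g)" if "g \<in> grouplikes" for g
      by (rule act_grouplike_inv[OF that]) (simp_all add: V)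
  qed (use inj one V in simp_all)
  ultimately show ?thesis using fin by blast
qed

end
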